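(* Let $S$ be a smooth projective surface with $H_1(S,\mathbb Z)=0$, $p_g(S)>0$, and such that the only Seiberg–Witten basic classes of $S$ are $0$ and $K_S\neq0$. Let $c_1\in H^2(S,\mathbb Z)$, and let $\Psi_{3,S,c_1}\in\mathbb Q(\sqrt3,i)[[q^{1/6}]]$, $\Psi_{4,S,c_1}\in\mathbb Q(\sqrt2,i)[[q^{1/8}]]$, $\Psi_{5,S,c_1}\in\mathbb Q(\epsilon_5,i)[[q^{1/10}]]$ be the series given by the explicit formulae in the context. Then, for the coefficientwise action of the Galois groups: - $\Psi_{3,S,c_1}$ is invariant under $\mathrm{Gal}(\mathbb Q(\sqrt3,i)/\mathbb Q)\cong\mathbb Z_2\times\mathbb Z_2$; - $\Psi_{4,S,c_1}$ is invariant under $\mathrm{Gal}(\mathbb Q(\sqrt2,i)/\mathbb Q)\cong\mathbb Z_2\times\mathbb Z_2$; - $\Psi_{5,S,c_1}$ is invariant under $\mathrm{Gal}(\mathbb Q(\epsilon_5,i)/\mathbb Q)\cong\mathbb Z_4\times\mathbb Z_2$. In particular, $\Psi_{3,S,c_1},\Psi_{4,S,c_1},\Psi_{5,S,c_1}$ have rational coefficients.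
   Context: Seiberg–Witten basic classes are the $\beta\in H^2(S,\mathbb Z)$ with nonzero Seiberg–Witten invariant; under the hypotheses the invariants of $0$ and $K_S$ are $1$ and $(-1)^{\chi(\mathcal O_S)}$. The series $\Psi_{r,S,c_1}$ depend on $S,c_1$ only through $\chi:=\chi(\mathcal O_S)$, $K^2:=K_S^2$ and the intersection number $Kc_1:=K_S\cdot c_1$. Notation: $\epsilon_r=e^{2\pi i/r}$; $\eta(q)=q^{1/24}\prod_{n\ge1}(1-q^n)$. Let $\langle\cdot,\cdot\rangle^\vee$ be the bilinear form on $\mathbb Z^m$ given by the inverse of the $A_m$ Cartan matrix (the matrix with $2$ on the diagonal, $-1$ for $|i-j|=1$, $0$ otherwise). For $\ell\in\mathbb Z$, $$\Theta_{A_m^\vee,\ell}(q)=\sum_{v\in\mathbb Z^m}e^{2\pi i\langle v,\ell(1,0,\dots,0)\rangle^\vee}q^{\frac12\langle v,v\rangle^\vee},\qquad t_{A_m^\vee,\ell}=\frac{\Theta_{A_m^\vee,0}}{\Theta_{A_m^\vee,\ell}}.$$ For a quadratic $aX^2+bX+c=0$ over power series, $X_\pm=\frac1{2a}(-b\pm\sqrt{b^2-4ac})$, where the square root of a series with positive leading coefficient is the one with positive leading coefficient. Rank 3: $$\Psi_{3,S,c_1}=t_{A_2^\vee,1}^{K^2}(X_+^{K^2}+X_-^{K^2})+(\epsilon_3^{Kc_1}+\epsilon_3^{-Kc_1})(-1)^\chi t_{A_2^\vee,1}^{K^2},$$ where $X_\pm$ are the roots of $X^2-4t_{A_2^\vee,1}^2X+4t_{A_2^\vee,1}=0$.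 Rank 4: with $v(q)=\eta(q^{1/2})\eta(q^{1/8})^2/\eta(q^{1/4})^3$, $$\begin{aligned}\Psi_{4,S,c_1}=&\Big(\tfrac{Z-Z^{-1}}{t_{A_3^\vee,2}^{-1}v^{-4}-Z^{-1}}\Big)^{K^2}+\Big(\tfrac{Z^{-1}-Z}{t_{A_3^\vee,2}^{-1}v^{-4}-Z}\Big)^{K^2}\\&+(-1)^{\chi+Kc_1}\Big\{\Big(\tfrac{Z-Z^{-1}}{t_{A_3^\vee,2}^{-1}Z-v^4}\Big)^{K^2}+\Big(\tfrac{Z^{-1}-Z}{t_{A_3^\vee,2}^{-1}Z^{-1}-v^4}\Big)^{K^2}\Big\}\\&+(i^{Kc_1}+i^{-Kc_1})t_{A_3^\vee,1}^{K^2}\{(1+v^{-4})^{K^2}+(-1)^\chi(v^4+1)^{K^2}\},\end{aligned}$$ where $Z$ is a solution of $Z-3(v^{-2}+v^2)+Z^{-1}=0$. Rank 5: let $r(q)=\cfrac{q^{1/5}}{1+\cfrac{q}{1+\cfrac{q^2}{1+\cdots}}}$ (Rogers–Ramanujan), $\varphi=\frac{1+\sqrt5}2$, $s=\frac{1-\varphi\,r(q)}{\varphi+r(q)}$, $\gamma_1=\frac1{25}t_{A_4^\vee,1}(3s^{-5}+2-8s^5)$, $\gamma_2=\frac1{25}t_{A_4^\vee,2}(8s^{-5}+2-3s^5)$. Then $$\begin{aligned}\Psi_{5,S,c_1}=&\Big(\tfrac{ZX_+^2Y_+^2}{\gamma_1\gamma_2}\Big)^{\frac{K^2}2}+\Big(\tfrac{X_+^2Y_-^2}{Z\gamma_1\gamma_2}\Big)^{\frac{K^2}2}+\Big(\tfrac{X_-^2Y_+^2}{Z\gamma_1\gamma_2}\Big)^{\frac{K^2}2}+\Big(\tfrac{ZX_-^2Y_-^2}{\gamma_1\gamma_2}\Big)^{\frac{K^2}2}\\&+(\epsilon_5^{Kc_1}+\epsilon_5^{-Kc_1})\{\gamma_1^{K^2}+(-1)^\chi(X_+^{K^2}+X_-^{K^2})\}\\&+(\epsilon_5^{2Kc_1}+\epsilon_5^{-2Kc_1})\{\gamma_2^{K^2}+(-1)^\chi(Y_+^{K^2}+Y_-^{K^2})\},\end{aligned}$$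 where $X_\pm$, $Y_\pm$ are the solutions of $$X^2-\tfrac45\gamma_1(\gamma_1t_{A_4^\vee,1}^{-1}-1)(3s^{-5}+1)X+\tfrac45\gamma_1^2(3s^{-5}+1)=0,$$ $$Y^2-\tfrac45\gamma_2(\gamma_2t_{A_4^\vee,2}^{-1}-1)(1-3s^5)Y+\tfrac45\gamma_2^2(1-3s^5)=0,$$ and $Z$ is the solution of $Z-\frac6{25}(8s^{-5}-13-8s^5)+Z^{-1}=0$ with constant term $9+4\sqrt5$. A power $F^{K^2/2}$ means $(\sqrt F)^{K^2}$ with $\sqrt F$ the square root with positive leading coefficient. *)

theory Defs
  imports
    "HOL-Analysis.Analysis"
    "HOL-Algebra.Generated_Fields"
    "HOL-Algebra.Elementary_Groups"
    "HOL-Algebra.Bij"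
    "HOL-Algebra.Algebraic_Closure_Type"
    "HOL-Homology.Homology"
    "HOL-Computational_Algebra.Formal_Power_Series"
    "Jordan_Normal_Form.Gauss_Jordan_Elimination"
begin

section \<open>Surfaces\<close>

text \<open>
  Smooth projective surfaces and Seiberg--Witten theory are not available, so a surface \<open>S\<close> enters
  through the data that the statement refers to: the underlying topological space (type \<open>'x\<close> of
  points), the group \<open>H\<^sup>2(S, \<int>)\<close> (the type \<open>'h\<close>) with its intersection form, the canonical class,
  \<open>p\<^sub>g = h\<^sup>0(K)\<close>, \<open>q = h\<^sup>1(\<O>)\<close>, and the Seiberg--Witten invariants as a function on \<open>H\<^sup>2(S, \<int>)\<close>.
  Every smooth projective surface provides such data and satisfies \<open>surface_axioms\<close>
  (\<open>q = 0\<close> if \<open>H\<^sub>1 = 0\<close> because \<open>b\<^sub>1 = 2q\<close>).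
\<close>

record ('x, 'h) surface_data =
  surf_space :: "'x topology"
  intersect :: "'h \<Rightarrow> 'h \<Rightarrow> int"
  canonical :: 'h
  geometric_genus :: nat
  irregularity :: nat
  SW :: "'h \<Rightarrow> int"

definition H1_trivial :: "('x, 'h) surface_data \<Rightarrow> bool" where
  "H1_trivial S \<longleftrightarrow> trivial_group (homology_group 1 (surf_space S))"

definition surface_axioms :: "('x, 'h::ab_group_add) surface_data \<Rightarrow> bool" where
  "surface_axioms S \<longleftrightarrow>
     (\<forall>a b. intersect S a b = intersect S b a) \<and>
     (\<forall>a b c. intersect S (a + b) c = intersect S a c + intersect S b c) \<and>
     (H1_trivial S \<longrightarrow> irregularity S = 0)"

definition basic_classes :: "('x, 'h) surface_data \<Rightarrow> 'h set" where
  "basic_classes S = {b. SW S b \<noteq> 0}"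

definition holomorphic_euler :: "('x, 'h) surface_data \<Rightarrow> int" where
  "holomorphic_euler S = 1 - int (irregularity S) + int (geometric_genus S)"

definition canonical_degree :: "('x, 'h) surface_data \<Rightarrow> 'h \<Rightarrow> int" where
  "canonical_degree S c = intersect S (canonical S) c"

definition canonical_square :: "('x, 'h) surface_data \<Rightarrow> int" where
  "canonical_square S = canonical_degree S (canonical S)"


section \<open>Galois groups and their coefficientwise action\<close>

definition rat_adjoin :: "complex set \<Rightarrow> complex set" where
  "rat_adjoin A = generate_field ring_of_type_algebra A"

definition galois_group :: "complex set \<Rightarrow> complex set \<Rightarrow> (complex \<Rightarrow> complex) monoid" where
  "galois_group L K =
     (let R = ring_of_type_algebra\<lparr>carrier := L\<rparr>
      in (BijGroup L)\<lparr>carrier := {\<sigma> \<in> Bij L. \<sigma> \<in> Ring.ring_hom R R \<and> (\<forall>x\<in>K. \<sigma> x = x)}\<rparr>)"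

definition coeffwise :: "(complex \<Rightarrow> complex) \<Rightarrow> complex fps \<Rightarrow> complex fps" where
  "coeffwise \<sigma> F = Abs_fps (\<lambda>n. \<sigma> (fps_nth F n))"

definition has_coeffs_in :: "complex fps \<Rightarrow> complex set \<Rightarrow> bool" where
  "has_coeffs_in F L \<longleftrightarrow> (\<forall>n. fps_nth F n \<in> L)"

definition galois_invariant :: "complex set \<Rightarrow> complex fps \<Rightarrow> bool" where
  "galois_invariant L F \<longleftrightarrow> (\<forall>\<sigma>\<in>carrier (galois_group L \<rat>). coeffwise \<sigma> F = F)"


section \<open>Series\<close>

text \<open>
  An element of \<open>\<complex>[[q\<^sup>1\<^sup>/\<^sup>N]]\<close> is represented as a formal power series in \<open>x = q\<^sup>1\<^sup>/\<^sup>N\<close>, i.e. \<open>q\<close> is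
  \<open>fps_X ^ N\<close>.  Ranks 3, 4, 5 use \<open>N = 6, 8, 10\<close>.
\<close>

definition cartan_A :: "nat \<Rightarrow> real mat" where
  "cartan_A m = Matrix.mat m m (\<lambda>(i, j). if i = j then 2 else if i = Suc j \<or> j = Suc i then -1 else 0)"

definition dual_form :: "nat \<Rightarrow> int Matrix.vec \<Rightarrow> int Matrix.vec \<Rightarrow> real" where
  "dual_form m v w =
     scalar_prod (map_vec real_of_int v)
       (mult_mat_vec (the (mat_inverse (cartan_A m))) (map_vec real_of_int w))"

text \<open>
  The coefficient of \<open>x\<^sup>n\<close> collects the finitely many \<open>v \<in> \<int>\<^sup>m\<close> with \<open>\<langle>v,v\<rangle>\<^sup>\<or>/2 = n/N\<close>; for
  \<open>(N, m) = (6, 2), (8, 3), (10, 4)\<close> all exponents lie in \<open>(1/N)\<int>\<close>, so no term is lost.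
\<close>

definition Theta_A :: "nat \<Rightarrow> nat \<Rightarrow> int \<Rightarrow> complex fps" where
  "Theta_A N m l = Abs_fps (\<lambda>n.
     \<Sum>v\<in>{v \<in> carrier_vec m. dual_form m v v / 2 = real n / real N}.
       exp (2 * of_real pi * \<i> * of_real (dual_form m v (smult_vec l (unit_vec m 0)))))"

definition t_A :: "nat \<Rightarrow> nat \<Rightarrow> int \<Rightarrow> complex fps" where
  "t_A N m l = Theta_A N m 0 / Theta_A N m l"

definition eps :: "nat \<Rightarrow> complex" where
  "eps r = exp (2 * of_real pi * \<i> / of_nat r)"

definition positive_lead :: "complex fps \<Rightarrow> bool" where
  "positive_lead F \<longleftrightarrow> (\<exists>c>0. fps_nth F (subdegree F) = complex_of_real c)"

definition sqrt_fps :: "complex fps \<Rightarrow> complex fps" where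
  "sqrt_fps F = (THE G. G ^ 2 = F \<and> positive_lead G)"

definition root_plus :: "complex fps \<Rightarrow> complex fps \<Rightarrow> complex fps \<Rightarrow> complex fps" where
  "root_plus a b c = (- b + sqrt_fps (b ^ 2 - 4 * a * c)) / (2 * a)"

definition root_minus :: "complex fps \<Rightarrow> complex fps \<Rightarrow> complex fps \<Rightarrow> complex fps" where
  "root_minus a b c = (- b - sqrt_fps (b ^ 2 - 4 * a * c)) / (2 * a)"

text \<open>
  In the arguments of \<open>Psi3\<close>, \<open>Psi4\<close>, \<open>Psi5\<close>, \<open>chi\<close>, \<open>K2\<close>, \<open>Kc\<close> stand for \<open>\<chi>(\<O>\<^sub>S)\<close>, \<open>K\<^sub>S\<^sup>2\<close>,
  \<open>K\<^sub>S \<cdot> c\<^sub>1\<close>.  All series raised to possibly negative powers or inverted below have nonzero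
  constant term, so \<open>inverse\<close>, \<open>/\<close> and \<open>powi\<close> have their usual meaning.
\<close>

definition Psi3 :: "int \<Rightarrow> int \<Rightarrow> int \<Rightarrow> complex fps" where
  "Psi3 chi K2 Kc =
    (let t = t_A 6 2 1;
         Xp = root_plus 1 (- 4 * t ^ 2) (4 * t);
         Xm = root_minus 1 (- 4 * t ^ 2) (4 * t)
     in t powi K2 * (Xp powi K2 + Xm powi K2)
        + fps_const ((eps 3 powi Kc + eps 3 powi (- Kc)) * (-1) powi chi) * t powi K2)"

text \<open>
  \<open>\<Prod>n\<ge>1. (1 - x\<^sup>k\<^sup>n)\<close>, which is \<open>\<eta>(x\<^sup>k)\<close> without its factor \<open>x\<^sup>k\<^sup>/\<^sup>2\<^sup>4\<close>.  With \<open>x = q\<^sup>1\<^sup>/\<^sup>8\<close> the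
  prefactors in \<open>v = \<eta>(q\<^sup>1\<^sup>/\<^sup>2) \<eta>(q\<^sup>1\<^sup>/\<^sup>8)\<^sup>2 / \<eta>(q\<^sup>1\<^sup>/\<^sup>4)\<^sup>3\<close> multiply to \<open>x\<close> to the power
  \<open>(4 + 2 \<cdot> 1 - 3 \<cdot> 2) / 24 = 0\<close>.
\<close>

definition eta_prod :: "nat \<Rightarrow> complex fps" where
  "eta_prod k = prodinf (\<lambda>n. 1 - fps_X ^ (k * Suc n))"

definition v_ser :: "complex fps" where
  "v_ser = eta_prod 4 * eta_prod 1 ^ 2 / eta_prod 2 ^ 3"

text \<open>The condition on \<open>Z\<close> forces a nonzero constant term, since \<open>inverse\<close> of a non-unit is \<open>0\<close>
  and \<open>v_ser\<close> has constant term \<open>1\<close>.\<close>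

definition is_Z4 :: "complex fps \<Rightarrow> bool" where
  "is_Z4 Z \<longleftrightarrow> Z - 3 * (v_ser powi (-2) + v_ser ^ 2) + inverse Z = 0"

definition Psi4 :: "complex fps \<Rightarrow> int \<Rightarrow> int \<Rightarrow> int \<Rightarrow> complex fps" where
  "Psi4 Z chi K2 Kc =
    (let t1 = t_A 8 3 1; t2 = t_A 8 3 2; v = v_ser; Zi = inverse Z
     in ((Z - Zi) / (inverse t2 * v powi (-4) - Zi)) powi K2
        + ((Zi - Z) / (inverse t2 * v powi (-4) - Z)) powi K2
        + fps_const ((-1) powi (chi + Kc)) *
            (((Z - Zi) / (inverse t2 * Z - v ^ 4)) powi K2
             + ((Zi - Z) / (inverse t2 * Zi - v ^ 4)) powi K2)
        + fps_const (\<i> powi Kc + \<i> powi (- Kc)) * t1 powi K2 *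
            ((1 + v powi (-4)) powi K2 + fps_const ((-1) powi chi) * (v ^ 4 + 1) powi K2))"

text \<open>Rogers--Ramanujan continued fraction in \<open>x = q\<^sup>1\<^sup>/\<^sup>1\<^sup>0\<close>:  \<open>rr_denom n k\<close> is
  \<open>1 + q\<^sup>k\<^sup>+\<^sup>1/(1 + q\<^sup>k\<^sup>+\<^sup>2/(1 + \<dots>))\<close> truncated after \<open>n\<close> levels.\<close>

fun rr_denom :: "nat \<Rightarrow> nat \<Rightarrow> complex fps" where
  "rr_denom 0 k = 1"
| "rr_denom (Suc n) k = 1 + fps_X ^ (10 * Suc k) / rr_denom n (Suc k)"

definition rr_ser :: "complex fps" where
  "rr_ser = lim (\<lambda>n. fps_X ^ 2 / rr_denom n 0)"

definition golden :: complex where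
  "golden = of_real ((1 + sqrt 5) / 2)"

definition s_ser :: "complex fps" where
  "s_ser = (1 - fps_const golden * rr_ser) / (fps_const golden + rr_ser)"

definition gamma1 :: "complex fps" where
  "gamma1 = fps_const (1/25) * t_A 10 4 1 * (3 * s_ser powi (-5) + 2 - 8 * s_ser ^ 5)"

definition gamma2 :: "complex fps" where
  "gamma2 = fps_const (1/25) * t_A 10 4 2 * (8 * s_ser powi (-5) + 2 - 3 * s_ser ^ 5)"

definition Z5 :: "complex fps" where
  "Z5 = (THE Z. Z - fps_const (6/25) * (8 * s_ser powi (-5) - 13 - 8 * s_ser ^ 5) + inverse Z = 0
              \<and> fps_nth Z 0 = of_real (9 + 4 * sqrt 5))"

definition Psi5 :: "int \<Rightarrow> int \<Rightarrow> int \<Rightarrow> complex fps" where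
  "Psi5 chi K2 Kc =
    (let Z = Z5; g1 = gamma1; g2 = gamma2;
         A = 3 * s_ser powi (-5) + 1;
         B = 1 - 3 * s_ser ^ 5;
         bX = - (fps_const (4/5) * g1 * (g1 * inverse (t_A 10 4 1) - 1) * A);
         cX = fps_const (4/5) * g1 ^ 2 * A;
         bY = - (fps_const (4/5) * g2 * (g2 * inverse (t_A 10 4 2) - 1) * B);
         cY = fps_const (4/5) * g2 ^ 2 * B;
         Xp = root_plus 1 bX cX; Xm = root_minus 1 bX cX;
         Yp = root_plus 1 bY cY; Ym = root_minus 1 bY cY
     in sqrt_fps (Z * Xp ^ 2 * Yp ^ 2 / (g1 * g2)) powi K2
        + sqrt_fps (Xp ^ 2 * Ym ^ 2 / (Z * g1 * g2)) powi K2
        + sqrt_fps (Xm ^ 2 * Yp ^ 2 / (Z * g1 * g2)) powi K2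
        + sqrt_fps (Z * Xm ^ 2 * Ym ^ 2 / (g1 * g2)) powi K2
        + fps_const (eps 5 powi Kc + eps 5 powi (- Kc)) *
            (g1 powi K2 + fps_const ((-1) powi chi) * (Xp powi K2 + Xm powi K2))
        + fps_const (eps 5 powi (2 * Kc) + eps 5 powi (- (2 * Kc))) *
            (g2 powi K2 + fps_const ((-1) powi chi) * (Yp powi K2 + Ym powi K2)))"

end

(*
  It suffices that all coefficients are rational: they then lie in L and are fixed by every
  automorphism of L.

  Ranks 3 and 4: the theta coefficients are sums of cos(2 pi k/3), resp. cos(2 pi k/4), hence rational,
  and the irrational series enter only through power sums U^n + V^n with U + V and U V rational.

  Rank 5: the conjugation of Q(sqrt 5) exchanges t_1 and t_2 and maps s to -1/s, hence it exchanges
  gamma_1 and gamma_2 and the two quadratic equations, and maps Z to 1/Z.  The discriminants of the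
  equations start with (10000 + 4000 sqrt 5) x^2 and (10000 - 4000 sqrt 5) x^2.  The product of these
  coefficients is 5 * 2000^2, so the product of the two square roots changes sign.  This makes
  X_+ Y_+ and X_- Y_- on the one hand and X_+ Y_- and X_- Y_+ on the other the roots of conjugate
  quadratics, and the first four terms of Psi_5 are exchanged in pairs.

  The automorphisms of the three fields are obtained by adjoining square roots one at a time to the
  identity of Q.  For Q(eps_5, i) = Q(kappa, i), kappa = 2 sin(2 pi/5), the generator of order 4
  sends kappa to sqrt 5/kappa.
*)

theory Submission
  imports Defs "Jordan_Normal_Form.Determinant"
begin

section \<open>Isomorphisms between subfields, and series\<close>

text \<open>\<open>R\<close> is the graph of an isomorphism between two subfields. With the identity of \<open>\<rat>\<close> the closure
  rules below express rationality, with the conjugation of \<open>\<rat>(\<surd>5)\<close> they express conjugacy.\<close>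

locale field_iso =
  fixes R :: "'a::field \<Rightarrow> 'a \<Rightarrow> bool"
  assumes one: "R 1 1"
    and diff: "R a a' \<Longrightarrow> R b b' \<Longrightarrow> R (a - b) (a' - b')"
    and mult: "R a a' \<Longrightarrow> R b b' \<Longrightarrow> R (a * b) (a' * b')"
    and inverse: "R a a' \<Longrightarrow> R (inverse a) (inverse a')"
    and zero_iff: "R a a' \<Longrightarrow> a = 0 \<longleftrightarrow> a' = 0"
begin

lemma zero: "R 0 0"
  using diff[OF one one] by simp

lemma minus: "R a a' \<Longrightarrow> R (- a) (- a')"
  using diff[OF zero] by fastforce

lemma add: "R a a' \<Longrightarrow> R b b' \<Longrightarrow> R (a + b) (a' + b')"
  using diff[OF _ minus] by fastforce

lemma divide: "R a a' \<Longrightarrow> R b b' \<Longrightarrow> R (a / b) (a' / b')"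
  by (simp add: divide_inverse mult inverse)

lemma power: "R a a' \<Longrightarrow> R (a ^ n) (a' ^ n)"
  by (induction n) (auto intro: one mult)

lemma of_nat: "R (of_nat n) (of_nat n)"
  by (induction n) (auto intro: zero one add)

lemma of_int: "R (of_int n) (of_int n)"
  by (cases n rule: int_diff_cases) (auto intro: diff of_nat)

lemma numeral: "R (numeral n) (numeral n)"
  using of_nat[of "numeral n"] by simp

lemma sum: "(\<And>x. x \<in> A \<Longrightarrow> R (f x) (g x)) \<Longrightarrow> R (sum f A) (sum g A)"
  by (induction A rule: infinite_finite_induct) (auto intro: zero add)

lemma functional: "R a b \<Longrightarrow> R a c \<Longrightarrow> b = c"
  using zero_iff[OF diff[of a b a c]] by simp

lemma injective: "R a c \<Longrightarrow> R b c \<Longrightarrow> a = b"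
  using zero_iff[OF diff[of a c b c]] by simp

end

definition fps_rel :: "('a::field \<Rightarrow> 'a \<Rightarrow> bool) \<Rightarrow> 'a fps \<Rightarrow> 'a fps \<Rightarrow> bool" where
  "fps_rel R F G \<longleftrightarrow> (\<forall>n. R (fps_nth F n) (fps_nth G n))"

lemma fps_rel_nth: "fps_rel R F G \<Longrightarrow> R (fps_nth F n) (fps_nth G n)"
  by (simp add: fps_rel_def)

context field_iso
begin

lemma fps_const: "R a b \<Longrightarrow> fps_rel R (fps_const a) (fps_const b)"
  by (simp add: fps_rel_def zero)

lemma fps_one: "fps_rel R 1 1"
  using fps_const[OF one] by simp

lemma fps_zero: "fps_rel R 0 0"
  by (simp add: fps_rel_def zero)

lemma fps_numeral: "fps_rel R (numeral n) (numeral n)"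
  using fps_const[OF numeral] by (simp add: numeral_fps_const)

lemma fps_X: "fps_rel R fps_X fps_X"
  by (simp add: fps_rel_def fps_X_def zero one)

lemma fps_add: "fps_rel R F F' \<Longrightarrow> fps_rel R G G' \<Longrightarrow> fps_rel R (F + G) (F' + G')"
  by (simp add: fps_rel_def add)

lemma fps_diff: "fps_rel R F F' \<Longrightarrow> fps_rel R G G' \<Longrightarrow> fps_rel R (F - G) (F' - G')"
  by (simp add: fps_rel_def diff)

lemma fps_minus: "fps_rel R F F' \<Longrightarrow> fps_rel R (- F) (- F')"
  by (simp add: fps_rel_def minus)

lemma fps_mult: "fps_rel R F F' \<Longrightarrow> fps_rel R G G' \<Longrightarrow> fps_rel R (F * G) (F' * G')"
  by (simp add: fps_rel_def fps_mult_nth sum mult)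

lemma fps_power: "fps_rel R F F' \<Longrightarrow> fps_rel R (F ^ n) (F' ^ n)"
  by (induction n) (auto intro: fps_one fps_mult)

lemma fps_inverse:
  assumes "fps_rel R F F'"
  shows "fps_rel R (inverse F) (inverse F')"
proof -
  have "R (natfun_inverse F n) (natfun_inverse F' n)" for n
  proof (induction n rule: less_induct)
    case (less n)
    show ?case
      using less assms
      by (cases n) (auto intro!: mult minus add sum inverse intro: fps_rel_nth)
  qed
  then show ?thesis
    using zero_iff[OF fps_rel_nth[OF assms]]
    by (simp add: fps_rel_def fps_inverse_def zero)
qed

lemma fps_divide:
  assumes "fps_rel R F F'" "fps_rel R G G'" "fps_nth G 0 \<noteq> 0"
  shows "fps_rel R (F / G) (F' / G')"
proof -
  have "fps_nth G' 0 \<noteq> 0"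
    using zero_iff[OF fps_rel_nth[OF assms(2)]] assms(3) by blast
  with assms show ?thesis
    by (simp add: fps_divide_unit fps_mult fps_inverse)
qed

lemma fps_powi: "fps_rel R F F' \<Longrightarrow> fps_rel R (F powi n) (F' powi n)"
  by (simp add: power_int_def fps_power fps_inverse)

lemmas fps_intros =
  fps_const fps_one fps_zero fps_numeral fps_X fps_add fps_diff fps_minus fps_mult fps_power
  fps_inverse fps_divide fps_powi

text \<open>A square root is determined by its constant term, through a recursion for its coefficients.\<close>

lemma fps_sqrt:
  assumes two: "(2::'a) \<noteq> 0"
    and rel: "fps_rel R (F ^ 2) (F' ^ 2)" "R (fps_nth F 0) (fps_nth F' 0)"
    and "fps_nth F 0 \<noteq> 0"
  shows "fps_rel R F F'"
proof -
  have F'0: "fps_nth F' 0 \<noteq> 0"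
    using zero_iff[OF rel(2)] assms by blast
  have rec: "fps_nth G n = (fps_nth (G ^ 2) n - (\<Sum>i=1..<n. fps_nth G i * fps_nth G (n - i)))
      / (2 * fps_nth G 0)" if "fps_nth G 0 \<noteq> 0" "n > 0" for G :: "'a fps" and n
  proof -
    have "fps_nth (G ^ 2) n = (\<Sum>i=0..n. fps_nth G i * fps_nth G (n - i))"
      by (simp add: power2_eq_square fps_mult_nth)
    also have "{0..n} = insert 0 (insert n {1..<n})"
      using \<open>n > 0\<close> by auto
    also have "(\<Sum>i\<in>\<dots>. fps_nth G i * fps_nth G (n - i))
        = 2 * fps_nth G 0 * fps_nth G n + (\<Sum>i=1..<n. fps_nth G i * fps_nth G (n - i))"
      using \<open>n > 0\<close> by (simp add: algebra_simps)
    finally show ?thesis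
      using that two by (simp add: field_simps)
  qed
  have "R (fps_nth F n) (fps_nth F' n)" for n
  proof (induction n rule: less_induct)
    case (less n)
    show ?case
    proof (cases "n = 0")
      case False
      then show ?thesis
        unfolding rec[OF \<open>fps_nth F 0 \<noteq> 0\<close>, of n, OF False[unfolded neq0_conv]]
          rec[OF F'0, of n, OF False[unfolded neq0_conv]]
        by (intro divide diff mult sum numeral less rel fps_rel_nth[OF rel(1)]) auto
    qed (use rel in simp)
  qed
  then show ?thesis
    by (simp add: fps_rel_def)
qed

lemma fps_power_sum_nat:
  assumes "fps_rel R (U + V) (U' + V')" "fps_rel R (U * V) (U' * V')"
  shows "fps_rel R (U ^ k + V ^ k) (U' ^ k + V' ^ k)"
proof (induction k rule: less_induct)
  case (less k)
  have newton: "x ^ Suc (Suc n) + y ^ Suc (Suc n) = (x + y) * (x ^ Suc n + y ^ Suc n) - x * y * (x ^ n + y ^ n)"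
    for x y :: "'a fps" and n
    by (simp add: algebra_simps)
  consider "k = 0" | "k = 1" | n where "k = Suc (Suc n)"
    by (metis One_nat_def not0_implies_Suc)
  then show ?case
  proof cases
    case 3
    show ?thesis
      unfolding 3 newton
      by (rule fps_diff[OF fps_mult[OF assms(1) less] fps_mult[OF assms(2) less]]) (simp_all add: 3)
  qed (use assms in \<open>auto intro: fps_numeral\<close>)
qed

lemma fps_power_sum:
  assumes "fps_rel R (U + V) (U' + V')" "fps_rel R (U * V) (U' * V')"
    and unit: "fps_nth U 0 \<noteq> 0" "fps_nth V 0 \<noteq> 0"
  shows "fps_rel R (U powi k + V powi k) (U' powi k + V' powi k)"
proof (cases "k \<ge> 0")
  case True
  then show ?thesis
    using fps_power_sum_nat[OF assms(1,2)] by (simp add: power_int_def)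
next
  case False
  have sum_inverse: "inverse x + inverse y = (x + y) * inverse (x * y)"
    if "fps_nth x 0 \<noteq> 0" "fps_nth y 0 \<noteq> 0" for x y :: "'a fps"
    using inverse_mult_eq_1[OF that(1)] inverse_mult_eq_1[OF that(2)]
    by (simp add: fps_inverse_mult algebra_simps)
  have "fps_nth (U' * V') 0 \<noteq> 0"
    using zero_iff[OF fps_rel_nth[OF assms(2), of 0]] unit by simp
  then have unit': "fps_nth U' 0 \<noteq> 0" "fps_nth V' 0 \<noteq> 0"
    by auto
  have "fps_rel R (inverse U + inverse V) (inverse U' + inverse V')"
    unfolding sum_inverse[OF unit] sum_inverse[OF unit']
    by (intro fps_mult fps_inverse assms)
  moreover have "fps_rel R (inverse U * inverse V) (inverse U' * inverse V')"
    using fps_inverse[OF assms(2)] by (simp add: fps_inverse_mult)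
  ultimately show ?thesis
    using fps_power_sum_nat False by (simp add: power_int_def)
qed

end

definition rat_rel :: "complex \<Rightarrow> complex \<Rightarrow> bool" where
  "rat_rel a b \<longleftrightarrow> a \<in> \<rat> \<and> a = b"

interpretation rat: field_iso rat_rel
  by unfold_locales (auto simp: rat_rel_def)

lemma fps_rel_rat_rel_iff: "fps_rel rat_rel F G \<longleftrightarrow> has_coeffs_in F \<rat> \<and> F = G"
  by (auto simp: fps_rel_def rat_rel_def has_coeffs_in_def fps_eq_iff)

definition adjoin :: "('a \<Rightarrow> 'a \<Rightarrow> bool) \<Rightarrow> 'a::field \<Rightarrow> 'a \<Rightarrow> 'a \<Rightarrow> 'a \<Rightarrow> bool" where
  "adjoin R d e x y \<longleftrightarrow> (\<exists>a a' b b'. R a a' \<and> R b b' \<and> x = a + b * d \<and> y = a' + b' * e)"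

context field_iso
begin

lemma adjoinI: "R a a' \<Longrightarrow> R b b' \<Longrightarrow> x = a + b * d \<Longrightarrow> y = a' + b' * e \<Longrightarrow> adjoin R d e x y"
  by (auto simp: adjoin_def)

lemma adjoin_incl: "R a a' \<Longrightarrow> adjoin R d e a a'"
  using zero by (force simp: adjoin_def)

lemma adjoin_gen: "adjoin R d e d e"
  using zero one by (force simp: adjoin_def)

lemma field_iso_adjoin:
  assumes sq: "R (d ^ 2) (e ^ 2)"
    and d: "\<And>a. \<not> R d a" and e: "\<And>a. \<not> R a e"
  shows "field_iso (adjoin R d e)"
proof
  show "adjoin R d e 1 1"
    by (rule adjoin_incl[OF one])
next
  fix x x' y y'
  assume "adjoin R d e x x'" "adjoin R d e y y'"
  then obtain a a' b b' p p' q q' where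
    *: "R a a'" "R b b'" "R p p'" "R q q'" and
    eq: "x = a + b * d" "x' = a' + b' * e" "y = p + q * d" "y' = p' + q' * e"
    by (auto simp: adjoin_def)
  show "adjoin R d e (x - y) (x' - y')"
    by (rule adjoinI[OF diff[OF *(1,3)] diff[OF *(2,4)]]) (simp_all add: eq algebra_simps)
  have "R (a * p + b * q * d ^ 2) (a' * p' + b' * q' * e ^ 2)"
    by (intro add mult * sq)
  moreover have "R (a * q + b * p) (a' * q' + b' * p')"
    by (intro add mult * sq)
  ultimately show "adjoin R d e (x * y) (x' * y')"
    by (rule adjoinI) (simp_all add: eq algebra_simps power2_eq_square)
next
  fix x x'
  assume "adjoin R d e x x'"
  then obtain a a' b b' where
    *: "R a a'" "R b b'" and eq: "x = a + b * d" "x' = a' + b' * e"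
    by (auto simp: adjoin_def)
  have zeroD: "a = 0 \<and> b = 0" if "a + b * d = 0" "R a a'" "R b b'" for a a' b b'
  proof (cases "b = 0")
    case False
    then have "d = - a / b"
      using that by (simp add: field_simps add_eq_0_iff)
    then show ?thesis
      using d divide[OF minus[OF that(2)] that(3)] by blast
  qed (use that in auto)
  have zeroD': "a' = 0 \<and> b' = 0" if "a' + b' * e = 0" "R a a'" "R b b'" for a a' b b'
  proof (cases "b' = 0")
    case False
    then have "e = - a' / b'"
      using that by (simp add: field_simps add_eq_0_iff)
    then show ?thesis
      using e divide[OF minus[OF that(2)] that(3)] by blast
  qed (use that in auto)
  show iff: "x = 0 \<longleftrightarrow> x' = 0"
    using zeroD[OF _ *] zeroD'[OF _ *] zero_iff[OF *(1)] zero_iff[OF *(2)] eq by auto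
  show "adjoin R d e (inverse x) (inverse x')"
  proof (cases "x = 0")
    case True
    then show ?thesis
      using iff adjoin_incl[OF zero] by simp
  next
    case False
    define N where "N = a ^ 2 - b ^ 2 * d ^ 2"
    define N' where "N' = a' ^ 2 - b' ^ 2 * e ^ 2"
    have NN: "R N N'"
      unfolding N_def N'_def by (intro diff mult power * sq)
    have N: "N = x * (a - b * d)" and N': "N' = x' * (a' - b' * e)"
      by (simp_all add: N_def N'_def eq algebra_simps power2_eq_square)
    have "a - b * d \<noteq> 0"
      using zeroD[of a "- b", OF _ *(1) minus[OF *(2)]] False eq by auto
    then have "N \<noteq> 0"
      using False N by simp
    then have "N' \<noteq> 0"
      using zero_iff[OF NN] by simp
    show ?thesis
    proof (rule adjoinI[OF divide[OF *(1) NN] divide[OF minus[OF *(2)] NN]])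
      show "inverse x = a / N + - b / N * d"
        using N \<open>N \<noteq> 0\<close> False by (simp add: field_simps)
      show "inverse x' = a' / N' + - b' / N' * e"
        using N' \<open>N' \<noteq> 0\<close> False iff by (simp add: field_simps)
    qed
  qed
qed

end

section \<open>Theta series of dual root lattices\<close>

lemma mat_inverse_eqI:
  fixes A B :: "'a::field mat"
  assumes "A \<in> carrier_mat n n" "B \<in> carrier_mat n n" "A * B = 1\<^sub>m n"
  shows "mat_inverse A = Some B"
proof -
  have BA: "B * A = 1\<^sub>m n"
    using mat_mult_left_right_inverse assms by blast
  show ?thesis
  proof (cases "mat_inverse A")
    case None
    then have "A \<notin> Units (ring_mat TYPE('a) n ())"
      by (rule mat_inverse(1)[OF assms(1)])
    with assms BA show ?thesis
      by (auto simp: Units_def ring_mat_def)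
  next
    case (Some C)
    then have "C * A = 1\<^sub>m n" "C \<in> carrier_mat n n"
      using mat_inverse(2)[OF assms(1)] by auto
    then have "C = C * (A * B)"
      using assms by simp
    also have "\<dots> = B"
      using \<open>C * A = _\<close> \<open>C \<in> _\<close> assms by (metis assoc_mult_mat left_mult_one_mat)
    finally show ?thesis
      using Some by simp
  qed
qed

lemma mat_inverse_cartan_A:
  "mat_inverse (cartan_A m) = Some (Matrix.mat m m
    (\<lambda>(i, j). real ((min i j + 1) * (m - max i j)) / real (m + 1)))"
proof (rule mat_inverse_eqI)
  define c where "c = real m + 1"
  define h where "h i j = (real (min i j) + 1) * (real m - real (max i j))" for i j
  define g where "g i j = h i j / c" for i j
  have "cartan_A m * Matrix.mat m m (\<lambda>(i, j). g i j) = 1\<^sub>m m"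
  proof (rule eq_matI)
    fix i j
    assume "i < dim_row (1\<^sub>m m :: real mat)" "j < dim_col (1\<^sub>m m :: real mat)"
    then have ij: "i < m" "j < m"
      by auto
    have "(cartan_A m * Matrix.mat m m (\<lambda>(i, j). g i j)) $$ (i, j)
        = (\<Sum>k<m. (if i = k then 2 else if i = Suc k \<or> k = Suc i then -1 else 0) * g k j)"
      using ij by (simp add: cartan_A_def scalar_prod_def atLeast0LessThan)
    also have "\<dots> = (\<Sum>k<m. if k = i then 2 * g k j else 0) - (\<Sum>k<m. if Suc k = i then g k j else 0)
        - (\<Sum>k<m. if k = Suc i then g k j else 0)"
      unfolding sum_subtractf[symmetric] by (rule sum.cong) auto
    also have "(\<Sum>k<m. if Suc k = i then g k j else 0) = (if i = 0 then 0 else g (i - 1) j)"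
    proof (cases i)
      case (Suc i')
      then have "(\<Sum>k<m. if Suc k = i then g k j else 0) = (\<Sum>k<m. if k = i' then g k j else 0)"
        by (intro sum.cong) auto
      then show ?thesis
        using Suc ij by simp
    qed simp
    also have "(\<Sum>k<m. if k = Suc i then g k j else 0) = g (Suc i) j"
      using ij by (cases "Suc i = m") (auto simp: g_def h_def)
    also have "(\<Sum>k<m. if k = i then 2 * g k j else 0) = 2 * g i j"
      using ij by simp
    also have "2 * g i j - (if i = 0 then 0 else g (i - 1) j) - g (Suc i) j = (if i = j then 1 else 0)"
    proof -
      have "2 * h i j - (if i = 0 then 0 else h (i - 1) j) - h (Suc i) j = (if i = j then c else 0)"
        using ij by (cases i j rule: linorder_cases; cases i)
          (auto simp: h_def c_def min_def max_def algebra_simps less_Suc_eq)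
      moreover have "c \<noteq> 0"
        by (simp add: c_def)
      ultimately show ?thesis
        by (auto simp: g_def field_simps split: if_splits)
    qed
    finally show "(cartan_A m * Matrix.mat m m (\<lambda>(i, j). g i j)) $$ (i, j) = 1\<^sub>m m $$ (i, j)"
      using ij by simp
  qed (auto simp: cartan_A_def)
  moreover have "Matrix.mat m m (\<lambda>(i, j). g i j)
      = Matrix.mat m m (\<lambda>(i, j). real ((min i j + 1) * (m - max i j)) / real (m + 1))"
  proof (rule eq_matI)
    fix i j
    assume "i < dim_row (Matrix.mat m m (\<lambda>(i, j). real ((min i j + 1) * (m - max i j)) / real (m + 1)))"
      "j < dim_col (Matrix.mat m m (\<lambda>(i, j). real ((min i j + 1) * (m - max i j)) / real (m + 1)))"
    then have ij: "i < m" "j < m"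
      by auto
    have "real ((min i j + 1) * (m - max i j)) = h i j"
      unfolding h_def of_nat_mult using ij by (simp add: of_nat_diff)
    then show "Matrix.mat m m (\<lambda>(i, j). g i j) $$ (i, j)
        = Matrix.mat m m (\<lambda>(i, j). real ((min i j + 1) * (m - max i j)) / real (m + 1)) $$ (i, j)"
      using ij by (simp add: g_def c_def add.commute del: of_nat_mult)
  qed auto
  ultimately show "cartan_A m * Matrix.mat m m (\<lambda>(i, j). real ((min i j + 1) * (m - max i j)) / real (m + 1)) = 1\<^sub>m m"
    by simp
qed (auto simp: cartan_A_def)

lemma dual_form_cartan_A:
  assumes vw: "v \<in> carrier_vec m" "w \<in> carrier_vec m"
  shows "dual_form m v w = (\<Sum>i<m. \<Sum>j<m. real_of_int (vec_index v i * vec_index w j)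
    * real ((min i j + 1) * (m - max i j))) / real (m + 1)"
proof -
  have "dual_form m v w = (\<Sum>i<m. of_int (vec_index v i) * (\<Sum>j<m. real ((min i j + 1) * (m - max i j)) / real (m + 1)
     * of_int (vec_index w j)))"
    unfolding dual_form_def mat_inverse_cartan_A using vw
    by (auto simp: scalar_prod_def atLeast0LessThan intro!: sum.cong)
  then show ?thesis
    by (simp add: sum_distrib_left sum_divide_distrib mult_ac)
qed

definition weight_height :: "nat \<Rightarrow> int Matrix.vec \<Rightarrow> int" where
  "weight_height m v = (\<Sum>i<m. int (m - i) * vec_index v i)"

lemma dual_form_unit_vec:
  assumes "v \<in> carrier_vec m"
  shows "dual_form m v (smult_vec l (unit_vec m 0)) = of_int (l * weight_height m v) / real (m + 1)"
proof -
  have "(\<Sum>j<m. real_of_int (vec_index v i * vec_index (smult_vec l (unit_vec m 0)) j)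
      * real ((min i j + 1) * (m - max i j))) = of_int (l * (int (m - i) * vec_index v i))" if "i < m" for i
  proof -
    have "(\<Sum>j<m. real_of_int (vec_index v i * vec_index (smult_vec l (unit_vec m 0)) j)
      * real ((min i j + 1) * (m - max i j))) = (\<Sum>j<m. if j = 0 then real_of_int (vec_index v i * l)
      * real (m - i) else 0)"
      using that by (intro sum.cong) (auto simp: unit_vec_def)
    also have "\<dots> = of_int (l * (int (m - i) * vec_index v i))"
      using that by (simp add: mult_ac)
    finally show ?thesis .
  qed
  then show ?thesis
    using dual_form_cartan_A[OF assms]
    by (simp add: weight_height_def sum_distrib_left)
qed

lemma dual_form_uminus:
  assumes "v \<in> carrier_vec m" "w \<in> carrier_vec m"
  shows "dual_form m (- v) (- w) = dual_form m v w"
  using assms by (auto simp: dual_form_cartan_A)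

lemma weight_height_uminus:
  "v \<in> carrier_vec m \<Longrightarrow> weight_height m (- v) = - weight_height m v"
  by (simp add: weight_height_def sum_negf)

text \<open>In terms of the \<open>x\<^sub>i\<close> with \<open>v\<^sub>i = x\<^sub>i - x\<^sub>i\<^sub>+\<^sub>1\<close>, the dual form is
  \<open>\<langle>v,v\<rangle>\<^sup>\<or> = \<Sum>i<j. (x\<^sub>i - x\<^sub>j)\<^sup>2 / (m + 1)\<close>.\<close>

definition weight_norm :: "nat \<Rightarrow> int Matrix.vec \<Rightarrow> int" where
  "weight_norm m v = (\<Sum>j\<le>m. \<Sum>i<j. (\<Sum>k=i..<j. vec_index v k) ^ 2)"

lemma dual_form_self:
  assumes "v \<in> carrier_vec m"
  shows "dual_form m v v = of_int (weight_norm m v) / real (m + 1)"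
proof -
  let ?P = "\<lambda>a b i. of_bool (a \<le> i \<and> i < b) :: int"
  have "weight_norm m v = (\<Sum>b\<le>m. \<Sum>a<m. (\<Sum>k<m. ?P a b k * vec_index v k) ^ 2)"
    unfolding weight_norm_def
  proof (rule sum.cong)
    fix b
    assume "b \<in> {..m}"
    have eq: "(\<Sum>k=a..<b. vec_index v k) = (\<Sum>k<m. ?P a b k * vec_index v k)" for a
      using \<open>b \<in> {..m}\<close> by (intro sum.mono_neutral_cong_left) auto
    show "(\<Sum>a<b. (\<Sum>k=a..<b. vec_index v k) ^ 2) = (\<Sum>a<m. (\<Sum>k<m. ?P a b k * vec_index v k) ^ 2)"
      unfolding eq using \<open>b \<in> {..m}\<close>
      by (intro sum.mono_neutral_left) (auto intro!: sum.neutral)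
  qed simp
  also have "\<dots> = (\<Sum>b\<le>m. \<Sum>a<m. \<Sum>i<m. \<Sum>j<m. vec_index v i * vec_index v j * (?P a b i * ?P a b j))"
    unfolding power2_eq_square sum_product by (intro sum.cong refl) (simp only: mult_ac)
  also have "\<dots> = (\<Sum>b\<le>m. \<Sum>i<m. \<Sum>j<m. \<Sum>a<m. vec_index v i * vec_index v j * (?P a b i * ?P a b j))"
    by (subst (1) sum.swap, rule sum.cong, simp, rule sum.cong, simp, rule sum.swap)
  also have "\<dots> = (\<Sum>i<m. \<Sum>j<m. \<Sum>b\<le>m. \<Sum>a<m. vec_index v i * vec_index v j * (?P a b i * ?P a b j))"
    by (subst sum.swap, rule sum.cong, simp, rule sum.swap)
  also have "\<dots> = (\<Sum>i<m. \<Sum>j<m. vec_index v i * vec_index v j * int ((min i j + 1) * (m - max i j)))"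
  proof (intro sum.cong refl)
    fix i j
    assume "i \<in> {..<m}" "j \<in> {..<m}"
    have "(\<Sum>b\<le>m. \<Sum>a<m. ?P a b i * ?P a b j)
        = (\<Sum>b\<le>m. of_bool (max i j < b)) * (\<Sum>a<m. of_bool (a \<le> min i j))"
      unfolding sum_product by (intro sum.cong) auto
    also have "(\<Sum>b\<le>m. of_bool (max i j < b) :: int) = int (card {max i j<..m})"
    proof -
      have "{..m} \<inter> {b. max i j < b} = {max i j<..m}"
        by auto
      then show ?thesis
        by (simp add: of_bool_def sum.If_cases del: max_less_iff_conj)
    qed
    also have "(\<Sum>a<m. of_bool (a \<le> min i j) :: int) = int (card {..min i j})"
    proof -
      have "{..<m} \<inter> {a. a \<le> min i j} = {..min i j}"
        using \<open>i \<in> _\<close> by auto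
      then show ?thesis
        by (simp add: of_bool_def sum.If_cases del: min.bounded_iff card_atMost)
    qed
    also have "int (card {max i j<..m}) * int (card {..min i j}) = int ((min i j + 1) * (m - max i j))"
      by (simp only: card_greaterThanAtMost card_atMost of_nat_mult Suc_eq_plus1 mult.commute)
    finally show "(\<Sum>b\<le>m. \<Sum>a<m. vec_index v i * vec_index v j * (?P a b i * ?P a b j))
        = vec_index v i * vec_index v j * int ((min i j + 1) * (m - max i j))"
      by (simp only: sum_distrib_left[symmetric])
  qed
  finally show ?thesis
    using assms by (simp add: dual_form_cartan_A)
qed

definition shell :: "nat \<Rightarrow> nat \<Rightarrow> int Matrix.vec set" where
  "shell m n = {v \<in> carrier_vec m. weight_norm m v = int n}"

lemma Theta_A_nth:
  assumes N: "N = 2 * (m + 1)"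
  shows "fps_nth (Theta_A N m l) n =
    (\<Sum>v\<in>shell m n. of_real (cos (2 * pi * of_int (l * weight_height m v) / real (m + 1))))"
proof -
  define f where "f v = 2 * complex_of_real pi * \<i> * of_real (of_int (l * weight_height m v) / real (m + 1))"
    for v
  have mem: "v \<in> shell m n \<longleftrightarrow> v \<in> carrier_vec m \<and> dual_form m v v / 2 = real n / real N" for v
  proof (cases "v \<in> carrier_vec m")
    case True
    have "dual_form m v v / 2 = of_int (weight_norm m v) / real N"
      unfolding dual_form_self[OF True] by (simp add: N)
    moreover have "real N \<noteq> 0"
      by (simp add: N)
    moreover have "real_of_int (weight_norm m v) = real n \<longleftrightarrow> weight_norm m v = int n"
      by (metis of_int_eq_iff of_int_of_nat_eq)
    ultimately show ?thesis
      using True by (simp add: shell_def)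
  qed (simp add: shell_def)
  have neg: "- v \<in> shell m n" if "v \<in> shell m n" for v
    using that dual_form_uminus[of v m v] by (simp add: mem)
  have S: "fps_nth (Theta_A N m l) n = (\<Sum>v\<in>shell m n. exp (f v))"
    unfolding Theta_A_def f_def fps_nth_Abs_fps
    by (rule sum.cong) (auto simp: mem dual_form_unit_vec)
  also have S': "\<dots> = (\<Sum>v\<in>shell m n. exp (- f v))"
  proof (rule sum.reindex_bij_witness[of _ uminus uminus])
    fix v
    assume v: "v \<in> shell m n"
    then show "- (- v) = v"
      by (intro eq_vecI) (auto simp: shell_def)
    then show "- (- v) = v" .
    show "- v \<in> shell m n" "- v \<in> shell m n"
      using neg v by auto
    show "exp (- f (- v)) = exp (f v)"
      using v by (simp add: f_def shell_def weight_height_uminus)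
  qed
  finally have "fps_nth (Theta_A N m l) n
      = ((\<Sum>v\<in>shell m n. exp (f v)) + (\<Sum>v\<in>shell m n. exp (- f v))) / 2"
    using S by simp
  also have "\<dots> = (\<Sum>v\<in>shell m n. (exp (f v) + exp (- f v)) / 2)"
    by (simp add: sum.distrib sum_divide_distrib add_divide_distrib)
  also have "\<dots> = (\<Sum>v\<in>shell m n. of_real (cos (2 * pi * of_int (l * weight_height m v) / real (m + 1))))"
  proof (rule sum.cong)
    fix v
    let ?x = "2 * pi * of_int (l * weight_height m v) / real (m + 1)"
    have "f v = \<i> * complex_of_real ?x"
      by (simp add: f_def)
    then show "(exp (f v) + exp (- f v)) / 2 = of_real (cos ?x)"
      unfolding cos_of_real[symmetric] cos_exp_eq by simp
  qed simp
  finally show ?thesis .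
qed

lemma shell_0: "shell m 0 = {0\<^sub>v m}"
proof -
  have "v = 0\<^sub>v m" if "v \<in> carrier_vec m" "weight_norm m v = 0" for v
  proof -
    have "(\<Sum>i<j. (\<Sum>k=i..<j. vec_index v k) ^ 2) = 0" if "j \<le> m" for j
      using \<open>weight_norm m v = 0\<close> that unfolding weight_norm_def
      by (subst (asm) sum_nonneg_eq_0_iff) (auto intro: sum_nonneg)
    then have *: "(\<Sum>k=i..<j. vec_index v k) ^ 2 = 0" if "i < j" "j \<le> m" for i j
      using that by (subst (asm) sum_nonneg_eq_0_iff) auto
    have "vec_index v i = 0" if "i < m" for i
      using *[of i "Suc i"] that by simp
    then show ?thesis
      using \<open>v \<in> _\<close> by (intro eq_vecI) auto
  qed
  moreover have "weight_norm m (0\<^sub>v m) = 0"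
    by (auto simp: weight_norm_def intro!: sum.neutral)
  ultimately show ?thesis
    by (auto simp: shell_def)
qed

lemma Theta_A_nth_0:
  assumes N: "N = 2 * (m + 1)"
  shows "fps_nth (Theta_A N m l) 0 = 1"
  by (simp add: Theta_A_nth[OF N] shell_0 weight_height_def)

lemma cos_int_mod:
  assumes "n > 0"
  shows "cos (2 * pi * of_int k / of_nat n) = cos (2 * pi * of_int (k mod int n) / of_nat n)"
proof -
  have "2 * pi * of_int k / of_nat n = 2 * pi * of_int (k mod int n) / of_nat n + 2 * pi * of_int (k div int n)"
  proof -
    have "real_of_int k = of_int (k mod int n) + of_int n * of_int (k div int n)"
      by (metis add.commute mult_div_mod_eq of_int_add of_int_mult of_int_of_nat_eq)
    then show ?thesis
      using assms by (simp add: field_simps)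
  qed
  then show ?thesis
    by (simp add: cos_add)
qed

section \<open>Rank 4\<close>

lemma (in field_iso) powi: "R a b \<Longrightarrow> R (a powi n) (b powi n)"
  by (simp add: power_int_def power inverse)

lemma field_iso_Rats:
  assumes "field_iso R" "a \<in> \<rat>"
  shows "R a (a::'a::field_char_0)"
proof -
  interpret field_iso R by fact
  obtain p q where "a = of_int p / of_int q"
    using \<open>a \<in> \<rat>\<close> by (elim Rats_cases') auto
  then show ?thesis
    using divide of_int by simp
qed

lemma fps_rel_of_rat:
  assumes "field_iso R" "fps_rel rat_rel F G"
  shows "fps_rel R F G"
  using assms(2) field_iso_Rats[OF assms(1)] by (simp add: fps_rel_def rat_rel_def) metis

lemma cos_thirds_rat: "cos (2 * pi * of_int k / 3) \<in> \<rat>"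
proof -
  have *: "cos (2 * pi * of_int k / 3) = cos (2 * pi * of_int (k mod 3) / 3)"
    using cos_int_mod[of 3 k] by simp
  have "k mod 3 \<in> {0, 1, 2}"
    by auto
  moreover have "cos (2 * pi * 2 / 3) = - 1 / 2"
    using cos_120 cos_2pi_minus[of "2 * pi / 3"] by (simp add: field_simps)
  ultimately show ?thesis
    using * cos_120 by auto
qed

lemma cos_quarters_rat: "cos (2 * pi * of_int k / 4) \<in> \<rat>"
proof -
  have *: "cos (2 * pi * of_int k / 4) = cos (2 * pi * of_int (k mod 4) / 4)"
    using cos_int_mod[of 4 k] by simp
  have "k mod 4 \<in> {0, 1, 2, 3}"
    by auto
  moreover have "cos (2 * pi * 3 / 4) = 0"
    using cos_2pi_minus[of "2 * pi * 3 / 4"] by (simp add: field_simps)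
  moreover have "cos (2 * pi * 2 / 4) = - 1" "cos (2 * pi * 1 / 4) = 0"
    using cos_pi cos_pi_half by (simp_all add: field_simps)
  ultimately show ?thesis
    unfolding * by (elim insertE) auto
qed

lemma eps_eq_cis: "eps r = cis (2 * pi / real r)"
  by (simp add: eps_def cis_conv_exp mult_ac)

lemma eps_powi_add: "eps r powi k + eps r powi (- k) = of_real (2 * cos (2 * pi * of_int k / real r))"
  by (simp add: eps_eq_cis cis_power_int complex_eq_iff mult_ac)

lemma ii_eq_eps: "\<i> = eps 4"
  by (simp add: eps_eq_cis)

lemma fps_nth_divide_0:
  fixes F G :: "'a::field fps"
  shows "fps_nth G 0 \<noteq> 0 \<Longrightarrow> fps_nth (F / G) 0 = fps_nth F 0 / fps_nth G 0"
  by (simp add: fps_divide_unit field_simps)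

lemma fps_nth_powi_0:
  fixes F :: "'a::field fps"
  shows "fps_nth (F powi n) 0 = fps_nth F 0 powi n"
  by (simp add: power_int_def fps_power_zeroth)

lemma t_A_nth_0:
  assumes "N = 2 * (m + 1)"
  shows "fps_nth (t_A N m l) 0 = 1"
  by (simp add: t_A_def fps_nth_divide_0 Theta_A_nth_0[OF assms])

lemma fps_rel_t_A:
  assumes "field_iso R" "N = 2 * (m + 1)"
    and "fps_rel R (Theta_A N m 0) (Theta_A N m 0)" "fps_rel R (Theta_A N m l) (Theta_A N m l')"
  shows "fps_rel R (t_A N m l) (t_A N m l')"
  unfolding t_A_def using assms by (intro field_iso.fps_divide[of R]) (simp_all add: Theta_A_nth_0)

lemma rat_rel_sum_of_real:
  "(\<And>x. x \<in> A \<Longrightarrow> f x \<in> \<rat>) \<Longrightarrow> rat_rel (\<Sum>x\<in>A. of_real (f x)) (\<Sum>x\<in>A. of_real (f x))"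
  by (auto intro!: rat.sum simp: rat_rel_def)

lemma rational_Theta_A2: "fps_rel rat_rel (Theta_A 6 2 l) (Theta_A 6 2 l)"
  using cos_thirds_rat by (auto simp: fps_rel_def Theta_A_nth simp del: of_int_mult intro!: rat_rel_sum_of_real)

lemma rational_Theta_A3: "fps_rel rat_rel (Theta_A 8 3 l) (Theta_A 8 3 l)"
  using cos_quarters_rat by (auto simp: fps_rel_def Theta_A_nth simp del: of_int_mult intro!: rat_rel_sum_of_real)

lemma rational_Theta_A_0: "fps_rel rat_rel (Theta_A (2 * (m + 1)) m 0) (Theta_A (2 * (m + 1)) m 0)"
  by (auto simp: fps_rel_def Theta_A_nth rat_rel_def)

lemma fps_eventually_const_limit:
  fixes P :: "nat \<Rightarrow> 'a::group_add fps"
  assumes "\<And>n m. n \<le> m \<Longrightarrow> fps_nth (P (Suc m)) n = fps_nth (P m) n"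
  shows "P \<longlonglongrightarrow> Abs_fps (\<lambda>n. fps_nth (P n) n)"
proof (rule tendsto_fpsI)
  fix n
  have "fps_nth (P m) n = fps_nth (P n) n" if "n \<le> m" for m
    using that by (induction m rule: dec_induct) (simp_all only: assms)
  then show "\<forall>\<^sub>F m in sequentially. fps_nth (P m) n = fps_nth (Abs_fps (\<lambda>n. fps_nth (P n) n)) n"
    unfolding fps_nth_Abs_fps eventually_sequentially by blast
qed

lemma eta_prod_nth:
  assumes "k > 0"
  shows "fps_nth (eta_prod k) n = fps_nth (\<Prod>i\<le>n. 1 - fps_X ^ (k * Suc i)) n"
proof -
  define P :: "nat \<Rightarrow> complex fps" where "P m = (\<Prod>i\<le>m. 1 - fps_X ^ (k * Suc i))" for m
  have "fps_nth (P (Suc m)) n = fps_nth (P m) n" if "n \<le> m" for n m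
  proof -
    have "1 * Suc (Suc m) \<le> k * Suc (Suc m)"
      using assms by (intro mult_le_mono1) simp
    then have "n < k * Suc (Suc m)"
      using that by (metis le_imp_less_Suc less_SucI less_le_trans mult_1)
    moreover have "P (Suc m) = P m - fps_X ^ (k * Suc (Suc m)) * P m"
      unfolding P_def prod.atMost_Suc
      by (simp only: mult.commute[of "prod _ _"] left_diff_distrib mult_1_left)
    ultimately show ?thesis
      by (simp only: fps_sub_nth fps_X_power_mult_nth if_True diff_0_right)
  qed
  then have lim: "P \<longlonglongrightarrow> Abs_fps (\<lambda>n. fps_nth (P n) n)"
    by (rule fps_eventually_const_limit)
  have "fps_nth (P 0) 0 = 1"
    using assms by (simp add: P_def)
  then have "Abs_fps (\<lambda>n. fps_nth (P n) n) \<noteq> 0"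
    by (metis fps_nth_Abs_fps fps_zero_nth one_neq_zero)
  with lim have "(\<lambda>n. 1 - fps_X ^ (k * Suc n)) has_prod Abs_fps (\<lambda>n. fps_nth (P n) n)"
    by (simp add: has_prod_def raw_has_prod_def P_def[abs_def] del: mult_Suc_right)
  then have "eta_prod k = Abs_fps (\<lambda>n. fps_nth (P n) n)"
    unfolding eta_prod_def by (rule has_prod_unique[symmetric])
  then show ?thesis
    by (simp only: P_def fps_nth_Abs_fps)
qed

lemma (in field_iso) fps_prod:
  "(\<And>x. x \<in> A \<Longrightarrow> fps_rel R (f x) (g x)) \<Longrightarrow> fps_rel R (prod f A) (prod g A)"
  by (induction A rule: infinite_finite_induct) (auto intro: fps_one fps_mult)

lemma rational_eta_prod:
  assumes "k > 0"
  shows "fps_rel rat_rel (eta_prod k) (eta_prod k)"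
proof -
  have "fps_rel rat_rel (\<Prod>i\<le>n. 1 - fps_X ^ (k * Suc i)) (\<Prod>i\<le>n. 1 - fps_X ^ (k * Suc i))" for n
    by (intro rat.fps_prod rat.fps_diff rat.fps_one rat.fps_power rat.fps_X)
  then show ?thesis
    by (auto simp: fps_rel_def eta_prod_nth[OF assms])
qed

lemma eta_prod_nth_0: "k > 0 \<Longrightarrow> fps_nth (eta_prod k) 0 = 1"
  by (simp add: eta_prod_nth)

lemma v_ser_nth_0: "fps_nth v_ser 0 = 1"
  by (simp add: v_ser_def fps_nth_divide_0 fps_power_zeroth eta_prod_nth_0)

lemma rational_v_ser: "fps_rel rat_rel v_ser v_ser"
  unfolding v_ser_def by (intro rat.fps_intros rational_eta_prod) (simp_all add: eta_prod_nth_0 fps_power_zeroth)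

lemma rational_quotient_power_sum:
  fixes D P Q :: "complex fps"
  assumes rel: "fps_rel rat_rel (D ^ 2) (D ^ 2)" "fps_rel rat_rel (P * Q) (P * Q)"
      "fps_rel rat_rel (D * (Q - P)) (D * (Q - P))"
    and unit: "fps_nth D 0 \<noteq> 0" "fps_nth P 0 \<noteq> 0" "fps_nth Q 0 \<noteq> 0"
  shows "fps_rel rat_rel ((D / P) powi k + (- D / Q) powi k) ((D / P) powi k + (- D / Q) powi k)"
proof (rule rat.fps_power_sum)
  note inv = inverse_mult_eq_1[OF unit(2)] inverse_mult_eq_1[OF unit(3)]
  have "D / P + - D / Q = D * (Q * inverse Q) * inverse P - D * (P * inverse P) * inverse Q"
    using unit inv by (simp add: fps_divide_unit mult.commute)
  also have "\<dots> = D * (Q - P) * inverse (P * Q)"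
    by (simp add: fps_inverse_mult algebra_simps)
  finally show "fps_rel rat_rel (D / P + - D / Q) (D / P + - D / Q)"
    using rel by (simp only: rat.fps_mult rat.fps_inverse)
  have "D / P * (- D / Q) = - (D ^ 2) * inverse (P * Q)"
    using unit by (simp add: fps_divide_unit fps_inverse_mult power2_eq_square mult_ac)
  then show "fps_rel rat_rel (D / P * (- D / Q)) (D / P * (- D / Q))"
    using rel by (simp only: rat.fps_mult rat.fps_inverse rat.fps_minus)
  show "fps_nth (D / P) 0 \<noteq> 0" "fps_nth (- D / Q) 0 \<noteq> 0"
    using unit by (simp_all add: fps_nth_divide_0)
qed

lemma minus_one_powi_rat: "rat_rel ((-1) powi n) ((-1) powi n)"
  by (intro rat.powi rat.minus rat.one)

lemma rational_Psi4:
  assumes "is_Z4 Z"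
  shows "fps_rel rat_rel (Psi4 Z chi K2 Kc) (Psi4 Z chi K2 Kc)"
proof -
  define W where "W = 3 * (v_ser powi (-2) + v_ser ^ 2)"
  define u where "u = inverse (t_A 8 3 2)"
  define c where "c = u * v_ser powi (-4)"
  define D where "D = Z - inverse Z"
  have t: "fps_rel rat_rel (t_A 8 3 l) (t_A 8 3 l)" for l
    by (intro fps_rel_t_A rat.field_iso_axioms rational_Theta_A3) simp
  have u: "fps_rel rat_rel u u"
    unfolding u_def by (intro rat.fps_inverse t)
  have W: "fps_rel rat_rel W W"
    unfolding W_def by (intro rat.fps_intros rational_v_ser)
  have c: "fps_rel rat_rel c c"
    unfolding c_def by (intro rat.fps_intros rational_v_ser u)
  have W0: "fps_nth W 0 = 6" and u0: "fps_nth u 0 = 1" and c0: "fps_nth c 0 = 1"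
    by (simp_all add: W_def u_def c_def fps_nth_powi_0 fps_power_zeroth v_ser_nth_0 t_A_nth_0)
  have ZW: "Z + inverse Z = W"
    using assms by (simp add: is_Z4_def W_def algebra_simps)
  have Z0: "fps_nth Z 0 \<noteq> 0"
    using ZW W0 by (metis add.right_neutral fps_inverse_eq_0 fps_zero_nth zero_neq_numeral)
  then have ZZ: "Z * inverse Z = 1"
    by (simp add: inverse_mult_eq_1')
  define z where "z = fps_nth Z 0"
  have "fps_nth (Z + inverse Z) 0 = 6"
    by (simp add: ZW W0)
  then have z: "z \<noteq> 0" "z + 1 / z = 6"
    using Z0 by (simp_all add: z_def divide_inverse)
  then have "z \<noteq> 1" "z \<noteq> - 1"
    by auto
  then have "z * z \<noteq> 1"
    using power2_eq_1_iff[of z] by (simp add: power2_eq_square)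
  then have z2: "z - 1 / z \<noteq> 0"
    using z(1) by (simp add: field_simps)
  have D2: "D ^ 2 = W ^ 2 - 4"
    unfolding D_def ZW[symmetric] using ZZ by (simp add: power2_eq_square algebra_simps)
  have D0: "fps_nth D 0 \<noteq> 0"
    using z2 Z0 by (simp add: D_def z_def field_simps)
  have uv: "fps_nth (u * Z - v_ser ^ 4) 0 \<noteq> 0" "fps_nth (u * inverse Z - v_ser ^ 4) 0 \<noteq> 0"
    "fps_nth (c - inverse Z) 0 \<noteq> 0" "fps_nth (c - Z) 0 \<noteq> 0"
    using \<open>z \<noteq> 1\<close> Z0 by (auto simp: u0 c0 fps_power_zeroth v_ser_nth_0 z_def field_simps)
  have rD: "fps_rel rat_rel (D ^ 2) (D ^ 2)"
    unfolding D2 by (intro rat.fps_intros W)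
  have 1: "fps_rel rat_rel ((D / (c - inverse Z)) powi K2 + (- D / (c - Z)) powi K2)
      ((D / (c - inverse Z)) powi K2 + (- D / (c - Z)) powi K2)"
  proof (rule rational_quotient_power_sum)
    have "(c - inverse Z) * (c - Z) = c ^ 2 - c * W + 1"
      unfolding ZW[symmetric] using ZZ by (simp add: power2_eq_square algebra_simps)
    then show "fps_rel rat_rel ((c - inverse Z) * (c - Z)) ((c - inverse Z) * (c - Z))"
      using W c by (simp only: rat.fps_intros)
    have "D * (c - Z - (c - inverse Z)) = - (D ^ 2)"
      by (simp add: D_def power2_eq_square algebra_simps)
    then show "fps_rel rat_rel (D * (c - Z - (c - inverse Z))) (D * (c - Z - (c - inverse Z)))"
      using rD by (simp only: rat.fps_minus)
  qed (use rD D0 uv in auto)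
  have 2: "fps_rel rat_rel ((D / (u * Z - v_ser ^ 4)) powi K2 + (- D / (u * inverse Z - v_ser ^ 4)) powi K2)
      ((D / (u * Z - v_ser ^ 4)) powi K2 + (- D / (u * inverse Z - v_ser ^ 4)) powi K2)"
  proof (rule rational_quotient_power_sum)
    have "(u * Z - v_ser ^ 4) * (u * inverse Z - v_ser ^ 4)
        = u ^ 2 * (Z * inverse Z) - u * v_ser ^ 4 * (Z + inverse Z) + (v_ser ^ 4) ^ 2"
      by (simp add: power2_eq_square algebra_simps)
    then have "(u * Z - v_ser ^ 4) * (u * inverse Z - v_ser ^ 4) = u ^ 2 * 1 - u * v_ser ^ 4 * W + (v_ser ^ 4) ^ 2"
      by (simp only: ZZ ZW)
    then show "fps_rel rat_rel ((u * Z - v_ser ^ 4) * (u * inverse Z - v_ser ^ 4))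
        ((u * Z - v_ser ^ 4) * (u * inverse Z - v_ser ^ 4))"
      using W u rational_v_ser by (simp only: rat.fps_intros)
    have "D * ((u * inverse Z - v_ser ^ 4) - (u * Z - v_ser ^ 4)) = - (u * D ^ 2)"
      by (simp add: D_def power2_eq_square algebra_simps)
    then show "fps_rel rat_rel (D * ((u * inverse Z - v_ser ^ 4) - (u * Z - v_ser ^ 4)))
      (D * ((u * inverse Z - v_ser ^ 4) - (u * Z - v_ser ^ 4)))"
      using rD u by (simp only: rat.fps_minus rat.fps_mult)
  qed (use rD D0 uv in auto)
  have 3: "rat_rel (\<i> powi Kc + \<i> powi (- Kc)) (\<i> powi Kc + \<i> powi (- Kc))"
    unfolding ii_eq_eps eps_powi_add[of 4] using cos_quarters_rat[of Kc] by (simp add: rat_rel_def)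
  have Psi4: "Psi4 Z chi K2 Kc =
        ((D / (c - inverse Z)) powi K2 + (- D / (c - Z)) powi K2)
        + fps_const ((-1) powi (chi + Kc)) *
            ((D / (u * Z - v_ser ^ 4)) powi K2 + (- D / (u * inverse Z - v_ser ^ 4)) powi K2)
        + fps_const (\<i> powi Kc + \<i> powi (- Kc)) * t_A 8 3 1 powi K2 *
            ((1 + v_ser powi (-4)) powi K2 + fps_const ((-1) powi chi) * (v_ser ^ 4 + 1) powi K2)"
    by (simp add: Psi4_def Let_def c_def u_def D_def add_ac)
  show ?thesis
    unfolding Psi4
    by (intro rat.fps_add[OF rat.fps_add[OF 1 rat.fps_mult[OF rat.fps_const 2]]] rat.fps_mult
        rat.fps_intros rational_v_ser t minus_one_powi_rat 3)
qed

section \<open>Rank 3\<close>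

lemma positive_lead_iff:
  "positive_lead F \<longleftrightarrow> (\<exists>k c G. F = fps_X ^ k * G \<and> fps_nth G 0 = of_real c \<and> c > 0)"
proof
  assume "positive_lead F"
  then obtain c where c: "c > 0" "fps_nth F (subdegree F) = complex_of_real c"
    by (auto simp: positive_lead_def)
  have "F = fps_X ^ subdegree F * fps_shift (subdegree F) F"
    using subdegree_decompose[of F] by (simp add: mult.commute)
  with c show "\<exists>k c G. F = fps_X ^ k * G \<and> fps_nth G 0 = of_real c \<and> c > 0"
    by (metis add_0 fps_shift_nth)
next
  assume "\<exists>k c G. F = fps_X ^ k * G \<and> fps_nth G 0 = of_real c \<and> c > 0"
  then obtain k c G where F: "F = fps_X ^ k * G" "fps_nth G 0 = of_real c" "c > 0"
    by blast
  then have "subdegree F = k"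
    by (intro subdegreeI) (auto simp: fps_X_power_mult_nth)
  with F show "positive_lead F"
    by (auto simp: positive_lead_def fps_X_power_mult_nth)
qed

lemma positive_leadI:
  "fps_nth F 0 = of_real c \<Longrightarrow> c > 0 \<Longrightarrow> positive_lead F"
  unfolding positive_lead_iff by (intro exI[of _ 0] exI[of _ c] exI[of _ F]) auto

lemma positive_lead_mult:
  assumes "positive_lead F" "positive_lead G"
  shows "positive_lead (F * G)"
proof -
  obtain k c F' where F: "F = fps_X ^ k * F'" "fps_nth F' 0 = of_real c" "c > 0"
    using assms(1) unfolding positive_lead_iff by blast
  obtain l d G' where G: "G = fps_X ^ l * G'" "fps_nth G' 0 = of_real d" "d > 0"
    using assms(2) unfolding positive_lead_iff by blast
  have "F * G = fps_X ^ (k + l) * (F' * G')" "fps_nth (F' * G') 0 = of_real (c * d)" "c * d > 0"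
    using F G by (simp_all add: power_add mult_ac)
  then show ?thesis
    unfolding positive_lead_iff by blast
qed

lemma positive_lead_square_eq:
  assumes "F ^ 2 = G ^ 2" "positive_lead F" "positive_lead G"
  shows "F = G"
proof (rule ccontr)
  assume "F \<noteq> G"
  then have "F = - G"
    using assms(1) by (auto simp: power2_eq_iff)
  with assms(2,3) obtain c d :: real where "c > 0" "d > 0" "of_real c = - complex_of_real d"
    by (auto simp: positive_lead_def)
  then have "c = - d"
    by (metis of_real_eq_iff of_real_minus)
  with \<open>c > 0\<close> \<open>d > 0\<close> show False
    by simp
qed

lemma sqrt_fps_eqI:
  "G ^ 2 = F \<Longrightarrow> positive_lead G \<Longrightarrow> sqrt_fps F = G"
  unfolding sqrt_fps_def by (rule the_equality) (auto intro: positive_lead_square_eq)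

lemma fps_square_root_ex:
  fixes F :: "'a::field_char_0 fps"
  assumes "fps_nth F 0 = c ^ 2" "c \<noteq> 0"
  obtains G where "G ^ 2 = F" "fps_nth G 0 = c"
proof
  let ?G = "fps_radical (\<lambda>_ _. c) (Suc 1) F"
  show "?G ^ 2 = F"
    using power_radical[of F "\<lambda>_ _. c" 1] assms by (simp add: numeral_2_eq_2)
  show "fps_nth ?G 0 = c"
    by simp
qed

lemma root_plus_minus:
  assumes "sqrt_fps (b ^ 2 - 4 * c) ^ 2 = b ^ 2 - 4 * c"
  defines "S \<equiv> sqrt_fps (b ^ 2 - 4 * c)"
  shows "root_plus 1 b c = fps_const (1/2) * (- b + S)" "root_minus 1 b c = fps_const (1/2) * (- b - S)"
    "root_plus 1 b c + root_minus 1 b c = - b" "root_plus 1 b c * root_minus 1 b c = c"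
proof -
  have half: "F / 2 = fps_const (1/2) * F" for F :: "complex fps"
    by (simp add: numeral_fps_const fps_divide_unit fps_const_inverse mult.commute)
  show rp: "root_plus 1 b c = fps_const (1/2) * (- b + S)"
    by (simp add: root_plus_def S_def half)
  show rm: "root_minus 1 b c = fps_const (1/2) * (- b - S)"
    by (simp add: root_minus_def S_def half)
  have two: "fps_const (1/2) * (2 * F) = F" for F :: "complex fps"
    by (simp add: numeral_fps_const flip: mult.assoc)
  have "root_plus 1 b c + root_minus 1 b c = fps_const (1/2) * (2 * - b)"
    unfolding rp rm by (simp add: algebra_simps)
  then show "root_plus 1 b c + root_minus 1 b c = - b"
    by (simp only: two)
  have "root_plus 1 b c * root_minus 1 b c = fps_const (1/2) * (fps_const (1/2) * (b ^ 2 - S ^ 2))"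
    unfolding rp rm by (simp add: power2_eq_square algebra_simps)
  also have "b ^ 2 - S ^ 2 = 2 * (2 * c)"
    using assms by simp
  finally show "root_plus 1 b c * root_minus 1 b c = c"
    by (simp only: two)
qed

definition jet :: "complex fps \<Rightarrow> complex \<Rightarrow> complex \<Rightarrow> bool" where
  "jet F a b \<longleftrightarrow> fps_nth F 0 = a \<and> fps_nth F 1 = 0 \<and> fps_nth F 2 = b"

lemma fps_mult_nth_1_2:
  "fps_nth (F * G) 1 = fps_nth F 0 * fps_nth G 1 + fps_nth F 1 * fps_nth G 0"
  "fps_nth (F * G) 2 = fps_nth F 0 * fps_nth G 2 + fps_nth F 1 * fps_nth G 1 + fps_nth F 2 * fps_nth G 0"
  by (simp_all add: fps_mult_nth numeral_2_eq_2)

lemma jet_const: "jet (fps_const a) a 0"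
  by (simp add: jet_def)

lemma jet_one: "jet 1 1 0"
  by (simp add: jet_def)

lemma jet_numeral: "jet (numeral n) (numeral n) 0"
  unfolding numeral_fps_const by (rule jet_const)

lemma jet_add: "jet F a b \<Longrightarrow> jet G c d \<Longrightarrow> jet (F + G) (a + c) (b + d)"
  by (simp add: jet_def)

lemma jet_minus: "jet F a b \<Longrightarrow> jet (- F) (- a) (- b)"
  by (simp add: jet_def)

lemma jet_diff: "jet F a b \<Longrightarrow> jet G c d \<Longrightarrow> jet (F - G) (a - c) (b - d)"
  by (simp add: jet_def)

lemma jet_mult: "jet F a b \<Longrightarrow> jet G c d \<Longrightarrow> jet (F * G) (a * c) (a * d + b * c)"
  unfolding jet_def fps_mult_nth_1_2 fps_mult_nth_0 by simp

lemma jet_power: "jet F a b \<Longrightarrow> jet (F ^ n) (a ^ n) (of_nat n * a ^ (n - 1) * b)"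
proof (induction n)
  case (Suc n)
  have "jet (F * F ^ n) (a * a ^ n) (a * (of_nat n * a ^ (n - 1) * b) + b * a ^ n)"
    by (rule jet_mult[OF Suc.prems Suc.IH[OF Suc.prems]])
  moreover have "a * (of_nat n * a ^ (n - 1) * b) + b * a ^ n = of_nat (Suc n) * a ^ (Suc n - 1) * b"
    by (cases n) (simp_all add: algebra_simps)
  ultimately show ?case
    by simp
qed (simp add: jet_one)

lemma jet_inverse:
  assumes "jet F a b" "a \<noteq> 0"
  shows "jet (inverse F) (inverse a) (- b / a ^ 2)"
proof -
  have "F * inverse F = 1"
    using assms by (simp add: jet_def inverse_mult_eq_1')
  moreover have "fps_nth (F * inverse F) 1 = a * fps_nth (inverse F) 1"
    "fps_nth (F * inverse F) 2 = a * fps_nth (inverse F) 2 + b * inverse a"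
    unfolding fps_mult_nth_1_2 using assms by (simp_all add: jet_def)
  ultimately have "a * fps_nth (inverse F) 1 = 0" "a * fps_nth (inverse F) 2 + b * inverse a = 0"
    by (metis fps_one_nth zero_neq_one, metis fps_one_nth zero_neq_numeral)
  moreover have "fps_nth (inverse F) 2 * a ^ 2 = a * (a * fps_nth (inverse F) 2 + b * inverse a) - b"
    using assms(2) by (simp add: power2_eq_square distrib_left mult_ac)
  ultimately have "fps_nth (inverse F) 1 = 0" "fps_nth (inverse F) 2 * a ^ 2 = - b"
    using assms(2) by simp_all
  moreover from this have "fps_nth (inverse F) 2 = - b / a ^ 2"
    using assms(2) by (intro eq_divide_imp) simp_all
  ultimately show ?thesis
    using assms by (simp add: jet_def)
qed

lemma jet_divide:
  assumes "jet F a b" "jet G c d" "c \<noteq> 0"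
  shows "jet (F / G) (a / c) ((b - a * d / c) / c)"
proof -
  have "fps_nth G 0 \<noteq> 0"
    using assms by (simp add: jet_def)
  then have "F / G = F * inverse G"
    by (rule fps_divide_unit)
  moreover have "jet (F * inverse G) (a * inverse c) (a * (- d / c ^ 2) + b * inverse c)"
    by (intro jet_mult jet_inverse assms)
  ultimately show ?thesis
    using assms(3) by (simp add: field_simps power2_eq_square)
qed

lemmas jet_intros =
  jet_one jet_numeral jet_const jet_add jet_minus jet_diff jet_mult jet_power jet_inverse jet_divide

lemma jet_cong: "jet F a b \<Longrightarrow> a = a' \<Longrightarrow> b = b' \<Longrightarrow> jet F a' b'"
  by simp

lemma sqrt_fps_jet:
  assumes "jet F 0 (of_real d)" "d > 0"
  obtains G where "sqrt_fps F = fps_X * G" "F = (fps_X * G) ^ 2" "fps_nth G 0 = of_real (sqrt d)"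
proof -
  have "F = fps_X ^ 2 * fps_shift 2 F"
  proof (rule fps_ext)
    fix n
    have "fps_nth F n = 0" if "n < 2"
      using assms(1) that by (cases n) (auto simp: jet_def)
    then show "fps_nth F n = fps_nth (fps_X ^ 2 * fps_shift 2 F) n"
    proof (cases "n < 2")
      case False
      then obtain m where "n = m + 2"
        by (metis add.commute le_add_diff_inverse not_less)
      then show ?thesis
        by (simp add: fps_X_power_mult_nth)
    qed (simp add: fps_X_power_mult_nth)
  qed
  moreover have "fps_nth (fps_shift 2 F) 0 = of_real (sqrt d) ^ 2"
    using assms by (simp add: jet_def numeral_2_eq_2) (simp flip: of_real_mult)
  then obtain G where G: "G ^ 2 = fps_shift 2 F" "fps_nth G 0 = of_real (sqrt d)"
    using assms(2) by (elim fps_square_root_ex) auto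
  ultimately have F: "F = (fps_X * G) ^ 2"
    by (simp add: power_mult_distrib)
  moreover have "positive_lead (fps_X * G)"
    unfolding positive_lead_iff using G(2) assms(2)
    by (intro exI[of _ 1] exI[of _ "sqrt d"] exI[of _ G]) simp
  ultimately have "sqrt_fps F = fps_X * G"
    by (intro sqrt_fps_eqI) simp_all
  then show thesis
    using F G(2) that by blast
qed

lemma carrier_vec_2_cases:
  assumes "v \<in> carrier_vec 2"
  obtains a b where "v = vCons a (vCons b vNil)"
  by (rule that[of "vec_index v 0" "vec_index v 1"], rule eq_vecI)
    (use assms in \<open>auto simp: less_Suc_eq numeral_2_eq_2\<close>)

lemma square_le_2: "a ^ 2 \<le> (2::int) \<Longrightarrow> a \<in> {-1, 0, 1}"
proof -
  assume "a ^ 2 \<le> 2"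
  then have "\<bar>a\<bar> < 2"
    by (intro power2_less_imp_less[of "\<bar>a\<bar>" 2]) auto
  then show ?thesis
    by auto
qed

lemma weight_norm_2: "weight_norm 2 (vCons a (vCons b vNil)) = a ^ 2 + b ^ 2 + (a + b) ^ 2"
  by (simp add: weight_norm_def numeral_2_eq_2 atLeast0_lessThan_Suc atLeastLessThanSuc add.commute)

lemma shell_2_1: "shell 2 1 = {}"
  and shell_2_2: "shell 2 2 = (\<lambda>(a, b). vCons a (vCons b vNil)) ` {(1, 0), (-1, 0), (0, 1), (0, -1), (1, -1), (-1, 1)}"
proof -
  have *: "(a = 0 \<and> b = 0) \<or> weight_norm 2 (vCons a (vCons b vNil)) = 2 \<and>
      (a, b) \<in> {(1, 0), (-1, 0), (0, 1), (0, -1), (1, -1), (-1, 1)}"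
    if "weight_norm 2 (vCons a (vCons b vNil)) \<le> 2" for a b
  proof -
    have le: "a ^ 2 + b ^ 2 + (a + b) ^ 2 \<le> 2"
      using that by (simp only: weight_norm_2)
    then have "a ^ 2 \<le> 2" "b ^ 2 \<le> 2"
      using zero_le_power2[of a] zero_le_power2[of b] zero_le_power2[of "a + b"] by linarith+
    then have "a \<in> {-1, 0, 1}" "b \<in> {-1, 0, 1}"
      using square_le_2 by auto
    then show ?thesis
      using le by (auto simp: weight_norm_2)
  qed
  have pair_carrier: "vCons a (vCons b vNil) \<in> carrier_vec 2" for a b :: int
    by (simp add: numeral_2_eq_2)
  have 0: "weight_norm 2 (vCons 0 (vCons 0 vNil)) = 0"
    by (simp add: weight_norm_2)
  show "shell 2 1 = {}"
  proof (rule equals0I)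
    fix v
    assume "v \<in> shell 2 1"
    then have "v \<in> carrier_vec 2" "weight_norm 2 v = 1"
      by (simp_all add: shell_def)
    moreover obtain a b where "v = vCons a (vCons b vNil)"
      using \<open>v \<in> carrier_vec 2\<close> by (rule carrier_vec_2_cases)
    ultimately have "v = vCons a (vCons b vNil)" "weight_norm 2 v = 1"
      by simp_all
    with *[of a b] 0 show False
      by auto
  qed
  show "shell 2 2 = (\<lambda>(a, b). vCons a (vCons b vNil)) ` {(1, 0), (-1, 0), (0, 1), (0, -1), (1, -1), (-1, 1)}"
    (is "_ = ?R")
  proof
    show "shell 2 2 \<subseteq> ?R"
    proof
      fix v
      assume "v \<in> shell 2 2"
      then have "v \<in> carrier_vec 2" and norm: "weight_norm 2 v = 2"
        by (simp_all add: shell_def)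
      then obtain a b where v: "v = vCons a (vCons b vNil)"
        by (elim carrier_vec_2_cases)
      then have "(a, b) \<in> {(1, 0), (-1, 0), (0, 1), (0, -1), (1, -1), (-1, 1)}"
        using *[of a b] 0 norm by auto
      then show "v \<in> ?R"
        unfolding v by (rule rev_image_eqI) simp
    qed
    show "?R \<subseteq> shell 2 2"
      by (clarsimp simp: shell_def weight_norm_2 pair_carrier)
  qed
qed

lemma weight_height_0: "weight_height m (0\<^sub>v m) = 0"
  by (simp add: weight_height_def)

lemma jet_Theta_A2: "jet (Theta_A 6 2 0) 1 6" "jet (Theta_A 6 2 1) 1 (- 3)"
proof -
  have inj: "inj_on (\<lambda>(a, b). vCons a (vCons b vNil)) (A :: (int \<times> int) set)" for A
    by (auto simp: inj_on_def)
  have ht: "weight_height 2 (vCons a (vCons b vNil)) = 2 * a + b" for a b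
    by (simp add: weight_height_def numeral_2_eq_2)
  have cos: "cos (2 * pi * 2 / 3) = - 1 / 2" "cos (2 * pi * 1 / 3) = - 1 / 2"
    using cos_120 cos_2pi_minus[of "2 * pi / 3"] by (simp_all add: field_simps)
  show "jet (Theta_A 6 2 0) 1 6" "jet (Theta_A 6 2 1) 1 (- 3)"
    using cos
    by (simp_all add: jet_def Theta_A_nth shell_0 shell_2_1[unfolded One_nat_def] shell_2_2
        sum.reindex[OF inj] ht weight_height_0)
qed

lemma rational_Psi3: "fps_rel rat_rel (Psi3 chi K2 Kc) (Psi3 chi K2 Kc)"
proof -
  define t where "t = t_A 6 2 1"
  define b where "b = - 4 * t ^ 2"
  define c where "c = 4 * t"
  have t: "fps_rel rat_rel t t"
    unfolding t_def by (intro fps_rel_t_A rat.field_iso_axioms rational_Theta_A2) simp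
  have jet_t: "jet t 1 9"
    unfolding t_def t_A_def using jet_divide[OF jet_Theta_A2] by simp
  have "jet (b ^ 2 - 4 * c) 0 432"
    unfolding b_def c_def
    by (rule jet_cong, (rule jet_intros jet_t)+) simp_all
  then obtain G where "sqrt_fps (b ^ 2 - 4 * c) = fps_X * G" "b ^ 2 - 4 * c = (fps_X * G) ^ 2"
    using sqrt_fps_jet[of "b ^ 2 - 4 * c" 432] by auto
  then have S: "sqrt_fps (b ^ 2 - 4 * c) ^ 2 = b ^ 2 - 4 * c" "fps_nth (sqrt_fps (b ^ 2 - 4 * c)) 0 = 0"
    by simp_all
  note roots = root_plus_minus[OF S(1)]
  have b0: "fps_nth b 0 = - 4"
    using jet_t by (simp add: b_def jet_def fps_power_zeroth)
  have 1: "fps_rel rat_rel (root_plus 1 b c powi K2 + root_minus 1 b c powi K2)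
     (root_plus 1 b c powi K2 + root_minus 1 b c powi K2)"
  proof (rule rat.fps_power_sum)
    show "fps_nth (root_plus 1 b c) 0 \<noteq> 0" "fps_nth (root_minus 1 b c) 0 \<noteq> 0"
      unfolding roots(1,2) using b0 S(2) by simp_all
    have "fps_rel rat_rel b b" "fps_rel rat_rel c c"
      unfolding b_def c_def by (intro rat.fps_intros t)+
    then show "fps_rel rat_rel (root_plus 1 b c + root_minus 1 b c) (root_plus 1 b c + root_minus 1 b c)"
      "fps_rel rat_rel (root_plus 1 b c * root_minus 1 b c) (root_plus 1 b c * root_minus 1 b c)"
      unfolding roots(3,4) by (simp_all only: rat.fps_minus)
  qed
  have 2: "rat_rel (eps 3 powi Kc + eps 3 powi (- Kc)) (eps 3 powi Kc + eps 3 powi (- Kc))"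
    unfolding eps_powi_add[of 3] using cos_thirds_rat[of Kc] by (simp add: rat_rel_def)
  have "Psi3 chi K2 Kc = t powi K2 * (root_plus 1 b c powi K2 + root_minus 1 b c powi K2)
        + fps_const ((eps 3 powi Kc + eps 3 powi (- Kc)) * (-1) powi chi) * t powi K2"
    by (simp add: Psi3_def Let_def t_def b_def c_def)
  then show ?thesis
    by (simp only: 1 2 t minus_one_powi_rat rat.fps_add rat.fps_mult rat.fps_powi rat.fps_const rat.mult)
qed

section \<open>Conjugation on series over the field generated by the square root of 5\<close>

lemma sqrt_prime_irrational:
  assumes "Factorial_Ring.prime (p::nat)"
  shows "sqrt (real p) \<notin> \<rat>"
proof
  assume "sqrt (real p) \<in> \<rat>"
  then obtain m n :: nat where n: "n \<noteq> 0" "\<bar>sqrt (real p)\<bar> = real m / real n" "coprime m n"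
    by (rule Rats_abs_nat_div_natE)
  then have "real m = sqrt (real p) * real n"
    by (simp add: field_simps)
  then have "real (m ^ 2) = real (p * n ^ 2)"
    by (simp add: power_mult_distrib)
  then have eq: "m ^ 2 = p * n ^ 2"
    by (simp only: of_nat_eq_iff)
  then have "p dvd m"
    using assms prime_dvd_power by (metis dvd_triv_left)
  then obtain k where "m = p * k"
    by auto
  then have "n ^ 2 = p * k ^ 2"
    using eq prime_gt_0_nat[OF assms] by (simp add: power2_eq_square mult_ac)
  then have "p dvd n"
    using assms prime_dvd_power by (metis dvd_triv_left)
  with \<open>p dvd m\<close> n(3) assms show False
    by (meson coprime_common_divisor not_prime_unit)
qed

definition r5 :: complex where "r5 = of_real (sqrt 5)"

lemma r5_square: "r5 * r5 = 5"
  by (simp add: r5_def flip: of_real_mult)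

lemma of_real_in_Rats_iff: "complex_of_real x \<in> \<rat> \<longleftrightarrow> x \<in> \<rat>"
proof
  assume "complex_of_real x \<in> \<rat>"
  then obtain a b where "complex_of_real x = of_int a / of_int b"
    by (rule Rats_cases')
  then have "complex_of_real x = of_real (of_int a / of_int b)"
    by simp
  then show "x \<in> \<rat>"
    by (simp only: of_real_eq_iff) simp
next
  assume "x \<in> \<rat>"
  then obtain q where "x = of_rat q"
    by (rule Rats_cases)
  then show "complex_of_real x \<in> \<rat>"
    by simp
qed

lemma r5_irrational: "r5 \<notin> \<rat>"
  using sqrt_prime_irrational[of 5] by (simp add: r5_def of_real_in_Rats_iff)

definition conj5 :: "complex \<Rightarrow> complex \<Rightarrow> bool" where
  "conj5 = adjoin rat_rel r5 (- r5)"

lemma conj5_iff: "conj5 x y \<longleftrightarrow> (\<exists>a\<in>\<rat>. \<exists>b\<in>\<rat>. x = a + b * r5 \<and> y = a - b * r5)"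
  by (auto simp: conj5_def adjoin_def rat_rel_def)

interpretation conj5: field_iso conj5
  unfolding conj5_def
proof (rule rat.field_iso_adjoin)
  show "rat_rel (r5 ^ 2) ((- r5) ^ 2)"
    by (simp add: rat_rel_def power2_eq_square r5_square)
  show "\<not> rat_rel r5 a" "\<not> rat_rel a (- r5)" for a
    using r5_irrational by (auto simp: rat_rel_def)
qed

lemma conj5_sym: "conj5 x y \<Longrightarrow> conj5 y x"
  unfolding conj5_iff by (metis Rats_minus_iff add_uminus_conv_diff diff_minus_eq_add mult_minus_left)

lemma conj5_refl_iff: "conj5 x x \<longleftrightarrow> x \<in> \<rat>"
proof
  assume "conj5 x x"
  then obtain a b where "a \<in> \<rat>" "x = a + b * r5" "x = a - b * r5"
    by (auto simp: conj5_iff)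
  then have "b * r5 = 0" "a \<in> \<rat>" "x = a + b * r5"
    by auto
  then show "x \<in> \<rat>"
    by (metis add.right_neutral)
qed (simp add: field_iso_Rats conj5.field_iso_axioms)

lemma conj5_r5: "conj5 r5 (- r5)"
  unfolding conj5_def by (rule rat.adjoin_gen)

lemma fps_conj5_sym: "fps_rel conj5 F G \<Longrightarrow> fps_rel conj5 G F"
  by (simp add: fps_rel_def conj5_sym)

lemma fps_conj5_refl_iff: "fps_rel conj5 F F \<longleftrightarrow> fps_rel rat_rel F F"
  by (simp add: fps_rel_def conj5_refl_iff rat_rel_def)

definition qd :: "real \<Rightarrow> real \<Rightarrow> complex" where
  "qd a b = of_real a + of_real b * r5"

lemma qd_simps:
  "qd a b + qd c d = qd (a + c) (b + d)"
  "qd a b - qd c d = qd (a - c) (b - d)"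
  "- qd a b = qd (- a) (- b)"
  "qd a b * qd c d = qd (a * c + 5 * (b * d)) (a * d + b * c)"
  using r5_square
  by (simp_all add: qd_def algebra_simps)

lemma qd_zero: "qd 0 0 = 0"
  by (simp add: qd_def)

lemma qd_of_real: "qd a b = of_real (a + b * sqrt 5)"
  by (simp add: qd_def r5_def)

lemma conj5_qd: "a \<in> \<rat> \<Longrightarrow> b \<in> \<rat> \<Longrightarrow> conj5 (qd a b) (qd a (- b))"
  unfolding conj5_iff qd_def using of_real_in_Rats_iff
  by (intro bexI[of _ "of_real a"] bexI[of _ "of_real b"]) auto

definition jet5 :: "complex fps \<Rightarrow> real \<Rightarrow> real \<Rightarrow> real \<Rightarrow> real \<Rightarrow> bool" where
  "jet5 F a b c d \<longleftrightarrow> jet F (qd a b) (qd c d)"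

lemma jet5_const: "jet5 (fps_const (qd a b)) a b 0 0"
  by (simp add: jet5_def qd_zero jet_const)

lemma jet5_one: "jet5 1 1 0 0 0"
  by (simp add: jet5_def qd_def jet_one)

lemma jet5_numeral: "jet5 (numeral n) (numeral n) 0 0 0"
  by (simp add: jet5_def qd_def jet_numeral)

lemma jet5_add: "jet5 F a b c d \<Longrightarrow> jet5 G a' b' c' d' \<Longrightarrow> jet5 (F + G) (a + a') (b + b') (c + c') (d + d')"
  unfolding jet5_def qd_simps[symmetric] by (rule jet_add)

lemma jet5_diff: "jet5 F a b c d \<Longrightarrow> jet5 G a' b' c' d' \<Longrightarrow> jet5 (F - G) (a - a') (b - b') (c - c') (d - d')"
  unfolding jet5_def qd_simps[symmetric] by (rule jet_diff)

lemma jet5_minus: "jet5 F a b c d \<Longrightarrow> jet5 (- F) (- a) (- b) (- c) (- d)"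
  unfolding jet5_def qd_simps[symmetric] by (rule jet_minus)

lemma jet5_mult: "jet5 F a b c d \<Longrightarrow> jet5 G a' b' c' d' \<Longrightarrow>
    jet5 (F * G) (a * a' + 5 * (b * b')) (a * b' + b * a')
      (a * c' + 5 * (b * d') + (c * a' + 5 * (d * b'))) (a * d' + b * c' + (c * b' + d * a'))"
  unfolding jet5_def by (drule (1) jet_mult) (simp only: qd_simps)

lemma jet5_inverse:
  assumes "jet5 F a b c d" "a ^ 2 - 5 * b ^ 2 = n" "n \<noteq> 0" "qd a b * qd a b * qd x y = - qd c d"
  shows "jet5 (inverse F) (a / n) (- b / n) x y"
proof -
  have n: "qd a b * qd (a / n) (- b / n) = 1"
    using assms(2,3) by (simp add: qd_simps) (simp add: qd_def power2_eq_square diff_divide_distrib[symmetric] divide_self_if)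
  then have nz: "qd a b \<noteq> 0"
    by auto
  have "jet (inverse F) (inverse (qd a b)) (- qd c d / qd a b ^ 2)"
    using assms(1) nz unfolding jet5_def by (rule jet_inverse)
  moreover have "inverse (qd a b) = qd (a / n) (- b / n)"
    using n by (rule inverse_unique)
  moreover have "- qd c d / qd a b ^ 2 = qd x y"
    unfolding assms(4)[symmetric] using nz by (simp add: power2_eq_square)
  ultimately show ?thesis
    by (simp add: jet5_def)
qed

lemma jet5_cong:
  "jet5 F a b c d \<Longrightarrow> a = a' \<Longrightarrow> b = b' \<Longrightarrow> c = c' \<Longrightarrow> d = d' \<Longrightarrow> jet5 F a' b' c' d'"
  by simp

lemma rr_denom_nth_0: "fps_nth (rr_denom n k) 0 = 1"
  by (induction n k rule: rr_denom.induct) (simp_all add: fps_divide_unit)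

lemma rational_rr_denom: "fps_rel rat_rel (rr_denom n k) (rr_denom n k)"
  by (induction n k rule: rr_denom.induct) (auto intro!: rat.fps_intros simp: rr_denom_nth_0)

lemma fps_inverse_diff:
  fixes F G :: "'a::field fps"
  assumes "fps_nth F 0 \<noteq> 0" "fps_nth G 0 \<noteq> 0"
  shows "inverse F - inverse G = (G - F) * inverse F * inverse G"
proof -
  have "(G - F) * inverse F * inverse G = (G * inverse G) * inverse F - (F * inverse F) * inverse G"
    by (simp add: algebra_simps)
  then show ?thesis
    using assms by (simp add: inverse_mult_eq_1')
qed

lemma rr_denom_Suc: "\<exists>E. rr_denom (Suc n) k = rr_denom n k + fps_X ^ Suc n * E"
proof (induction n arbitrary: k)
  case 0
  have "fps_X ^ (10 * Suc k) = (fps_X ^ Suc 0 * fps_X ^ (10 * k + 9) :: complex fps)"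
    by (simp flip: power_add power_Suc)
  then show ?case
    by (intro exI[of _ "fps_X ^ (10 * k + 9)"]) simp
next
  case (Suc n)
  obtain E where E: "rr_denom (Suc n) (Suc k) = rr_denom n (Suc k) + fps_X ^ Suc n * E"
    using Suc by blast
  have inv: "F / rr_denom m j = F * inverse (rr_denom m j)" for F m j
    by (simp add: fps_divide_unit rr_denom_nth_0)
  define I where "I = inverse (rr_denom (Suc n) (Suc k)) * inverse (rr_denom n (Suc k))"
  have "inverse (rr_denom (Suc n) (Suc k)) - inverse (rr_denom n (Suc k)) = - (fps_X ^ Suc n * E) * I"
    unfolding fps_inverse_diff[of "rr_denom (Suc n) (Suc k)" "rr_denom n (Suc k)", unfolded rr_denom_nth_0, OF one_neq_zero one_neq_zero]
    by (simp add: E I_def mult.assoc del: rr_denom.simps)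
  then have I: "inverse (rr_denom (Suc n) (Suc k)) = inverse (rr_denom n (Suc k)) + - (fps_X ^ Suc n * E) * I"
    by (metis add.commute diff_add_cancel)
  have "rr_denom (Suc (Suc n)) k = rr_denom (Suc n) k + fps_X ^ (10 * Suc k) * (- (fps_X ^ Suc n * E) * I)"
    unfolding rr_denom.simps(2)[of "Suc n" k] rr_denom.simps(2)[of n k] inv I
    by (simp only: distrib_left add.assoc)
  also have "fps_X ^ (10 * Suc k) * (- (fps_X ^ Suc n * E) * I) = fps_X ^ Suc (Suc n) * (- (fps_X ^ (10 * k + 9) * E * I))"
  proof -
    have "fps_X ^ (10 * Suc k) * fps_X ^ Suc n = (fps_X ^ Suc (Suc n) * fps_X ^ (10 * k + 9) :: complex fps)"
      by (simp flip: power_add power_Suc)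
    then show ?thesis
      by (simp add: mult.assoc[symmetric] del: power_Suc mult_Suc_right)
  qed
  finally show ?case
    by blast
qed

lemma rr_ser_nth: "fps_nth rr_ser n = fps_nth (fps_X ^ 2 / rr_denom n 0) n"
proof -
  define P where "P m = fps_X ^ 2 * inverse (rr_denom m 0)" for m
  have P: "P = (\<lambda>m. fps_X ^ 2 / rr_denom m 0)"
    by (simp add: P_def[abs_def] fps_divide_unit rr_denom_nth_0)
  have "fps_nth (P (Suc m)) n = fps_nth (P m) n" if "n \<le> m" for n m
  proof -
    obtain E where E: "rr_denom (Suc m) 0 = rr_denom m 0 + fps_X ^ Suc m * E"
      using rr_denom_Suc by blast
    have "inverse (rr_denom (Suc m) 0) - inverse (rr_denom m 0)
        = fps_X ^ Suc m * (- E * inverse (rr_denom (Suc m) 0) * inverse (rr_denom m 0))"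
      unfolding fps_inverse_diff[of "rr_denom (Suc m) 0" "rr_denom m 0", unfolded rr_denom_nth_0, OF one_neq_zero one_neq_zero]
      by (simp add: E mult.assoc del: rr_denom.simps power_Suc)
    then have "P (Suc m) - P m
        = fps_X ^ Suc m * (fps_X ^ 2 * (- E * inverse (rr_denom (Suc m) 0) * inverse (rr_denom m 0)))"
      unfolding P_def by (simp add: mult.left_commute del: rr_denom.simps power_Suc flip: right_diff_distrib)
    then have "fps_nth (P (Suc m) - P m) n = 0"
      using that by (simp only: fps_X_power_mult_nth) simp
    then show ?thesis
      by simp
  qed
  then have "lim P = Abs_fps (\<lambda>n. fps_nth (P n) n)"
    by (intro limI fps_eventually_const_limit)
  then show ?thesis
    by (simp add: rr_ser_def P)
qed

lemma rational_rr_ser: "fps_rel rat_rel rr_ser rr_ser"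
proof -
  have "fps_rel rat_rel (fps_X ^ 2 / rr_denom n 0) (fps_X ^ 2 / rr_denom n 0)" for n
    by (intro rat.fps_intros rational_rr_denom) (simp add: rr_denom_nth_0)
  then show ?thesis
    by (auto simp: fps_rel_def rr_ser_nth)
qed

lemma jet5_rr_ser: "jet5 rr_ser 0 0 1 0"
proof -
  have "fps_nth rr_ser 0 = 0" "fps_nth rr_ser 1 = 0" "fps_nth rr_ser 2 = 1"
    by (simp_all only: rr_ser_nth fps_divide_unit rr_denom_nth_0 one_neq_zero not_False_eq_True
        fps_X_power_mult_nth) (simp_all del: rr_denom.simps add: rr_denom_nth_0)
  then show ?thesis
    by (simp add: jet5_def jet_def qd_def)
qed

lemma cos_fifths:
  "cos (2 * pi / 5) = (sqrt 5 - 1) / 4" "cos (4 * pi / 5) = - (sqrt 5 + 1) / 4"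
proof -
  define c d where "c = cos (2 * pi / 5)" and "d = cos (4 * pi / 5)"
  have d: "d = 2 * c ^ 2 - 1"
    unfolding c_def d_def using cos_double_cos[of "2 * pi / 5"] by simp
  have "cos (8 * pi / 5) = c"
    unfolding c_def using cos_2pi_minus[of "2 * pi / 5"] by (simp add: field_simps)
  then have c: "c = 2 * d ^ 2 - 1"
    unfolding d_def using cos_double_cos[of "4 * pi / 5"] by simp
  have "d < c"
    unfolding c_def d_def by (intro cos_monotone_0_pi) simp_all
  have "(c - d) * (2 * (c + d) + 1) = (c - (2 * d ^ 2 - 1)) - (d - (2 * c ^ 2 - 1))"
    by (simp add: algebra_simps power2_eq_square)
  also have "\<dots> = 0"
    unfolding c[symmetric] d[symmetric] by simp
  finally have sum: "2 * (c + d) + 1 = 0"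
    using \<open>d < c\<close> by simp
  have "c > 0"
    unfolding c_def by (intro cos_gt_zero) (auto simp: field_simps)
  have "(4 * c + 1) ^ 2 = 5 + 8 * (2 * c ^ 2 - 1 + c + 1 / 2)"
    by (simp add: algebra_simps power2_eq_square)
  also have "\<dots> = 5"
    using sum unfolding d by simp
  finally have "4 * c + 1 = sqrt 5"
    using \<open>c > 0\<close> by (intro real_sqrt_unique[symmetric]) auto
  then show "cos (2 * pi / 5) = (sqrt 5 - 1) / 4" "cos (4 * pi / 5) = - (sqrt 5 + 1) / 4"
    using sum unfolding c_def[symmetric] d_def[symmetric] by simp_all
qed

lemma conj5_cos_fifths:
  "conj5 (of_real (cos (2 * pi * of_int k / 5))) (of_real (cos (2 * pi * of_int (2 * k) / 5)))"
  "conj5 (of_real (cos (2 * pi * of_int (2 * k) / 5))) (of_real (cos (2 * pi * of_int k / 5)))"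
proof -
  have *: "cos (2 * pi * of_int k / 5) = cos (2 * pi * of_int (k mod 5) / 5)" for k
    using cos_int_mod[of 5 k] by simp
  have c1: "complex_of_real (cos (2 * pi / 5)) = qd (- (1/4)) (1/4)"
    and c2: "complex_of_real (cos (4 * pi / 5)) = qd (- (1/4)) (- (1/4))"
    unfolding cos_fifths qd_of_real by (simp_all add: field_simps)
  have c3: "cos (6 * pi / 5) = cos (4 * pi / 5)" and c4: "cos (8 * pi / 5) = cos (2 * pi / 5)"
    using cos_2pi_minus[of "4 * pi / 5"] cos_2pi_minus[of "2 * pi / 5"] by (simp_all add: field_simps)
  have rel: "conj5 (qd (- (1/4)) (1/4)) (qd (- (1/4)) (- (1/4)))" "conj5 (qd (- (1/4)) (- (1/4))) (qd (- (1/4)) (1/4))"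
    using conj5_qd[of "-1/4" "1/4"] conj5_qd[of "-1/4" "-1/4"] by simp_all
  have two: "2 * k mod 5 = (2 * (k mod 5)) mod 5"
    by (simp add: mod_mult_right_eq)
  have "k mod 5 \<in> {0, 1, 2, 3, 4}"
    by auto
  then show "conj5 (of_real (cos (2 * pi * of_int k / 5))) (of_real (cos (2 * pi * of_int (2 * k) / 5)))"
    unfolding *[of k] *[of "2 * k"] two
    by (elim insertE) (simp_all add: c1 c2 c3 c4 rel conj5.one)
  then show "conj5 (of_real (cos (2 * pi * of_int (2 * k) / 5))) (of_real (cos (2 * pi * of_int k / 5)))"
    by (rule conj5_sym)
qed

lemma conj5_Theta_A4: "fps_rel conj5 (Theta_A 10 4 1) (Theta_A 10 4 2)"
  unfolding fps_rel_def
proof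
  fix n
  show "conj5 (fps_nth (Theta_A 10 4 1) n) (fps_nth (Theta_A 10 4 2) n)"
    using conj5_cos_fifths(1) by (simp add: Theta_A_nth del: of_int_mult) (intro conj5.sum)
qed

lemma conj5_t_A4: "fps_rel conj5 (t_A 10 4 1) (t_A 10 4 2)"
  using fps_rel_of_rat[OF conj5.field_iso_axioms rational_Theta_A_0[of 4]]
  by (intro fps_rel_t_A conj5.field_iso_axioms conj5_Theta_A4) simp_all

lemma weight_norm_4: "weight_norm 4 (vCons a (vCons b (vCons c (vCons d vNil))))
  = a ^ 2 + b ^ 2 + c ^ 2 + d ^ 2 + (a + b) ^ 2 + (b + c) ^ 2 + (c + d) ^ 2
    + (a + b + c) ^ 2 + (b + c + d) ^ 2 + (a + b + c + d) ^ 2"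
proof -
  have [simp]: "{..4} = {0, 1, 2, 3, 4::nat}" "{..<2} = {0, 1::nat}" "{..<3} = {0, 1, 2::nat}"
    "{..<4} = {0, 1, 2, 3::nat}" "{0..<2} = {0, 1::nat}" "{0..<3} = {0, 1, 2::nat}"
    "{0..<4} = {0, 1, 2, 3::nat}" "{Suc 0..<2} = {1::nat}" "{Suc 0..<3} = {1, 2::nat}" "{Suc 0..<4} = {1, 2, 3::nat}"
    "{2..<3} = {2::nat}" "{2..<4} = {2, 3::nat}" "{3..<4} = {3::nat}" "{..<Suc 0} = {0}"
    by auto
  show ?thesis
    by (simp add: weight_norm_def vec_index_vCons add_ac)
qed

lemma shell_4: 
  assumes "0 < n" "n \<le> 2"
  shows "shell 4 n = {}"
proof (rule equals0I)
  fix v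
  assume "v \<in> shell 4 n"
  then have v: "v \<in> carrier_vec 4" and norm: "weight_norm 4 v = int n"
    by (simp_all add: shell_def)
  obtain a b c d where abcd: "v = vCons a (vCons b (vCons c (vCons d vNil)))"
  proof -
    have "v = vCons (vec_index v 0) (vCons (vec_index v 1) (vCons (vec_index v 2) (vCons (vec_index v 3) vNil)))"
    proof (rule eq_vecI)
      fix i
      assume "i < dim_vec (vCons (vec_index v 0) (vCons (vec_index v 1) (vCons (vec_index v 2) (vCons (vec_index v 3) vNil))))"
      then have "i \<in> {0, 1, 2, 3}"
        by auto
      then show "vec_index v i = vec_index (vCons (vec_index v 0) (vCons (vec_index v 1) (vCons (vec_index v 2) (vCons (vec_index v 3) vNil)))) i"
        by (auto simp: vec_index_vCons)
    qed (use v in simp)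
    then show ?thesis
      by (rule that)
  qed
  have sq: "a ^ 2 + b ^ 2 + c ^ 2 + d ^ 2 + (a + b) ^ 2 + (b + c) ^ 2 + (c + d) ^ 2
    + (a + b + c) ^ 2 + (b + c + d) ^ 2 + (a + b + c + d) ^ 2 = int n"
    using norm by (simp only: abcd weight_norm_4)
  have "a ^ 2 \<le> 2" "b ^ 2 \<le> 2" "c ^ 2 \<le> 2" "d ^ 2 \<le> 2"
    using sq \<open>n \<le> 2\<close> zero_le_power2[of a] zero_le_power2[of b] zero_le_power2[of c] zero_le_power2[of d]
      zero_le_power2[of "a + b"] zero_le_power2[of "b + c"] zero_le_power2[of "c + d"]
      zero_le_power2[of "a + b + c"] zero_le_power2[of "b + c + d"] zero_le_power2[of "a + b + c + d"]
    by linarith+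
  then have "a \<in> {-1, 0, 1}" "b \<in> {-1, 0, 1}" "c \<in> {-1, 0, 1}" "d \<in> {-1, 0, 1}"
    using square_le_2 by auto
  then show False
    using sq assms by (elim insertE emptyE; hypsubst) simp_all
qed

lemma jet5_t_A4: "jet5 (t_A 10 4 l) 1 0 0 0"
proof -
  have "jet (Theta_A 10 4 l) 1 0" for l
    by (simp add: jet_def Theta_A_nth shell_0 shell_4 weight_height_0)
  then have "jet (t_A 10 4 l) (1 / 1) ((0 - 1 * 0 / 1) / 1)"
    unfolding t_A_def by (intro jet_divide) auto
  then show ?thesis
    by (simp add: jet5_def qd_def)
qed

lemma golden_qd: "golden = qd (1/2) (1/2)"
  unfolding golden_def qd_of_real by (simp add: add_divide_distrib)

lemma golden_neq_0: "golden \<noteq> 0"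
proof -
  have "1 + sqrt 5 > 0"
    by (simp add: add_pos_pos)
  then show ?thesis
    unfolding golden_def of_real_eq_0_iff by simp
qed

lemma rr_ser_nth_0: "fps_nth rr_ser 0 = 0"
  using jet5_rr_ser by (simp add: jet5_def jet_def qd_zero)

lemma jet5_s_ser: "jet5 s_ser (-1/2) (1/2) (-5/2) (1/2)"
proof -
  have "jet5 (fps_const golden + rr_ser) (1/2) (1/2) 1 0"
    unfolding golden_qd by (rule jet5_cong, (rule jet5_add jet5_const jet5_rr_ser)+) simp_all
  then have inv: "jet5 (inverse (fps_const golden + rr_ser)) (-1/2) (1/2) (-3/2) (1/2)"
    by (rule jet5_cong[OF jet5_inverse[where n = "-1" and x = "-3/2" and y = "1/2"]])
      (simp_all add: qd_simps power2_eq_square)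
  have s: "s_ser = (1 - fps_const golden * rr_ser) * inverse (fps_const golden + rr_ser)"
    unfolding s_ser_def by (rule fps_divide_unit) (simp add: golden_neq_0 rr_ser_nth_0)
  show ?thesis
    unfolding s golden_qd
    by (rule jet5_cong, (rule jet5_mult jet5_diff jet5_one jet5_const jet5_rr_ser inv[unfolded golden_qd])+) simp_all
qed

lemma power_5_eq: "(x::'a::monoid_mult) ^ 5 = x * (x * (x * (x * x)))"
  by (simp add: eval_nat_numeral)

lemma jet5_s_ser_5: "jet5 (s_ser ^ 5) (-11/2) (5/2) (-125/2) (55/2)"
  unfolding power_5_eq by (rule jet5_cong, (rule jet5_mult jet5_s_ser)+) simp_all

lemma s_ser_powi: "s_ser powi (-5) = inverse (s_ser ^ 5)"
  by (simp add: power_int_def fps_inverse_power)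

lemma jet5_s_ser_minus_5: "jet5 (s_ser powi (-5)) (11/2) (5/2) (125/2) (55/2)"
  unfolding s_ser_powi
  by (rule jet5_cong[OF jet5_inverse[OF jet5_s_ser_5, where n = "-1" and x = "125/2" and y = "55/2"]])
      (simp_all add: qd_simps power2_eq_square)

lemma conj5_s_ser: "fps_rel conj5 s_ser (- inverse s_ser)"
proof -
  define s' where "s' = (1 - fps_const (1 - golden) * rr_ser) / (fps_const (1 - golden) + rr_ser)"
  have g: "conj5 golden (1 - golden)"
  proof -
    have "1 - golden = qd (1/2) (- (1/2))"
      unfolding golden_def qd_of_real by (simp add: field_simps)
    then show ?thesis
      unfolding golden_qd by (metis conj5_qd Rats_divide Rats_1 Rats_number_of)
  qed
  have rr: "fps_rel conj5 rr_ser rr_ser"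
    by (rule fps_rel_of_rat[OF conj5.field_iso_axioms rational_rr_ser])
  have "1 - golden \<noteq> 0"
    using conj5.zero_iff[OF g] golden_neq_0 by simp
  have "fps_rel conj5 s_ser s'"
    unfolding s_ser_def s'_def
    by (intro conj5.fps_intros rr g) (simp add: rr_ser_nth_0 golden_neq_0)
  moreover have "s' = - inverse s_ser"
  proof -
    define N D N' D' where "N = 1 - fps_const golden * rr_ser" and "D = fps_const golden + rr_ser"
      and "N' = 1 - fps_const (1 - golden) * rr_ser" and "D' = fps_const (1 - golden) + rr_ser"
    have gg: "golden * golden = golden + 1"
      by (simp add: golden_qd qd_simps) (simp add: qd_def)
    define g where "g = fps_const golden"
    have gg': "g * g = g + 1"
      unfolding g_def by (simp add: gg flip: fps_const_add)
    have N': "N' = 1 - (1 - g) * rr_ser" and D': "D' = 1 - g + rr_ser"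
      unfolding N'_def D'_def g_def by (simp_all flip: fps_const_sub)
    have "N' * N = 1 - rr_ser + (g - g * g) * (rr_ser * rr_ser)"
      unfolding N' N_def g_def[symmetric] by (simp add: algebra_simps)
    also have "\<dots> = - (g - g * g + rr_ser + rr_ser * rr_ser)"
      unfolding gg' by simp
    also have "\<dots> = - (D' * D)"
      unfolding D' D_def g_def[symmetric] by (simp add: algebra_simps)
    finally have NN: "N' * N = - (D' * D)" .
    have units: "fps_nth N 0 \<noteq> 0" "fps_nth D 0 \<noteq> 0" "fps_nth D' 0 \<noteq> 0"
      using golden_neq_0 \<open>1 - golden \<noteq> 0\<close> by (simp_all add: N_def D_def D'_def rr_ser_nth_0)
    have s: "s_ser = N * inverse D" and s': "s' = N' * inverse D'"
      using units by (simp_all add: s_ser_def s'_def fps_divide_unit N_def D_def N'_def D'_def)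
    have "s_ser * s' = (N' * N) * inverse D * inverse D'"
      unfolding s s' by (simp add: mult_ac)
    also have "\<dots> = - ((D * inverse D) * (D' * inverse D'))"
      unfolding NN by (simp add: mult_ac)
    also have "\<dots> = - 1"
      using units by (simp add: inverse_mult_eq_1')
    finally have "s_ser * (- s') = 1"
      by simp
    then show ?thesis
      by (metis fps_inverse_unique add.inverse_inverse mult.commute)
  qed
  ultimately show ?thesis
    by simp
qed

lemma conj5_s_ser_5:
  "fps_rel conj5 (s_ser ^ 5) (- (s_ser powi (-5)))" "fps_rel conj5 (s_ser powi (-5)) (- (s_ser ^ 5))"
proof -
  have "(- inverse s_ser) ^ 5 = - (s_ser powi (-5))"
    by (simp add: s_ser_powi fps_inverse_power)
  then show *: "fps_rel conj5 (s_ser ^ 5) (- (s_ser powi (-5)))"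
    using conj5.fps_power[OF conj5_s_ser, of 5] by simp
  show "fps_rel conj5 (s_ser powi (-5)) (- (s_ser ^ 5))"
    using conj5.fps_minus[OF fps_conj5_sym[OF *]] by simp
qed

section \<open>Rank 5\<close>

lemma conj5_gamma: "fps_rel conj5 gamma1 gamma2"
proof -
  have "fps_rel conj5 (fps_const (1/25) * t_A 10 4 1 * (3 * s_ser powi (-5) + 2 - 8 * s_ser ^ 5))
      (fps_const (1/25) * t_A 10 4 2 * (3 * - (s_ser ^ 5) + 2 - 8 * - (s_ser powi (-5))))"
    by (intro conj5.fps_mult conj5.fps_add conj5.fps_diff conj5.fps_numeral conj5.fps_const conj5_t_A4 conj5_s_ser_5
        conj5.divide conj5.one conj5.numeral)
  moreover have "3 * - (s_ser ^ 5) + 2 - 8 * - (s_ser powi (-5)) = 8 * s_ser powi (-5) + 2 - 3 * s_ser ^ 5"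
    by simp
  ultimately show ?thesis
    by (simp only: gamma1_def gamma2_def)
qed

lemma jet5_gamma1: "jet5 gamma1 (5/2) (-1/2) (55/2) (-11/2)"
proof -
  have 25: "jet5 (fps_const (1/25)) (1/25) 0 0 0"
    using jet5_const[of "1/25" 0] by (simp add: qd_def)
  show ?thesis
    unfolding gamma1_def
    by (rule jet5_cong, (rule jet5_mult jet5_add jet5_diff jet5_numeral 25 jet5_t_A4 jet5_s_ser_5 jet5_s_ser_minus_5)+)
      simp_all
qed

definition A5 :: "complex fps" where "A5 = 3 * s_ser powi (-5) + 1"
definition B5 :: "complex fps" where "B5 = 1 - 3 * s_ser ^ 5"
definition bX :: "complex fps" where
  "bX = - (fps_const (4/5) * gamma1 * (gamma1 * inverse (t_A 10 4 1) - 1) * A5)"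
definition cX :: "complex fps" where
  "cX = fps_const (4/5) * gamma1 ^ 2 * A5"
definition bY :: "complex fps" where
  "bY = - (fps_const (4/5) * gamma2 * (gamma2 * inverse (t_A 10 4 2) - 1) * B5)"
definition cY :: "complex fps" where
  "cY = fps_const (4/5) * gamma2 ^ 2 * B5"

lemma conj5_AB: "fps_rel conj5 A5 B5"
proof -
  have "fps_rel conj5 A5 (3 * - (s_ser ^ 5) + 1)"
    unfolding A5_def by (intro conj5.fps_mult conj5.fps_add conj5.fps_numeral conj5.fps_one conj5_s_ser_5)
  then show ?thesis
    by (simp add: B5_def)
qed

lemma conj5_bc: "fps_rel conj5 bX bY" "fps_rel conj5 cX cY"
  unfolding bX_def bY_def cX_def cY_def
  by (intro conj5.fps_mult conj5.fps_minus conj5.fps_diff conj5.fps_inverse conj5.fps_one conj5.fps_power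
      conj5.fps_const conj5.divide conj5.numeral conj5_gamma conj5_AB conj5_t_A4)+

lemma jet5_45: "jet5 (fps_const (4/5)) (4/5) 0 0 0"
  using jet5_const[of "4/5" 0] by (simp add: qd_def)

lemma jet5_A5: "jet5 A5 (35/2) (15/2) (375/2) (165/2)"
  unfolding A5_def
  by (rule jet5_cong, (rule jet5_mult jet5_add jet5_one jet5_numeral jet5_s_ser_minus_5)+) simp_all

lemma jet5_inverse_t: "jet5 (inverse (t_A 10 4 l)) 1 0 0 0"
  by (rule jet5_cong[OF jet5_inverse[OF jet5_t_A4, where n = 1 and x = 0 and y = 0]])
    (simp_all add: qd_simps)

lemma jet5_bX: "jet5 bX (-10) (-2) (-530) (-162)"
  unfolding bX_def
  by (rule jet5_cong, (rule jet5_mult jet5_diff jet5_minus jet5_one jet5_gamma1 jet5_A5 jet5_45 jet5_inverse_t)+)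
     simp_all

lemma jet5_cX: "jet5 cX 30 10 960 340"
  unfolding cX_def power2_eq_square
  by (rule jet5_cong, (rule jet5_mult jet5_gamma1 jet5_A5 jet5_45)+) simp_all

lemma jet5_discriminant_X: "jet5 (bX ^ 2 - 4 * cX) 0 0 10000 4000"
  unfolding power2_eq_square
  by (rule jet5_cong, (rule jet5_mult jet5_diff jet5_numeral jet5_bX jet5_cX)+) simp_all

lemma jet5_conj5:
  assumes "fps_rel conj5 F G" "jet5 F a b c d" "a \<in> \<rat>" "b \<in> \<rat>" "c \<in> \<rat>" "d \<in> \<rat>"
  shows "jet5 G a (- b) c (- d)"
proof -
  have "conj5 (fps_nth F n) (fps_nth G n)" for n
    using assms(1) by (simp add: fps_rel_def)
  then have "fps_nth G n = y" if "conj5 (fps_nth F n) y" for n y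
    using that conj5.functional by blast
  then show ?thesis
    using assms(2) conj5_qd[OF assms(3,4)] conj5_qd[OF assms(5,6)] conj5.zero
    by (simp add: jet5_def jet_def)
qed

lemma conj5_discriminant: "fps_rel conj5 (bX ^ 2 - 4 * cX) (bY ^ 2 - 4 * cY)"
  by (intro conj5.fps_diff conj5.fps_mult conj5.fps_power conj5.fps_numeral conj5_bc)

lemma conj5_sqrt_discriminants:
  defines "SX \<equiv> sqrt_fps (bX ^ 2 - 4 * cX)" and "SY \<equiv> sqrt_fps (bY ^ 2 - 4 * cY)"
  shows "SX ^ 2 = bX ^ 2 - 4 * cX" "SY ^ 2 = bY ^ 2 - 4 * cY"
    "fps_nth SX 0 = 0" "fps_nth SY 0 = 0" "fps_rel conj5 (SX * SY) (- (SX * SY))"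
proof -
  have "sqrt 5 ^ 2 < (5/2) ^ 2"
    by (simp add: power2_eq_square)
  then have "sqrt 5 < 5/2"
    by (rule power2_less_imp_less) simp
  then have pos: "10000 + 4000 * sqrt 5 > 0" "10000 + - 4000 * sqrt 5 > 0"
    by (simp_all add: add_pos_pos)
  have "jet (bX ^ 2 - 4 * cX) 0 (of_real (10000 + 4000 * sqrt 5))"
    using jet5_discriminant_X by (simp only: jet5_def qd_zero qd_of_real[of 10000])
  then obtain G where G: "SX = fps_X * G" "bX ^ 2 - 4 * cX = (fps_X * G) ^ 2"
      "fps_nth G 0 = of_real (sqrt (10000 + 4000 * sqrt 5))"
    unfolding SX_def using pos(1) by (rule sqrt_fps_jet)
  have "jet5 (bY ^ 2 - 4 * cY) 0 (- 0) 10000 (- 4000)"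
    by (rule jet5_conj5[OF conj5_discriminant jet5_discriminant_X]) simp_all
  then have "jet (bY ^ 2 - 4 * cY) 0 (of_real (10000 + - 4000 * sqrt 5))"
    by (simp only: jet5_def qd_zero qd_of_real[of 10000] minus_zero)
  then obtain H where H: "SY = fps_X * H" "bY ^ 2 - 4 * cY = (fps_X * H) ^ 2"
      "fps_nth H 0 = of_real (sqrt (10000 + - 4000 * sqrt 5))"
    unfolding SY_def using pos(2) by (rule sqrt_fps_jet)
  show "SX ^ 2 = bX ^ 2 - 4 * cX" "SY ^ 2 = bY ^ 2 - 4 * cY" "fps_nth SX 0 = 0" "fps_nth SY 0 = 0"
    using G H by simp_all
  have "sqrt (10000 + 4000 * sqrt 5) * sqrt (10000 + - 4000 * sqrt 5) = sqrt (2000 ^ 2 * 5)"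
    unfolding real_sqrt_mult[symmetric] by (simp add: algebra_simps)
  also have "\<dots> = 2000 * sqrt 5"
    by (simp only: real_sqrt_mult real_sqrt_abs)
  finally have GH0: "fps_nth (G * H) 0 = qd 0 2000"
    unfolding fps_mult_nth_0 G(3) H(3) qd_of_real of_real_mult[symmetric] by simp
  have prod: "fps_X ^ 4 * (G * H) ^ 2 = (bX ^ 2 - 4 * cX) * (bY ^ 2 - 4 * cY)"
    unfolding G(2) H(2) by (simp add: power_mult_distrib mult_ac flip: power_add)
  have "fps_nth ((G * H) ^ 2) n = fps_nth ((bX ^ 2 - 4 * cX) * (bY ^ 2 - 4 * cY)) (n + 4)" for n
    unfolding prod[symmetric] fps_X_power_mult_nth by simp
  moreover have "fps_rel conj5 ((bX ^ 2 - 4 * cX) * (bY ^ 2 - 4 * cY)) ((bX ^ 2 - 4 * cX) * (bY ^ 2 - 4 * cY))"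
    using conj5.fps_mult[OF conj5_discriminant fps_conj5_sym[OF conj5_discriminant]] by (simp only: mult.commute)
  ultimately have "fps_rel conj5 ((G * H) ^ 2) ((G * H) ^ 2)"
    by (simp only: fps_rel_def simp_thms)
  moreover have "conj5 (fps_nth (G * H) 0) (fps_nth (- (G * H)) 0)"
    using conj5_qd[of 0 2000] unfolding fps_neg_nth GH0 by (simp add: qd_simps)
  moreover have "fps_nth (G * H) 0 \<noteq> 0"
    unfolding GH0 by (simp add: qd_def r5_def)
  ultimately have "fps_rel conj5 (G * H) (- (G * H))"
    by - (rule conj5.fps_sqrt, simp_all only: power2_minus numeral_neq_zero not_False_eq_True)
  then have "fps_rel conj5 (fps_X ^ 2 * (G * H)) (fps_X ^ 2 * - (G * H))"
    by (intro conj5.fps_mult conj5.fps_power conj5.fps_X)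
  moreover have "SX * SY = fps_X ^ 2 * (G * H)"
    unfolding G H by (simp add: power2_eq_square mult_ac)
  ultimately show "fps_rel conj5 (SX * SY) (- (SX * SY))"
    by simp
qed

lemma fps_half: "fps_const (1/2) * (2 * F) = (F :: complex fps)"
  by (simp add: numeral_fps_const flip: mult.assoc)

definition W5 :: "complex fps" where
  "W5 = fps_const (6/25) * (8 * s_ser powi (-5) - 13 - 8 * s_ser ^ 5)"

lemma jet5_W5: "jet5 W5 18 0 240 0"
  and conj5_W5: "fps_rel conj5 W5 W5"
proof -
  have 625: "jet5 (fps_const (6/25)) (6/25) 0 0 0"
    using jet5_const[of "6/25" 0] by (simp add: qd_def)
  show "jet5 W5 18 0 240 0"
    unfolding W5_def
    by (rule jet5_cong, (rule jet5_mult jet5_diff jet5_numeral 625 jet5_s_ser_5 jet5_s_ser_minus_5)+) simp_all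
  have "fps_rel conj5 W5 (fps_const (6/25) * (8 * - (s_ser ^ 5) - 13 - 8 * - (s_ser powi (-5))))"
    unfolding W5_def
    by (intro conj5.fps_mult conj5.fps_diff conj5.fps_numeral conj5.fps_const conj5.divide conj5.numeral conj5_s_ser_5)
  moreover have "8 * - (s_ser ^ 5) - 13 - 8 * - (s_ser powi (-5)) = 8 * s_ser powi (-5) - 13 - 8 * s_ser ^ 5"
    by simp
  ultimately show "fps_rel conj5 W5 W5"
    by (simp only: W5_def)
qed

lemma Z5_properties:
  "Z5 * inverse Z5 = 1" "fps_nth Z5 0 = qd 9 4" "fps_rel conj5 Z5 (inverse Z5)"
proof -
  have W0: "fps_nth W5 0 = 18"
    using jet5_W5 by (simp add: jet5_def jet_def qd_def)
  have "fps_nth (W5 ^ 2 - 4) 0 = (qd 0 8) ^ 2"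
    by (simp add: fps_power_zeroth W0 power2_eq_square qd_simps) (simp add: qd_def)
  moreover have "qd 0 8 \<noteq> 0"
    by (simp add: qd_def r5_def)
  ultimately obtain Q where Q: "Q ^ 2 = W5 ^ 2 - 4" "fps_nth Q 0 = qd 0 8"
    by (rule fps_square_root_ex)
  define Z where "Z = fps_const (1/2) * (W5 + Q)"
  define Z' where "Z' = fps_const (1/2) * (W5 - Q)"
  have "Z * Z' = fps_const (1/2) * (fps_const (1/2) * (W5 ^ 2 - Q ^ 2))"
    by (simp add: Z_def Z'_def power2_eq_square algebra_simps)
  also have "W5 ^ 2 - Q ^ 2 = 2 * (2 * 1)"
    unfolding Q by simp
  also have "fps_const (1/2) * (fps_const (1/2) * (2 * (2 * 1))) = (1 :: complex fps)"
    by (simp only: fps_half)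
  finally have ZZ': "Z * Z' = 1" .
  then have inv: "inverse Z = Z'"
    by (metis fps_inverse_unique mult.commute)
  have sum: "Z + Z' = W5"
    using fps_half[of W5] by (simp add: Z_def Z'_def algebra_simps)
  have Z0: "fps_nth Z 0 = qd 9 4"
    by (simp add: Z_def W0 Q) (simp add: qd_def algebra_simps)
  have qd: "qd 9 4 = of_real (9 + 4 * sqrt 5)"
    by (simp add: qd_of_real)
  have "Z5 = Z"
    unfolding Z5_def W5_def[symmetric]
  proof (rule the_equality)
    show "Z - W5 + inverse Z = 0 \<and> fps_nth Z 0 = of_real (9 + 4 * sqrt 5)"
      using sum by (simp add: inv Z0 qd algebra_simps)
  next
    fix Y
    assume Y: "Y - W5 + inverse Y = 0 \<and> fps_nth Y 0 = of_real (9 + 4 * sqrt 5)"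
    then have Y0: "fps_nth Y 0 = qd 9 4"
      by (simp add: qd)
    have "qd 9 4 * qd 9 (-4) = 1"
      by (simp add: qd_simps) (simp add: qd_def)
    then have "qd 9 4 \<noteq> 0"
      by auto
    then have YY: "Y * inverse Y = 1"
      using Y0 by (simp add: inverse_mult_eq_1')
    have sumY: "Y + inverse Y = W5"
      using Y by (simp add: algebra_simps)
    show "Y = Z"
    proof (rule ccontr)
      assume "Y \<noteq> Z"
      have "(Z - Y) * (Z - inverse Y) = Z * Z - Z * (Y + inverse Y) + Y * inverse Y"
        by (simp add: algebra_simps)
      also have "\<dots> = 0"
        unfolding YY sumY sum[symmetric] using ZZ' by (simp add: algebra_simps)
      finally have "Z = inverse Y"
        using \<open>Y \<noteq> Z\<close> by simp
      then have "Z' = Y"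
        using inv fps_inverse_idempotent[of Y] Y0 \<open>qd 9 4 \<noteq> 0\<close> by simp
      then have "fps_nth Z' 0 = qd 9 4"
        using Y0 by simp
      moreover have "fps_nth Z' 0 = qd 9 (-4)"
        by (simp add: Z'_def W0 Q) (simp add: qd_def algebra_simps)
      ultimately show False
        by (simp add: qd_def r5_def)
    qed
  qed
  moreover have "fps_rel conj5 Q (- Q)"
  proof (rule conj5.fps_sqrt)
    show "fps_rel conj5 (Q ^ 2) ((- Q) ^ 2)"
      unfolding power2_minus Q by (intro conj5.fps_diff conj5.fps_power conj5.fps_numeral conj5_W5)
    show "conj5 (fps_nth Q 0) (fps_nth (- Q) 0)"
      using conj5_qd[of 0 8] by (simp add: Q qd_simps)
    show "fps_nth Q 0 \<noteq> 0"
      by (simp add: Q qd_def r5_def)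
  qed simp
  then have "fps_rel conj5 Z (fps_const (1/2) * (W5 + - Q))"
    unfolding Z_def
    by (intro conj5.fps_mult conj5.fps_add conj5.fps_const conj5.divide conj5.one conj5.numeral conj5_W5)
  then have "fps_rel conj5 Z Z'"
    by (simp add: Z'_def)
  ultimately show "Z5 * inverse Z5 = 1" "fps_nth Z5 0 = qd 9 4" "fps_rel conj5 Z5 (inverse Z5)"
    using ZZ' Z0 inv by simp_all
qed

lemma fps_powi_mult:
  fixes F G :: "'a::field fps"
  shows "(F * G) powi n = F powi n * G powi n"
  by (simp add: power_int_def power_mult_distrib fps_inverse_mult)

lemma fps_nth_gammas: "fps_nth (gamma1 * gamma2) 0 = 5" "fps_nth gamma1 0 \<noteq> 0" "fps_nth gamma2 0 \<noteq> 0"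
proof -
  have 1: "fps_nth gamma1 0 = qd (5/2) (-1/2)"
    using jet5_gamma1 by (simp add: jet5_def jet_def)
  have "jet5 gamma2 (5/2) (- (-1/2)) (55/2) (- (-11/2))"
    by (rule jet5_conj5[OF conj5_gamma jet5_gamma1]) simp_all
  then have 2: "fps_nth gamma2 0 = qd (5/2) (1/2)"
    by (simp add: jet5_def jet_def)
  show "fps_nth (gamma1 * gamma2) 0 = 5"
    by (simp add: 1 2 qd_simps) (simp add: qd_def)
  then show "fps_nth gamma1 0 \<noteq> 0" "fps_nth gamma2 0 \<noteq> 0"
    by auto
qed

lemma sqrt_prefactors:
  obtains w w' where
    "w ^ 2 = Z5 / (gamma1 * gamma2)" "w' ^ 2 = 1 / (Z5 * gamma1 * gamma2)"
    "positive_lead w" "positive_lead w'" "fps_rel conj5 w w'"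
proof -
  define g where "g = gamma1 * gamma2"
  have g0: "fps_nth g 0 = 5"
    unfolding g_def by (rule fps_nth_gammas)
  have Z0: "fps_nth Z5 0 \<noteq> 0"
    using Z5_properties(1) by (metis fps_inverse_eq_0 mult_zero_right zero_neq_one)
  have Zi0: "fps_nth (inverse Z5) 0 = qd 9 (-4)"
    using conj5.functional[OF fps_rel_nth[OF Z5_properties(3), of 0]] conj5_qd[of 9 4] Z5_properties(2)
    by simp
  have "sqrt 5 ^ 2 < (5/2) ^ 2"
    by (simp add: power2_eq_square)
  then have "sqrt 5 < 5/2"
    by (rule power2_less_imp_less) simp
  then have pos: "1 + 2/5 * sqrt 5 > 0" "1 + - 2/5 * sqrt 5 > 0"
    by (simp_all add: add_pos_pos)
  have div5: "qd a b / 5 = qd (a / 5) (b / 5)" for a b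
    by (simp add: qd_def add_divide_distrib)
  have "fps_nth (Z5 / g) 0 = (qd 1 (2/5)) ^ 2"
    using g0 by (simp add: fps_nth_divide_0 Z5_properties(2) power2_eq_square qd_simps div5)
  moreover have "qd 1 (2/5) \<noteq> 0" "qd 1 (- 2/5) \<noteq> 0"
    using pos unfolding qd_of_real of_real_eq_0_iff by simp_all
  ultimately obtain w where w: "w ^ 2 = Z5 / g" "fps_nth w 0 = qd 1 (2/5)"
    by (elim fps_square_root_ex)
  have "fps_nth (inverse Z5 / g) 0 = (qd 1 (- 2/5)) ^ 2"
    using g0 Zi0 by (simp add: fps_nth_divide_0 power2_eq_square qd_simps div5 del: fps_inverse_nth_0)
  with \<open>qd 1 (- 2/5) \<noteq> 0\<close> obtain w' where w': "w' ^ 2 = inverse Z5 / g" "fps_nth w' 0 = qd 1 (- 2/5)"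
    by (elim fps_square_root_ex)
  have "fps_rel conj5 g (gamma2 * gamma1)"
    unfolding g_def by (intro conj5.fps_mult conj5_gamma fps_conj5_sym[OF conj5_gamma])
  then have g: "fps_rel conj5 g g"
    by (simp add: g_def mult.commute)
  have rel: "fps_rel conj5 w w'"
  proof (rule conj5.fps_sqrt)
    show "fps_rel conj5 (w ^ 2) (w' ^ 2)"
      unfolding w w' using g0 by (intro conj5.fps_divide Z5_properties g) simp
    show "conj5 (fps_nth w 0) (fps_nth w' 0)"
      unfolding w w' using conj5_qd[of 1 "2/5"] by simp
  qed (use w \<open>qd 1 (2/5) \<noteq> 0\<close> in simp_all)
  have "w' ^ 2 = 1 / (Z5 * gamma1 * gamma2)"
    using w'(1) g0 Z0 fps_nth_gammas
    by (simp add: g_def fps_divide_unit fps_inverse_mult mult.assoc)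
  moreover have "positive_lead w" "positive_lead w'"
    by (rule positive_leadI[OF w(2)[unfolded qd_of_real] pos(1)],
        rule positive_leadI[OF w'(2)[unfolded qd_of_real] pos(2)])
  ultimately show thesis
    using that w(1) rel unfolding g_def by blast
qed

lemma sqrt_fps_factored:
  assumes "w ^ 2 = P / Q" "fps_nth Q 0 \<noteq> 0"
    and "positive_lead w" "positive_lead U" "positive_lead V"
  shows "sqrt_fps (P * U ^ 2 * V ^ 2 / Q) = w * (U * V)"
proof (rule sqrt_fps_eqI)
  show "(w * (U * V)) ^ 2 = P * U ^ 2 * V ^ 2 / Q"
    using assms(1,2) by (simp add: power_mult_distrib fps_divide_unit mult_ac)
qed (intro positive_lead_mult assms)

lemma rational_Psi5: "fps_rel rat_rel (Psi5 chi K2 Kc) (Psi5 chi K2 Kc)"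
proof -
  define SX SY where "SX = sqrt_fps (bX ^ 2 - 4 * cX)" and "SY = sqrt_fps (bY ^ 2 - 4 * cY)"
  note S = conj5_sqrt_discriminants[folded SX_def SY_def]
  define Xp Xm Yp Ym where "Xp = root_plus 1 bX cX" and "Xm = root_minus 1 bX cX"
    and "Yp = root_plus 1 bY cY" and "Ym = root_minus 1 bY cY"
  note X = root_plus_minus[of bX cX, folded SX_def Xp_def Xm_def, OF S(1)]
    and Y = root_plus_minus[of bY cY, folded SY_def Yp_def Ym_def, OF S(2)]
  have jbY: "jet5 bY (-10) (- (-2)) (-530) (- (-162))"
    by (rule jet5_conj5[OF conj5_bc(1) jet5_bX]) simp_all
  have bX0: "fps_nth bX 0 = qd (-10) (-2)" and bY0: "fps_nth bY 0 = qd (-10) 2"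
    using jet5_bX jbY by (simp_all add: jet5_def jet_def)
  have half: "1/2 * (- qd a b) = of_real (- a / 2 + - b / 2 * sqrt 5)" for a b
    by (simp add: qd_of_real field_simps)
  have roots0: "fps_nth Xp 0 = 1/2 * (- fps_nth bX 0)" "fps_nth Xm 0 = 1/2 * (- fps_nth bX 0)"
    "fps_nth Yp 0 = 1/2 * (- fps_nth bY 0)" "fps_nth Ym 0 = 1/2 * (- fps_nth bY 0)"
    unfolding X(1,2) Y(1,2) using S(3,4) by simp_all
  have X0: "fps_nth Xp 0 = of_real (5 + sqrt 5)" "fps_nth Xm 0 = of_real (5 + sqrt 5)"
    and Y0: "fps_nth Yp 0 = of_real (5 + - 1 * sqrt 5)" "fps_nth Ym 0 = of_real (5 + - 1 * sqrt 5)"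
    unfolding roots0 bX0 bY0 half by simp_all
  have "sqrt 5 ^ 2 < 5 ^ 2"
    by simp
  then have "sqrt 5 < 5"
    by (rule power2_less_imp_less) simp
  then have pos: "5 + sqrt 5 > 0" "5 + - 1 * sqrt 5 > 0"
    by (simp_all add: add_pos_pos)
  have lead: "positive_lead Xp" "positive_lead Xm" "positive_lead Yp" "positive_lead Ym"
    using positive_leadI X0 Y0 pos by blast+
  have nz: "fps_nth Xp 0 \<noteq> 0" "fps_nth Xm 0 \<noteq> 0" "fps_nth Yp 0 \<noteq> 0" "fps_nth Ym 0 \<noteq> 0"
    unfolding X0 Y0 of_real_eq_0_iff using pos by simp_all
  obtain w w' where w: "w ^ 2 = Z5 / (gamma1 * gamma2)" "w' ^ 2 = 1 / (Z5 * gamma1 * gamma2)"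
    "positive_lead w" "positive_lead w'" "fps_rel conj5 w w'"
    by (rule sqrt_prefactors)
  have Z0: "fps_nth Z5 0 \<noteq> 0"
    using Z5_properties(1) by (metis fps_inverse_eq_0 mult_zero_right zero_neq_one)
  have denom: "fps_nth (gamma1 * gamma2) 0 \<noteq> 0" "fps_nth (Z5 * gamma1 * gamma2) 0 \<noteq> 0"
    using fps_nth_gammas Z0 by simp_all
  define p where "p = (Xp * Yp) powi K2 + (Xm * Ym) powi K2"
  define m where "m = (Xp * Ym) powi K2 + (Xm * Yp) powi K2"
  have pm: "fps_rel conj5 p m"
    unfolding p_def m_def
  proof (rule conj5.fps_power_sum)
    have "Xp * Yp + Xm * Ym = fps_const (1/2) * (fps_const (1/2) * (2 * (bX * bY + SX * SY)))"
      unfolding X(1,2) Y(1,2) by (simp add: algebra_simps)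
    then have "Xp * Yp + Xm * Ym = fps_const (1/2) * (bX * bY + SX * SY)"
      by (simp only: fps_half)
    moreover have "Xp * Ym + Xm * Yp = fps_const (1/2) * (fps_const (1/2) * (2 * (bY * bX + - (SX * SY))))"
      unfolding X(1,2) Y(1,2) by (simp add: algebra_simps)
    then have "Xp * Ym + Xm * Yp = fps_const (1/2) * (bY * bX + - (SX * SY))"
      by (simp only: fps_half)
    ultimately show "fps_rel conj5 (Xp * Yp + Xm * Ym) (Xp * Ym + Xm * Yp)"
      using conj5_bc(1) fps_conj5_sym[OF conj5_bc(1)] S(5)
      by (simp only: conj5.fps_mult conj5.fps_add conj5.fps_const conj5.divide conj5.one conj5.numeral)
    have "Xp * Yp * (Xm * Ym) = (Xp * Xm) * (Yp * Ym)" "Xp * Ym * (Xm * Yp) = (Yp * Ym) * (Xp * Xm)"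
      by (simp_all add: mult_ac)
    then show "fps_rel conj5 (Xp * Yp * (Xm * Ym)) (Xp * Ym * (Xm * Yp))"
      unfolding X(4) Y(4) using conj5_bc(2) fps_conj5_sym[OF conj5_bc(2)]
      by (simp only: conj5.fps_mult)
  qed (use nz in simp_all)
  have XY: "fps_rel conj5 (Xp powi K2 + Xm powi K2) (Yp powi K2 + Ym powi K2)"
  proof (rule conj5.fps_power_sum)
    show "fps_rel conj5 (Xp + Xm) (Yp + Ym)" "fps_rel conj5 (Xp * Xm) (Yp * Ym)"
      unfolding X(3,4) Y(3,4) by (intro conj5.fps_minus conj5_bc)+
  qed (use nz in simp_all)
  define e1 where "e1 = eps 5 powi Kc + eps 5 powi (- Kc)"
  define e2 where "e2 = eps 5 powi (2 * Kc) + eps 5 powi (- (2 * Kc))"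
  define T1 where "T1 = fps_const e1 * (gamma1 powi K2 + fps_const ((-1) powi chi) * (Xp powi K2 + Xm powi K2))"
  define T2 where "T2 = fps_const e2 * (gamma2 powi K2 + fps_const ((-1) powi chi) * (Yp powi K2 + Ym powi K2))"
  have e: "conj5 e1 e2"
    unfolding e1_def e2_def eps_powi_add of_real_mult
    using conj5.mult[OF conj5.numeral conj5_cos_fifths(1)[of Kc], of "num.Bit0 num.One"] by simp
  have T: "fps_rel conj5 T1 T2"
    unfolding T1_def T2_def
    by (intro conj5.fps_mult conj5.fps_add conj5.fps_const conj5.fps_powi conj5_gamma XY e
        conj5.powi conj5.minus conj5.one)
  have wpm: "fps_rel conj5 (w powi K2 * p) (w' powi K2 * m)"
    by (intro conj5.fps_mult conj5.fps_powi w pm)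
  have "Psi5 chi K2 Kc = (w * (Xp * Yp)) powi K2 + (w' * (Xp * Ym)) powi K2
      + (w' * (Xm * Yp)) powi K2 + (w * (Xm * Ym)) powi K2 + T1 + T2"
    unfolding Psi5_def Let_def A5_def[symmetric] B5_def[symmetric] bX_def[symmetric] bY_def[symmetric]
      cX_def[symmetric] cY_def[symmetric] Xp_def[symmetric] Xm_def[symmetric] Yp_def[symmetric] Ym_def[symmetric]
      e1_def[symmetric] e2_def[symmetric] T1_def[symmetric] T2_def[symmetric]
    using sqrt_fps_factored[OF w(1) denom(1) w(3)] sqrt_fps_factored[OF w(2) denom(2) w(4)] lead
    by simp
  also have "\<dots> = (w powi K2 * p + w' powi K2 * m) + (T1 + T2)"
    by (simp only: p_def m_def fps_powi_mult[of w] fps_powi_mult[of w'] distrib_left add_ac)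
  finally have "Psi5 chi K2 Kc = (w powi K2 * p + w' powi K2 * m) + (T1 + T2)" .
  moreover have "fps_rel conj5 ((w powi K2 * p + w' powi K2 * m) + (T1 + T2))
      ((w' powi K2 * m + w powi K2 * p) + (T2 + T1))"
    by (intro conj5.fps_add T wpm fps_conj5_sym[OF T] fps_conj5_sym[OF wpm])
  ultimately have "fps_rel conj5 (Psi5 chi K2 Kc) (Psi5 chi K2 Kc)"
    by (simp only: add.commute)
  then show ?thesis
    by (simp only: fps_conj5_refl_iff)
qed

section \<open>Galois groups\<close>

definition complex_subfield :: "complex set \<Rightarrow> bool" where
  "complex_subfield K \<longleftrightarrow> 1 \<in> K \<and> (\<forall>x\<in>K. \<forall>y\<in>K. x - y \<in> K \<and> x * y \<in> K) \<and> (\<forall>x\<in>K. inverse x \<in> K)"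

lemma complex_subfieldD:
  assumes "complex_subfield K"
  shows "1 \<in> K" "0 \<in> K" "x \<in> K \<Longrightarrow> y \<in> K \<Longrightarrow> x - y \<in> K" "x \<in> K \<Longrightarrow> - x \<in> K"
    "x \<in> K \<Longrightarrow> y \<in> K \<Longrightarrow> x + y \<in> K" "x \<in> K \<Longrightarrow> y \<in> K \<Longrightarrow> x * y \<in> K"
    "x \<in> K \<Longrightarrow> inverse x \<in> K" "x \<in> K \<Longrightarrow> y \<in> K \<Longrightarrow> x / y \<in> K"
proof -
  show 1: "1 \<in> K" and diff: "x \<in> K \<Longrightarrow> y \<in> K \<Longrightarrow> x - y \<in> K"
    and "x \<in> K \<Longrightarrow> y \<in> K \<Longrightarrow> x * y \<in> K" "x \<in> K \<Longrightarrow> inverse x \<in> K" for x y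
    using assms by (auto simp: complex_subfield_def)
  then show "x \<in> K \<Longrightarrow> y \<in> K \<Longrightarrow> x / y \<in> K"
    by (simp add: divide_inverse)
  show 0: "0 \<in> K"
    using diff[OF 1 1] by simp
  show minus: "x \<in> K \<Longrightarrow> - x \<in> K" for x
    using diff[OF 0] by fastforce
  show "x \<in> K \<Longrightarrow> y \<in> K \<Longrightarrow> x + y \<in> K"
    using diff[OF _ minus] by fastforce
qed

lemma complex_subfield_Rats:
  assumes "complex_subfield K" "q \<in> \<rat>"
  shows "q \<in> K"
proof -
  have nat: "of_nat n \<in> K" for n
    by (induction n) (auto intro: complex_subfieldD[OF assms(1)])
  have "of_int n \<in> K" for n
    by (cases n rule: int_diff_cases) (auto intro: nat complex_subfieldD[OF assms(1)])
  with \<open>q \<in> \<rat>\<close> show ?thesis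
    by (elim Rats_cases') (auto intro: complex_subfieldD[OF assms(1)])
qed

lemma a_inv_ring_of_type_algebra: "a_inv (ring_of_type_algebra :: complex ring) x = - x"
proof -
  interpret ring "ring_of_type_algebra :: complex ring"
    by (rule ring_from_type_algebra)
  show ?thesis
    by (rule minus_equality) (simp_all add: ring_of_type_algebra_def)
qed

lemma m_inv_ring_of_type_algebra:
  assumes "x \<noteq> 0"
  shows "m_inv (ring_of_type_algebra :: complex ring) x = inverse x"
proof -
  interpret cring "ring_of_type_algebra :: complex ring"
    by (rule cring_from_type_algebra)
  show ?thesis
    using assms by (intro comm_inv_char) (simp_all add: ring_of_type_algebra_def)
qed

lemma ring_of_type_algebra_simps:
  "carrier (ring_of_type_algebra :: complex ring) = UNIV"
  "monoid.mult (ring_of_type_algebra :: complex ring) = (*)"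
  "ring.add (ring_of_type_algebra :: complex ring) = (+)"
  "monoid.one (ring_of_type_algebra :: complex ring) = 1"
  "ring.zero (ring_of_type_algebra :: complex ring) = 0"
  by (simp_all add: ring_of_type_algebra_def fun_eq_iff)

lemma rat_adjoin_incl: "A \<subseteq> rat_adjoin A"
  unfolding rat_adjoin_def by (auto intro: generate_field.incl)

lemma complex_subfield_rat_adjoin: "complex_subfield (rat_adjoin A)"
proof -
  note intros = generate_field.intros[where R = "ring_of_type_algebra :: complex ring",
      unfolded ring_of_type_algebra_simps a_inv_ring_of_type_algebra]
  have "x - y \<in> rat_adjoin A" if "x \<in> rat_adjoin A" "y \<in> rat_adjoin A" for x y
    using intros(5)[OF _ intros(3), of x A y] that by (simp add: rat_adjoin_def)
  moreover have "0 \<in> rat_adjoin A"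
    using calculation[of 1 1] intros(1) by (simp add: rat_adjoin_def)
  moreover have "inverse x \<in> rat_adjoin A" if "x \<in> rat_adjoin A" for x
    using that intros(4)[of x A] calculation(2) m_inv_ring_of_type_algebra[of x]
    by (cases "x = 0") (simp_all add: rat_adjoin_def)
  ultimately show ?thesis
    using intros(1,6) by (simp add: complex_subfield_def rat_adjoin_def)
qed

lemma rat_adjoin_minimal:
  assumes "complex_subfield K" "A \<subseteq> K"
  shows "rat_adjoin A \<subseteq> K"
proof
  fix x
  assume "x \<in> rat_adjoin A"
  then show "x \<in> K"
    unfolding rat_adjoin_def
    by (induction rule: generate_field.induct)
      (use assms in \<open>auto simp: ring_of_type_algebra_simps a_inv_ring_of_type_algebra m_inv_ring_of_type_algebra
        intro: complex_subfieldD[OF assms(1)]\<close>)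
qed

definition field_aut :: "complex set \<Rightarrow> (complex \<Rightarrow> complex) \<Rightarrow> bool" where
  "field_aut L \<sigma> \<longleftrightarrow> bij_betw \<sigma> L L \<and> \<sigma> 1 = 1 \<and>
    (\<forall>x\<in>L. \<forall>y\<in>L. \<sigma> (x + y) = \<sigma> x + \<sigma> y \<and> \<sigma> (x * y) = \<sigma> x * \<sigma> y)"

lemma field_aut_closed: "field_aut L \<sigma> \<Longrightarrow> x \<in> L \<Longrightarrow> \<sigma> x \<in> L"
  by (auto simp: field_aut_def bij_betw_def)

lemma field_iso_of_aut:
  assumes "complex_subfield L" "field_aut L \<sigma>"
  shows "field_iso (\<lambda>x y. x \<in> L \<and> y = \<sigma> x)"
proof
  note L = complex_subfieldD[OF assms(1)]
  have add: "\<sigma> (x + y) = \<sigma> x + \<sigma> y" and mult: "\<sigma> (x * y) = \<sigma> x * \<sigma> y" if "x \<in> L" "y \<in> L" for x y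
    using assms(2) that by (auto simp: field_aut_def)
  have one: "\<sigma> 1 = 1" and inj: "inj_on \<sigma> L"
    using assms(2) by (auto simp: field_aut_def bij_betw_def)
  have zero: "\<sigma> 0 = 0"
    using add[of 0 0] L by simp
  show "1 \<in> L \<and> 1 = \<sigma> 1"
    using L one by simp
  fix a a' b b'
  assume a: "a \<in> L \<and> a' = \<sigma> a"
  show "a = 0 \<longleftrightarrow> a' = 0"
    using a zero inj_onD[OF inj, of a 0] L by auto
  show "inverse a \<in> L \<and> inverse a' = \<sigma> (inverse a)"
  proof (cases "a = 0")
    case False
    then have "\<sigma> a * \<sigma> (inverse a) = 1"
      using mult[of a "inverse a"] a L one by simp
    then show ?thesis
      using a L by (auto intro: inverse_unique)
  qed (use a zero L in auto)
  assume b: "b \<in> L \<and> b' = \<sigma> b"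
  have "\<sigma> (a - b) + \<sigma> b = \<sigma> a"
    using add[of "a - b" b] a b L by simp
  then show "a - b \<in> L \<and> a' - b' = \<sigma> (a - b)"
    using a b L by (auto simp: algebra_simps)
  show "a * b \<in> L \<and> a' * b' = \<sigma> (a * b)"
    using a b mult L by auto
qed

lemma mem_galois_group_iff:
  assumes "complex_subfield L"
  shows "\<sigma> \<in> carrier (galois_group L \<rat>) \<longleftrightarrow> \<sigma> \<in> extensional L \<and> field_aut L \<sigma>"
proof
  assume "\<sigma> \<in> carrier (galois_group L \<rat>)"
  then show "\<sigma> \<in> extensional L \<and> field_aut L \<sigma>"
    by (auto simp: galois_group_def Let_def Bij_def field_aut_def Ring.ring_hom_def ring_of_type_algebra_simps)
next
  assume \<sigma>: "\<sigma> \<in> extensional L \<and> field_aut L \<sigma>"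
  have "\<sigma> x = x" if "x \<in> \<rat>" for x
    using field_iso_Rats[OF field_iso_of_aut[OF assms conjunct2[OF \<sigma>]] that] by simp
  with \<sigma> field_aut_closed[of L \<sigma>] show "\<sigma> \<in> carrier (galois_group L \<rat>)"
    by (auto simp: galois_group_def Let_def Bij_def field_aut_def Ring.ring_hom_def ring_of_type_algebra_simps)
qed

lemma mult_galois_group:
  assumes "\<sigma> \<in> carrier (galois_group L K)" "\<tau> \<in> carrier (galois_group L K)"
  shows "\<sigma> \<otimes>\<^bsub>galois_group L K\<^esub> \<tau> = compose L \<sigma> \<tau>"
  using assms by (simp add: galois_group_def Let_def BijGroup_def)

lemma field_aut_comp:
  assumes "field_aut L \<sigma>" "field_aut L \<tau>"
  shows "field_aut L (\<sigma> \<circ> \<tau>)"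
  using assms field_aut_closed[OF assms(2)] bij_betw_trans[of \<tau> L L \<sigma> L]
  by (auto simp: field_aut_def)

lemma field_aut_funpow:
  assumes "field_aut L \<sigma>"
  shows "field_aut L (\<sigma> ^^ n)"
proof (induction n)
  case (Suc n)
  then show ?case
    using field_aut_comp[OF assms] by (simp only: funpow.simps)
qed (simp add: field_aut_def bij_betw_def)

lemma field_aut_restrict:
  assumes "complex_subfield L"
  shows "field_aut L (restrict \<sigma> L) \<longleftrightarrow> field_aut L \<sigma>"
proof -
  have "bij_betw (restrict \<sigma> L) L L \<longleftrightarrow> bij_betw \<sigma> L L"
    by (rule bij_betw_cong) simp
  then show ?thesis
    by (auto simp: field_aut_def complex_subfieldD[OF assms])
qed

lemma field_aut_eqI:
  assumes "field_aut (rat_adjoin A) \<sigma>" "field_aut (rat_adjoin A) \<tau>" "\<And>a. a \<in> A \<Longrightarrow> \<sigma> a = \<tau> a"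
    and "x \<in> rat_adjoin A"
  shows "\<sigma> x = \<tau> x"
proof -
  let ?L = "rat_adjoin A"
  interpret s: field_iso "\<lambda>x y. x \<in> ?L \<and> y = \<sigma> x"
    by (rule field_iso_of_aut[OF complex_subfield_rat_adjoin assms(1)])
  interpret t: field_iso "\<lambda>x y. x \<in> ?L \<and> y = \<tau> x"
    by (rule field_iso_of_aut[OF complex_subfield_rat_adjoin assms(2)])
  have "complex_subfield {x \<in> ?L. \<sigma> x = \<tau> x}"
    using s.one t.one s.diff t.diff s.mult t.mult s.inverse t.inverse
    by (auto simp: complex_subfield_def) metis+
  then have "?L \<subseteq> {x \<in> ?L. \<sigma> x = \<tau> x}"
    using assms(3) rat_adjoin_incl by (intro rat_adjoin_minimal) auto
  with assms(4) show ?thesis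
    by blast
qed

lemma field_aut_cnj:
  assumes "cnj ` A \<subseteq> rat_adjoin A"
  shows "field_aut (rat_adjoin A) cnj"
proof -
  have "complex_subfield {x \<in> rat_adjoin A. cnj x \<in> rat_adjoin A}"
    by (auto simp: complex_subfield_def intro: complex_subfieldD[OF complex_subfield_rat_adjoin])
  then have "rat_adjoin A \<subseteq> {x \<in> rat_adjoin A. cnj x \<in> rat_adjoin A}"
    using assms rat_adjoin_incl[of A] by (intro rat_adjoin_minimal) auto
  then have "cnj ` rat_adjoin A \<subseteq> rat_adjoin A"
    by auto
  then have "bij_betw cnj (rat_adjoin A) (rat_adjoin A)"
    by (intro bij_betw_byWitness[of _ cnj]) auto
  then show ?thesis
    by (simp add: field_aut_def)
qed

text \<open>An automorphism of \<open>\<rat>(\<alpha>, \<i>)\<close> is determined by the images of \<open>\<alpha>\<close> and \<open>\<i>\<close>, and the composites of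
  \<open>\<rho>\<close> and complex conjugation realise all \<open>2m\<close> combinations of the conjugates of \<open>\<alpha>\<close> and of \<open>\<i>\<close>.\<close>

lemma galois_group_iso:
  fixes \<alpha> :: complex and m :: nat
  defines "L \<equiv> rat_adjoin {\<alpha>, \<i>}"
  assumes \<rho>: "field_aut L \<rho>" "\<rho> \<i> = \<i>"
    and period: "m > 0" "(\<rho> ^^ m) \<alpha> = \<alpha>"
    and inj: "inj_on (\<lambda>k. (\<rho> ^^ k) \<alpha>) {..<m}"
    and conjugates: "\<And>\<sigma>. field_aut L \<sigma> \<Longrightarrow> \<sigma> \<alpha> \<in> (\<lambda>k. (\<rho> ^^ k) \<alpha>) ` {..<m}"
    and real: "\<And>k. cnj ((\<rho> ^^ k) \<alpha>) = (\<rho> ^^ k) \<alpha>"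
  shows "galois_group L \<rat> \<cong> integer_mod_group m \<times>\<times> integer_mod_group 2"
proof -
  have sub: "complex_subfield L"
    unfolding L_def by (rule complex_subfield_rat_adjoin)
  note L = complex_subfieldD[OF sub]
  have gens: "\<alpha> \<in> L" "\<i> \<in> L"
    using rat_adjoin_incl[of "{\<alpha>, \<i>}"] by (auto simp: L_def)
  have cnj: "field_aut L cnj"
    unfolding L_def using real[of 0] gens L(4) by (intro field_aut_cnj) (auto simp: L_def)
  define M where "M a b = (\<rho> ^^ a) \<circ> (cnj ^^ b)" for a b
  have M: "field_aut L (M a b)" for a b
    unfolding M_def by (intro field_aut_comp field_aut_funpow \<rho> cnj)
  have eqI: "\<sigma> x = \<tau> x" if "field_aut L \<sigma>" "field_aut L \<tau>" "\<sigma> \<alpha> = \<tau> \<alpha>" "\<sigma> \<i> = \<tau> \<i>" "x \<in> L" for \<sigma> \<tau> x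
    using field_aut_eqI[of "{\<alpha>, \<i>}" \<sigma> \<tau> x] that by (auto simp: L_def)
  have cnj_real: "(cnj ^^ b) x = x" if "cnj x = x" for b x
    using that by (induction b) simp_all
  have cnj_i: "(cnj ^^ b) \<i> = (-1) ^ b * \<i>" for b
    by (induction b) simp_all
  have \<rho>_minus: "\<rho> (- x) = - \<rho> x" if "x \<in> L" for x
    using field_iso.minus[OF field_iso_of_aut[OF sub \<rho>(1)], of x] that by simp
  have \<rho>_i: "(\<rho> ^^ a) ((-1) ^ b * \<i>) = (-1) ^ b * \<i>" for a b
  proof (induction a)
    case (Suc a)
    have "\<rho> ((-1) ^ b * \<i>) = (-1) ^ b * \<i>"
      using \<rho>(2) \<rho>_minus[OF gens(2)] by (cases "even b") simp_all
    with Suc show ?case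
      by simp
  qed simp
  have M\<alpha>: "M a b \<alpha> = (\<rho> ^^ a) \<alpha>" and Mi: "M a b \<i> = (-1) ^ b * \<i>" for a b
    using cnj_real[OF real[of 0]] by (simp_all add: M_def cnj_i \<rho>_i)
  have MM\<alpha>: "M a b (M a' b' \<alpha>) = (\<rho> ^^ (a + a')) \<alpha>" for a b a' b'
    using cnj_real[OF real[of a']] by (simp add: M\<alpha>) (simp add: M_def funpow_add)
  have MMi: "M a b (M a' b' \<i>) = (-1) ^ (b + b') * \<i>" for a b a' b'
  proof -
    have "(cnj ^^ b) ((-1) ^ b' * \<i>) = (-1) ^ b' * (cnj ^^ b) \<i>"
      by (induction b) simp_all
    also have "\<dots> = (-1) ^ (b + b') * \<i>"
      by (simp only: cnj_i power_add mult_ac)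
    finally show ?thesis
      by (simp only: Mi) (simp only: M_def comp_apply \<rho>_i)
  qed
  define \<phi> where "\<phi> = (\<lambda>(a, b). restrict (M (nat a) (nat b)) L)"
  have carrier: "carrier (integer_mod_group m \<times>\<times> integer_mod_group 2) = {0..<int m} \<times> {0..<2}"
    using period(1) by (simp add: DirProd_def carrier_integer_mod_group)
  have \<phi>_mem: "\<phi> p \<in> carrier (galois_group L \<rat>)" for p
    unfolding mem_galois_group_iff[OF sub] \<phi>_def
    by (cases p) (simp add: field_aut_restrict[OF sub] M)
  have "\<phi> \<in> hom (integer_mod_group m \<times>\<times> integer_mod_group 2) (galois_group L \<rat>)"
  proof (rule homI)
    fix p q
    assume "p \<in> carrier (integer_mod_group m \<times>\<times> integer_mod_group 2)"
      "q \<in> carrier (integer_mod_group m \<times>\<times> integer_mod_group 2)"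
    then obtain a b a' b' where pq: "p = (a, b)" "q = (a', b')" and nonneg: "a \<ge> 0" "b \<ge> 0" "a' \<ge> 0" "b' \<ge> 0"
      unfolding carrier by auto
    have "M (nat ((a + a') mod int m)) (nat ((b + b') mod 2)) x = M (nat a) (nat b) (M (nat a') (nat b') x)"
      if "x \<in> L" for x
    proof -
      have "nat ((a + a') mod int m) = (nat a + nat a') mod m" "nat ((b + b') mod 2) = (nat b + nat b') mod 2"
        using nonneg by (simp_all add: nat_mod_distrib nat_add_distrib)
      moreover have "(-1 :: complex) ^ ((nat b + nat b') mod 2) = (-1) ^ (nat b + nat b')"
        by (metis minus_one_power_iff even_mod_2_iff)
      ultimately have "M (nat ((a + a') mod int m)) (nat ((b + b') mod 2)) \<alpha>
          = M (nat a) (nat b) (M (nat a') (nat b') \<alpha>)"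
        "M (nat ((a + a') mod int m)) (nat ((b + b') mod 2)) \<i>
          = M (nat a) (nat b) (M (nat a') (nat b') \<i>)"
        unfolding MM\<alpha> MMi by (simp_all only: M\<alpha> Mi funpow_mod_eq[OF period(2)])
      then show ?thesis
        using eqI[OF M field_aut_comp[OF M M] _ _ that] by (simp only: comp_apply)
    qed
    then show "\<phi> (p \<otimes>\<^bsub>integer_mod_group m \<times>\<times> integer_mod_group 2\<^esub> q) = \<phi> p \<otimes>\<^bsub>galois_group L \<rat>\<^esub> \<phi> q"
      unfolding mult_galois_group[OF \<phi>_mem \<phi>_mem]
      using field_aut_closed[OF M] by (auto simp: pq \<phi>_def compose_def fun_eq_iff)
  qed (rule \<phi>_mem)
  moreover have "bij_betw \<phi> ({0..<int m} \<times> {0..<2}) (carrier (galois_group L \<rat>))"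
  proof (rule bij_betw_imageI)
    show "inj_on \<phi> ({0..<int m} \<times> {0..<2})"
    proof (rule inj_onI, clarify)
      fix a b a' b' :: int
      assume ab: "a \<in> {0..<int m}" "b \<in> {0..<2}" "a' \<in> {0..<int m}" "b' \<in> {0..<2}"
        and eq: "\<phi> (a, b) = \<phi> (a', b')"
      have "M (nat a) (nat b) x = M (nat a') (nat b') x" if "x \<in> L" for x
        using fun_cong[OF eq, of x] that by (simp add: \<phi>_def)
      from this[OF gens(1)] this[OF gens(2)]
      have "(\<rho> ^^ nat a) \<alpha> = (\<rho> ^^ nat a') \<alpha>" "(-1 :: complex) ^ nat b = (-1) ^ nat b'"
        by (simp_all add: M\<alpha> Mi)
      then have "nat a = nat a'" "even (nat b) \<longleftrightarrow> even (nat b')"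
        using inj_onD[OF inj, of "nat a" "nat a'"] ab by (auto simp: minus_one_power_iff split: if_splits)
      moreover have "b \<in> {0, 1}" "b' \<in> {0, 1}"
        using ab by auto
      ultimately show "a = a' \<and> b = b'"
        using ab by auto
    qed
    show "\<phi> ` ({0..<int m} \<times> {0..<2}) = carrier (galois_group L \<rat>)"
    proof
      show "carrier (galois_group L \<rat>) \<subseteq> \<phi> ` ({0..<int m} \<times> {0..<2})"
      proof
        fix \<sigma>
        assume "\<sigma> \<in> carrier (galois_group L \<rat>)"
        then have \<sigma>: "\<sigma> \<in> extensional L" "field_aut L \<sigma>"
          by (simp_all add: mem_galois_group_iff[OF sub])
        obtain a where a: "a < m" "\<sigma> \<alpha> = (\<rho> ^^ a) \<alpha>"
          using conjugates[OF \<sigma>(2)] by auto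
        have "\<sigma> \<i> * \<sigma> \<i> = \<sigma> (\<i> * \<i>)"
          using \<sigma>(2) gens unfolding field_aut_def by metis
        also have "\<sigma> (\<i> * \<i>) = - 1"
          using field_iso_Rats[OF field_iso_of_aut[OF sub \<sigma>(2)], of "-1"] by simp
        finally have "(\<sigma> \<i> - \<i>) * (\<sigma> \<i> + \<i>) = 0"
          by (simp add: algebra_simps)
        then have "\<sigma> \<i> = (-1) ^ 0 * \<i> \<or> \<sigma> \<i> = (-1) ^ 1 * \<i>"
          by (auto simp: add_eq_0_iff2)
        then obtain b :: nat where b: "b < 2" "\<sigma> \<i> = (-1) ^ b * \<i>"
          by (metis one_less_numeral_iff pos2 semiring_norm(76))
        have "\<sigma> = \<phi> (int a, int b)"
          using eqI[OF \<sigma>(2) M, of a b] a b \<sigma>(1)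
          by (intro extensionalityI[of _ L]) (auto simp: \<phi>_def M\<alpha> Mi)
        with a(1) b(1) show "\<sigma> \<in> \<phi> ` ({0..<int m} \<times> {0..<2})"
          by auto
      qed
    qed (use \<phi>_mem in auto)
  qed
  ultimately have "\<phi> \<in> iso (integer_mod_group m \<times>\<times> integer_mod_group 2) (galois_group L \<rat>)"
    unfolding iso_def carrier by simp
  then have "integer_mod_group m \<times>\<times> integer_mod_group 2 \<cong> galois_group L \<rat>"
    by (rule is_isoI)
  then show ?thesis
    by (rule group.iso_sym[OF DirProd_group[OF group_integer_mod_group group_integer_mod_group]])
qed

lemma field_aut_of_rel:
  assumes R: "field_iso R" and mem: "\<And>x y. R x y \<Longrightarrow> x \<in> rat_adjoin A \<and> y \<in> rat_adjoin A"
    and gens: "\<And>a. a \<in> A \<Longrightarrow> (\<exists>y. R a y) \<and> (\<exists>x. R x a)"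
  obtains \<sigma> where "field_aut (rat_adjoin A) \<sigma>" "\<And>x y. R x y \<Longrightarrow> \<sigma> x = y"
proof
  interpret field_iso R by fact
  define \<sigma> where "\<sigma> x = (THE y. R x y)" for x
  have \<sigma>: "\<sigma> x = y" if "R x y" for x y
    unfolding \<sigma>_def using that functional by blast
  then show "\<sigma> x = y" if "R x y" for x y
    using that .
  have "complex_subfield {x. \<exists>y. R x y}"
    unfolding complex_subfield_def using one diff mult inverse by blast
  then have dom: "\<exists>y. R x y" if "x \<in> rat_adjoin A" for x
    using rat_adjoin_minimal[of _ A] gens that by blast
  have "complex_subfield {y. \<exists>x. R x y}"
    unfolding complex_subfield_def using one diff mult inverse by blast
  then have ran: "\<exists>x. R x y" if "y \<in> rat_adjoin A" for y
    using rat_adjoin_minimal[of _ A] gens that by blast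
  have rel: "R x (\<sigma> x)" if "x \<in> rat_adjoin A" for x
    using dom[OF that] \<sigma> by auto
  have "bij_betw \<sigma> (rat_adjoin A) (rat_adjoin A)"
  proof (rule bij_betw_imageI)
    show "inj_on \<sigma> (rat_adjoin A)"
      by (rule inj_onI) (metis rel injective)
    show "\<sigma> ` rat_adjoin A = rat_adjoin A"
      using rel mem ran \<sigma> by (auto simp: image_iff) metis
  qed
  then show "field_aut (rat_adjoin A) \<sigma>"
    unfolding field_aut_def using \<sigma>[OF one] \<sigma>[OF add[OF rel rel]] \<sigma>[OF mult[OF rel rel]] by blast
qed

lemma adjoin_closed:
  assumes "complex_subfield L" "\<And>x y. R x y \<Longrightarrow> x \<in> L \<and> y \<in> L" "d \<in> L" "e \<in> L" "adjoin R d e x y"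
  shows "x \<in> L \<and> y \<in> L"
proof -
  obtain a a' b b' where "R a a'" "R b b'" "x = a + b * d" "y = a' + b' * e"
    using assms(5) by (auto simp: adjoin_def)
  moreover from this have "a \<in> L" "a' \<in> L" "b \<in> L" "b' \<in> L"
    using assms(2) by auto
  ultimately show ?thesis
    using assms(3,4) complex_subfieldD(5,6)[OF assms(1)] by simp
qed

lemma complex_subfield_Reals: "complex_subfield \<real>"
  by (simp add: complex_subfield_def)

lemma rat_rel_closed: "complex_subfield L \<Longrightarrow> rat_rel x y \<Longrightarrow> x \<in> L \<and> y \<in> L"
  using complex_subfield_Rats by (auto simp: rat_rel_def)

lemma field_iso_adjoin_ii:
  assumes R: "field_iso R" and real: "\<And>x y. R x y \<Longrightarrow> x \<in> \<real> \<and> y \<in> \<real>"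
  shows "field_iso (adjoin R \<i> \<i>)"
proof (rule field_iso.field_iso_adjoin[OF R])
  have "\<i> \<notin> \<real>"
    by (simp add: complex_is_Real_iff)
  then show "\<not> R \<i> a" "\<not> R a \<i>" for a
    using real by blast+
  show "R (\<i> ^ 2) (\<i> ^ 2)"
    using field_iso_Rats[OF R, of "-1"] by simp
qed

lemma field_aut_powers:
  assumes "complex_subfield L" "field_aut L \<sigma>" "x \<in> L"
  shows "\<sigma> (x ^ n) = \<sigma> x ^ n"
  using field_iso.power[OF field_iso_of_aut[OF assms(1,2)], of x "\<sigma> x" n] assms(3) by simp

lemma field_aut_rat:
  assumes "complex_subfield L" "field_aut L \<sigma>" "x \<in> \<rat>"
  shows "\<sigma> x = x"
  using field_iso_Rats[OF field_iso_of_aut[OF assms(1,2)] assms(3)] by simp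

lemma galois_group_sqrt_ii:
  assumes "Factorial_Ring.prime (p::nat)"
  shows "galois_group (rat_adjoin {of_real (sqrt (real p)), \<i>}) \<rat> \<cong> integer_mod_group 2 \<times>\<times> integer_mod_group 2"
proof -
  define \<delta> where "\<delta> = complex_of_real (sqrt (real p))"
  define L where "L = rat_adjoin {\<delta>, \<i>}"
  have \<delta>: "\<delta> \<notin> \<rat>" "\<delta> ^ 2 = of_nat p" "\<delta> \<in> \<real>" "\<delta> \<noteq> 0"
    using sqrt_prime_irrational[OF assms] prime_gt_0_nat[OF assms]
    by (auto simp: \<delta>_def of_real_in_Rats_iff simp flip: of_real_power)
  have sub: "complex_subfield L"
    unfolding L_def by (rule complex_subfield_rat_adjoin)
  have gens: "\<delta> \<in> L" "\<i> \<in> L"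
    unfolding L_def using rat_adjoin_incl[of "{\<delta>, \<i>}"] by auto
  define R0 where "R0 = adjoin rat_rel \<delta> (- \<delta>)"
  have R0: "field_iso R0"
    unfolding R0_def
  proof (rule rat.field_iso_adjoin)
    show "\<not> rat_rel \<delta> a" "\<not> rat_rel a (- \<delta>)" for a
      using \<delta>(1) by (auto simp: rat_rel_def)
  qed (simp add: \<delta>(2) rat_rel_def)
  interpret R0: field_iso R0 by fact
  have "R0 x y \<Longrightarrow> x \<in> \<real> \<and> y \<in> \<real>" for x y
    unfolding R0_def using \<delta>(3)
    by (intro adjoin_closed[OF complex_subfield_Reals rat_rel_closed[OF complex_subfield_Reals]]) auto
  then have R: "field_iso (adjoin R0 \<i> \<i>)"
    by (rule field_iso_adjoin_ii[OF R0])
  have "R0 x y \<Longrightarrow> x \<in> L \<and> y \<in> L" for x y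
    unfolding R0_def using gens complex_subfieldD(4)[OF sub]
    by (intro adjoin_closed[OF sub rat_rel_closed[OF sub]]) auto
  then have mem: "x \<in> L \<and> y \<in> L" if "adjoin R0 \<i> \<i> x y" for x y
    by (rule adjoin_closed[OF sub _ gens(2) gens(2) that])
  have rel: "adjoin R0 \<i> \<i> \<delta> (- \<delta>)" "adjoin R0 \<i> \<i> (- \<delta>) \<delta>" "adjoin R0 \<i> \<i> \<i> \<i>"
    using R0.adjoin_incl[OF rat.adjoin_gen[of \<delta> "- \<delta>", folded R0_def]]
      R0.adjoin_incl[OF R0.minus[OF rat.adjoin_gen[of \<delta> "- \<delta>", folded R0_def]]] R0.adjoin_gen
    by simp_all
  have "(\<exists>y. adjoin R0 \<i> \<i> a y) \<and> (\<exists>x. adjoin R0 \<i> \<i> x a)" if "a \<in> {\<delta>, \<i>}" for a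
    using rel that by auto
  then obtain \<rho> where \<rho>: "field_aut L \<rho>" "\<And>x y. adjoin R0 \<i> \<i> x y \<Longrightarrow> \<rho> x = y"
    unfolding L_def using field_aut_of_rel[OF R mem[unfolded L_def]] by blast
  have \<rho>_simps: "\<rho> \<delta> = - \<delta>" "\<rho> (- \<delta>) = \<delta>" "\<rho> \<i> = \<i>"
    using \<rho>(2) rel by auto
  have orbit: "(\<rho> ^^ k) \<delta> \<in> {\<delta>, - \<delta>}" for k
    by (induction k) (auto simp: \<rho>_simps)
  have "galois_group L \<rat> \<cong> integer_mod_group 2 \<times>\<times> integer_mod_group 2"
  proof (rule galois_group_iso[where \<alpha> = \<delta>, folded L_def])
    show "field_aut L \<rho>" "\<rho> \<i> = \<i>" "(2::nat) > 0" "(\<rho> ^^ 2) \<delta> = \<delta>"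
      using \<rho>(1) \<rho>_simps by (simp_all add: numeral_2_eq_2)
    show "inj_on (\<lambda>k. (\<rho> ^^ k) \<delta>) {..<2}"
      using \<delta>(4) by (auto simp: inj_on_def less_2_cases_iff \<rho>_simps)
    show "cnj ((\<rho> ^^ k) \<delta>) = (\<rho> ^^ k) \<delta>" for k
      using orbit[of k] \<delta>(3) by (auto simp: Reals_cnj_iff)
    fix \<sigma>
    assume \<sigma>: "field_aut L \<sigma>"
    have "\<sigma> \<delta> ^ 2 = \<delta> ^ 2"
      unfolding field_aut_powers[OF sub \<sigma> gens(1), symmetric] \<delta>(2) by (rule field_aut_rat[OF sub \<sigma>]) simp
    then have "\<sigma> \<delta> = (\<rho> ^^ 0) \<delta> \<or> \<sigma> \<delta> = (\<rho> ^^ 1) \<delta>"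
      by (auto simp: power2_eq_iff \<rho>_simps)
    moreover have "{..<2} = {0, 1::nat}"
      by auto
    ultimately show "\<sigma> \<delta> \<in> (\<lambda>k. (\<rho> ^^ k) \<delta>) ` {..<2}"
      by simp
  qed
  then show ?thesis
    by (simp add: L_def \<delta>_def)
qed

lemma galois_group_eps5_ii:
  "galois_group (rat_adjoin {eps 5, \<i>}) \<rat> \<cong> integer_mod_group 4 \<times>\<times> integer_mod_group 2"
proof -
  define \<kappa> where "\<kappa> = complex_of_real (2 * sin (2 * pi / 5))"
  define \<kappa>' where "\<kappa>' = r5 / \<kappa>"
  define L where "L = rat_adjoin {\<kappa>, \<i>}"
  have sub: "complex_subfield L"
    unfolding L_def by (rule complex_subfield_rat_adjoin)
  note L = complex_subfieldD[OF sub]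
  have gens: "\<kappa> \<in> L" "\<i> \<in> L"
    unfolding L_def using rat_adjoin_incl[of "{\<kappa>, \<i>}"] by auto
  have sq: "\<kappa> ^ 2 = qd (5/2) (1/2)"
  proof -
    have "(2 * sin (2 * pi / 5)) ^ 2 = 4 - 4 * cos (2 * pi / 5) ^ 2"
      using sin_squared_eq[of "2 * pi / 5"] by (simp add: power_mult_distrib)
    also have "\<dots> = 5/2 + 1/2 * sqrt 5"
      unfolding cos_fifths by (simp add: power2_eq_square field_simps)
    finally show ?thesis
      by (simp only: \<kappa>_def qd_of_real of_real_power[symmetric])
  qed
  have r5_pos: "sqrt 5 > 0"
    by simp
  have "qd (5/2) (1/2) \<noteq> 0"
    unfolding qd_of_real of_real_eq_0_iff using r5_pos by linarith
  then have "\<kappa> \<noteq> 0"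
    using sq by auto
  have r5_nz: "r5 \<noteq> 0"
    by (simp add: r5_def)
  have \<kappa>\<kappa>': "\<kappa> * \<kappa>' = r5" and "\<kappa>' \<noteq> 0"
    using \<open>\<kappa> \<noteq> 0\<close> r5_nz by (simp_all add: \<kappa>'_def)
  have sq': "\<kappa>' ^ 2 = qd (5/2) (-1/2)"
  proof -
    have "qd (5/2) (1/2) * qd (5/2) (-1/2) = r5 * r5"
      unfolding r5_square by (simp add: qd_simps) (simp add: qd_def)
    also have "\<dots> = \<kappa> ^ 2 * \<kappa>' ^ 2"
      unfolding \<kappa>\<kappa>'[symmetric] by (simp add: power2_eq_square mult_ac)
    finally show ?thesis
      using \<open>qd (5/2) (1/2) \<noteq> 0\<close> unfolding sq by (metis mult_cancel_left)
  qed
  have conj_sq: "conj5 (\<kappa> ^ 2) (\<kappa>' ^ 2)" "conj5 (\<kappa>' ^ 2) (\<kappa> ^ 2)"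
    unfolding sq sq' using conj5_qd[of "5/2" "1/2"] conj5_qd[of "5/2" "-1/2"] by simp_all
  text \<open>If \<open>\<kappa>\<close> had a conjugate \<open>y\<close> over \<open>\<rat>(\<surd>5)\<close>, then \<open>\<kappa> y\<close> would be a rational number with
    square \<open>5\<close>.\<close>
  have not_conj: "\<not> conj5 x y" if x: "x ^ 2 * x' ^ 2 = r5 ^ 2" "conj5 (x ^ 2) (x' ^ 2)" for x x' y
  proof
    assume xy: "conj5 x y"
    have "y ^ 2 = x' ^ 2"
      using conj5.functional[OF conj5.power[OF xy] x(2)] .
    then have "(x * y) ^ 2 = r5 ^ 2"
      using x(1) by (simp add: power_mult_distrib)
    then have "x * y = r5 \<or> x * y = - r5"
      by (simp add: power2_eq_iff)
    moreover have "conj5 (x * y) (x * y)"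
      using conj5.mult[OF xy conj5_sym[OF xy]] by (simp add: mult.commute)
    then have "x * y \<in> \<rat>"
      by (simp add: conj5_refl_iff)
    ultimately show False
      using r5_irrational by auto
  qed
  have prod_sq: "\<kappa> ^ 2 * \<kappa>' ^ 2 = r5 ^ 2" "\<kappa>' ^ 2 * \<kappa> ^ 2 = r5 ^ 2"
    unfolding \<kappa>\<kappa>'[symmetric] by (simp_all add: power_mult_distrib)
  define R0 where "R0 = adjoin conj5 \<kappa> \<kappa>'"
  have R0: "field_iso R0"
    unfolding R0_def using not_conj[OF prod_sq(1) conj_sq(1)] not_conj[OF prod_sq(2) conj_sq(2)] conj5_sym
    by (intro conj5.field_iso_adjoin conj_sq) blast+
  interpret R0: field_iso R0 by fact
  have real: "\<kappa> \<in> \<real>" "\<kappa>' \<in> \<real>" "r5 \<in> \<real>"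
    by (simp_all add: \<kappa>_def \<kappa>'_def r5_def)
  have conj5_closed: "x \<in> K \<and> y \<in> K" if "complex_subfield K" "r5 \<in> K" "conj5 x y" for K x y
    using that complex_subfieldD(4)[OF that(1)] unfolding conj5_def
    by (intro adjoin_closed[OF that(1) rat_rel_closed[OF that(1)]]) auto
  have "R0 x y \<Longrightarrow> x \<in> \<real> \<and> y \<in> \<real>" for x y
    unfolding R0_def using real
    by (intro adjoin_closed[OF complex_subfield_Reals conj5_closed[OF complex_subfield_Reals]]) auto
  then have R: "field_iso (adjoin R0 \<i> \<i>)"
    by (rule field_iso_adjoin_ii[OF R0])
  have r5_eq: "r5 = 2 * \<kappa> ^ 2 - 5"
    unfolding sq by (simp add: qd_def)
  have "\<kappa> ^ 2 \<in> L"
    unfolding power2_eq_square by (intro L gens)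
  then have "r5 \<in> L"
    unfolding r5_eq using complex_subfield_Rats[OF sub] by (intro L) auto
  then have "\<kappa>' \<in> L"
    unfolding \<kappa>'_def by (intro L gens)
  have "R0 x y \<Longrightarrow> x \<in> L \<and> y \<in> L" for x y
    unfolding R0_def using gens \<open>\<kappa>' \<in> L\<close>
    by (intro adjoin_closed[OF sub conj5_closed[OF sub \<open>r5 \<in> L\<close>]]) auto
  then have mem: "x \<in> L \<and> y \<in> L" if "adjoin R0 \<i> \<i> x y" for x y
    by (rule adjoin_closed[OF sub _ gens(2) gens(2) that])
  have R0_\<kappa>: "R0 \<kappa> \<kappa>'"
    unfolding R0_def by (rule conj5.adjoin_gen)
  have "R0 (r5 / \<kappa>) (- r5 / \<kappa>')"
    by (intro R0.divide R0_\<kappa>) (unfold R0_def, rule conj5.adjoin_incl[OF conj5_r5])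
  moreover have "- r5 / \<kappa>' = - \<kappa>"
    using \<kappa>\<kappa>' \<open>\<kappa>' \<noteq> 0\<close> by (simp add: field_simps)
  ultimately have R0_\<kappa>': "R0 \<kappa>' (- \<kappa>)"
    by (simp add: \<kappa>'_def)
  have rel: "adjoin R0 \<i> \<i> \<kappa> \<kappa>'" "adjoin R0 \<i> \<i> \<kappa>' (- \<kappa>)" "adjoin R0 \<i> \<i> (- \<kappa>) (- \<kappa>')"
    "adjoin R0 \<i> \<i> (- \<kappa>') \<kappa>" "adjoin R0 \<i> \<i> \<i> \<i>"
    using R0.minus[OF R0_\<kappa>'] by (auto intro: R0.adjoin_incl R0.adjoin_gen R0_\<kappa> R0_\<kappa>' R0.minus)
  have "(\<exists>y. adjoin R0 \<i> \<i> a y) \<and> (\<exists>x. adjoin R0 \<i> \<i> x a)" if "a \<in> {\<kappa>, \<i>}" for a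
    using rel that by auto
  then obtain \<rho> where \<rho>: "field_aut L \<rho>" "\<And>x y. adjoin R0 \<i> \<i> x y \<Longrightarrow> \<rho> x = y"
    unfolding L_def using field_aut_of_rel[OF R mem[unfolded L_def]] by blast
  have \<rho>_simps: "\<rho> \<kappa> = \<kappa>'" "\<rho> \<kappa>' = - \<kappa>" "\<rho> (- \<kappa>) = - \<kappa>'" "\<rho> (- \<kappa>') = \<kappa>" "\<rho> \<i> = \<i>"
    using \<rho>(2) rel by auto
  have orbit: "(\<rho> ^^ k) \<kappa> \<in> {\<kappa>, \<kappa>', - \<kappa>, - \<kappa>'}" for k
  proof (induction k)
    case (Suc k)
    then have "(\<rho> ^^ k) \<kappa> = \<kappa> \<or> (\<rho> ^^ k) \<kappa> = \<kappa>' \<or> (\<rho> ^^ k) \<kappa> = - \<kappa> \<or> (\<rho> ^^ k) \<kappa> = - \<kappa>'"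
      by simp
    then show ?case
      by (elim disjE) (simp_all add: \<rho>_simps)
  qed simp
  have orbit_list: "(\<rho> ^^ 0) \<kappa> = \<kappa>" "(\<rho> ^^ 1) \<kappa> = \<kappa>'" "(\<rho> ^^ 2) \<kappa> = - \<kappa>" "(\<rho> ^^ 3) \<kappa> = - \<kappa>'" "(\<rho> ^^ 4) \<kappa> = \<kappa>"
    by (simp_all add: eval_nat_numeral \<rho>_simps)
  have "\<kappa> ^ 2 \<noteq> \<kappa>' ^ 2"
    unfolding sq sq' by (simp add: qd_def r5_nz)
  then have distinct: "\<kappa> \<noteq> \<kappa>'" "\<kappa> \<noteq> - \<kappa>'" "- \<kappa> \<noteq> \<kappa>'" "\<kappa> \<noteq> - \<kappa>" "\<kappa>' \<noteq> - \<kappa>'"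
    using \<open>\<kappa> \<noteq> 0\<close> \<open>\<kappa>' \<noteq> 0\<close> by auto
  have "galois_group L \<rat> \<cong> integer_mod_group 4 \<times>\<times> integer_mod_group 2"
  proof (rule galois_group_iso[where \<alpha> = \<kappa>, folded L_def])
    show "field_aut L \<rho>" "\<rho> \<i> = \<i>" "(4::nat) > 0" "(\<rho> ^^ 4) \<kappa> = \<kappa>"
      using \<rho>(1) \<rho>_simps orbit_list by simp_all
    have four: "{..<4} = {0, 1, 2, 3::nat}"
      by auto
    show "inj_on (\<lambda>k. (\<rho> ^^ k) \<kappa>) {..<4}"
      unfolding four using distinct distinct[symmetric] orbit_list by (simp add: inj_on_def)
    show "cnj ((\<rho> ^^ k) \<kappa>) = (\<rho> ^^ k) \<kappa>" for k
      using orbit[of k] real by (auto simp: Reals_cnj_iff)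
    fix \<sigma>
    assume \<sigma>: "field_aut L \<sigma>"
    interpret s: field_iso "\<lambda>x y. x \<in> L \<and> y = \<sigma> x"
      by (rule field_iso_of_aut[OF sub \<sigma>])
    have "(2 * \<sigma> \<kappa> ^ 2 - 5) ^ 2 = \<sigma> ((2 * \<kappa> ^ 2 - 5) ^ 2)"
      using s.power[OF s.diff[OF s.mult[OF s.numeral s.power] s.numeral], of \<kappa> "\<sigma> \<kappa>"] gens by simp
    also have "\<dots> = r5 ^ 2"
      unfolding r5_eq[symmetric] using field_aut_rat[OF sub \<sigma>, of 5] by (simp add: power2_eq_square r5_square)
    finally have "2 * \<sigma> \<kappa> ^ 2 - 5 = r5 \<or> 2 * \<sigma> \<kappa> ^ 2 - 5 = - r5"
      by (simp add: power2_eq_iff)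
    then have "\<sigma> \<kappa> ^ 2 = \<kappa> ^ 2 \<or> \<sigma> \<kappa> ^ 2 = \<kappa>' ^ 2"
      unfolding sq sq' by (auto simp: qd_def field_simps)
    then have "\<sigma> \<kappa> \<in> {\<kappa>, \<kappa>', - \<kappa>, - \<kappa>'}"
      by (auto simp: power2_eq_iff)
    then show "\<sigma> \<kappa> \<in> (\<lambda>k. (\<rho> ^^ k) \<kappa>) ` {..<4}"
      unfolding four using orbit_list by auto
  qed
  moreover have "rat_adjoin {eps 5, \<i>} = L"
  proof
    define E where "E = rat_adjoin {eps 5, \<i>}"
    have E: "complex_subfield E"
      unfolding E_def by (rule complex_subfield_rat_adjoin)
    have "eps 5 \<in> E" "\<i> \<in> E"
      unfolding E_def using rat_adjoin_incl[of "{eps 5, \<i>}"] by auto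
    have "\<kappa> = (eps 5 - inverse (eps 5)) / \<i>"
      unfolding \<kappa>_def eps_eq_cis cis_inverse by (simp add: complex_eq_iff)
    then have "\<kappa> \<in> E"
      using \<open>eps 5 \<in> E\<close> \<open>\<i> \<in> E\<close> by (simp only:) (intro complex_subfieldD[OF E])
    then show "L \<subseteq> rat_adjoin {eps 5, \<i>}"
      using \<open>\<i> \<in> E\<close> E unfolding L_def E_def by (intro rat_adjoin_minimal) auto
    have "eps 5 = (r5 - 1) / 4 + \<i> * \<kappa> / 2"
      unfolding \<kappa>_def eps_eq_cis r5_def using cos_fifths(1) by (simp add: complex_eq_iff)
    moreover have "(r5 - 1) / 4 + \<i> * \<kappa> / 2 \<in> L"
      using complex_subfield_Rats[OF sub] by (intro L gens \<open>r5 \<in> L\<close>) auto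
    ultimately show "rat_adjoin {eps 5, \<i>} \<subseteq> L"
      using gens by (intro rat_adjoin_minimal[OF sub]) auto
  qed
  ultimately show ?thesis
    by simp
qed

lemma rational_imp_invariant:
  assumes "fps_rel rat_rel F F" "L = rat_adjoin A"
  shows "has_coeffs_in F L" "galois_invariant L F" "has_coeffs_in F \<rat>"
proof -
  show rat: "has_coeffs_in F \<rat>"
    using assms(1) by (simp add: fps_rel_rat_rel_iff)
  have sub: "complex_subfield L"
    unfolding assms by (rule complex_subfield_rat_adjoin)
  then show "has_coeffs_in F L"
    using rat complex_subfield_Rats by (auto simp: has_coeffs_in_def)
  show "galois_invariant L F"
    using rat field_aut_rat[OF sub]
    by (auto simp: galois_invariant_def mem_galois_group_iff[OF sub] coeffwise_def has_coeffs_in_def intro!: fps_ext)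
qed

theorem proposition4p4:
  fixes S :: "('x, 'h::ab_group_add) surface_data" and c1 :: 'h
    and chi K2 Kc1 :: int and L3 L4 L5 :: "complex set"
    and Psi_3 Psi_4 Psi_5 Z :: "complex fps"
  assumes "surface_axioms S"
    and "H1_trivial S"
    and "geometric_genus S > 0"
    and "basic_classes S = {0, canonical S}" and "canonical S \<noteq> 0"
    and "chi = holomorphic_euler S" and "K2 = canonical_square S" and "Kc1 = canonical_degree S c1"
    and "L3 = rat_adjoin {of_real (sqrt 3), \<i>}"
    and "L4 = rat_adjoin {of_real (sqrt 2), \<i>}"
    and "L5 = rat_adjoin {eps 5, \<i>}"
    and "Psi_3 = Psi3 chi K2 Kc1"
    and "is_Z4 Z" and "Psi_4 = Psi4 Z chi K2 Kc1"
    and "Psi_5 = Psi5 chi K2 Kc1"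
  shows "has_coeffs_in Psi_3 L3 \<and> galois_invariant L3 Psi_3
           \<and> galois_group L3 \<rat> \<cong> integer_mod_group 2 \<times>\<times> integer_mod_group 2
       \<and> has_coeffs_in Psi_4 L4 \<and> galois_invariant L4 Psi_4
           \<and> galois_group L4 \<rat> \<cong> integer_mod_group 2 \<times>\<times> integer_mod_group 2
       \<and> has_coeffs_in Psi_5 L5 \<and> galois_invariant L5 Psi_5
           \<and> galois_group L5 \<rat> \<cong> integer_mod_group 4 \<times>\<times> integer_mod_group 2
       \<and> has_coeffs_in Psi_3 \<rat> \<and> has_coeffs_in Psi_4 \<rat> \<and> has_coeffs_in Psi_5 \<rat>"
  using rational_imp_invariant[OF rational_Psi3 assms(9)] rational_imp_invariant[OF rational_Psi4[OF assms(13)] assms(10)]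
    rational_imp_invariant[OF rational_Psi5 assms(11)]
    galois_group_sqrt_ii[of 3] galois_group_sqrt_ii[of 2] galois_group_eps5_ii
  unfolding assms(9-12,14,15) by simp

end
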